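(* Let $r\ge1$ and $0\le\epsilon<1/2$, and consider any perturbation $\hat V$ with strength $\epsilon$ and range $r$. For $\sigma\in\{0,1\}$ let $|g_\sigma\rangle$ and $|\tilde g_\sigma\rangle$ be the ground states of $\hat H_0$ and of $\hat H_0+\hat V$, respectively, in the sector of fermionic parity $\sigma$. Then there is a family of real antisymmetric $2N\times 2N$ matrices $D(u)$, $u\in[0,1]$, with the following properties. - Set $\hat D(u)=\frac{i}{4}\sum_{p,q=1}^{2N}D_{p,q}(u)c_pc_q$ and let $\hat U=\mathcal T\exp[i\int_0^1 du\,\hat D(u)]$. Then $|g_\sigma\rangle=\hat U|\tilde g_\sigma\rangle$ up to an overall phase, for both $\sigma=0,1$. - $\|D(u)\|\le\frac{3\epsilon}{1-2\epsilon}$ for all $u\in[0,1]$ and all $N$. - If moreover $\epsilon<1/4$, then $|D_{p,q}(u)|\le c\,\epsilon r^2(2/3)^{\frac{|p-q|}{4r}}$ for all $p,q$ and all $u$, where $c>0$ is an absolute constant.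
   Context: Fix an integer $N\ge 2$. Let $c_1,\dots,c_{2N}$ be Majorana operators on the $2^N$-dimensional fermionic Fock space of $N$ modes: self-adjoint, with $c_pc_q+c_qc_p=2\delta_{p,q}I$. The unperturbed Hamiltonian is $\hat H_0=\frac{i}{2}\sum_{j=1}^{N-1}c_{2j}c_{2j+1}$. A perturbation is $\hat V=\frac{i}{4}\sum_{p,q=1}^{2N}V_{p,q}c_pc_q$ with $V$ a real antisymmetric $2N\times 2N$ matrix. It has strength $\epsilon$ if $\|V\|\le\epsilon$ (operator norm). It has range $r$ if $V_{p,q}=0$ whenever $|p-q|>r$. The fermionic parity operator is $\hat P=\prod_{j=1}^N(-i)c_{2j-1}c_{2j}$. A vector has parity $\sigma\in\{0,1\}$ if it is an eigenvector of $\hat P$ with eigenvalue $(-1)^\sigma$. The ground state in the parity-$\sigma$ sector is the lowest-energy eigenvector of the Hamiltonian restricted to that sector; it is unique up to phase under the stated hypotheses. $\mathcal T\exp[i\int_0^1du\,\hat D(u)]$ denotes $\hat U(1)$, where $\hat U(u)$ solves $\partial_u\hat U(u)=i\hat D(u)\hat U(u)$ with $\hat U(0)=I$. *)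

theory Defs
  imports "HOL-Analysis.Analysis" "Jordan_Normal_Form.Matrix"
begin

text \<open>Operators on the 2^N-dimensional Fock space are complex (2^N x 2^N) matrices.
  Majorana operators are indexed by p in {1..2N}; coefficient matrices V, D are
  functions nat => nat => real, indexed by {1..2N}.\<close>

definition self_adjoint_mat :: "complex mat \<Rightarrow> bool" where
  "self_adjoint_mat A \<longleftrightarrow> (\<forall>i<dim_row A. \<forall>j<dim_col A. A $$ (i,j) = cnj (A $$ (j,i)))"

definition majorana_ops :: "nat \<Rightarrow> (nat \<Rightarrow> complex mat) \<Rightarrow> bool" where
  "majorana_ops N c \<longleftrightarrow>
     (\<forall>p\<in>{1..2*N}. c p \<in> carrier_mat (2^N) (2^N) \<and> self_adjoint_mat (c p)) \<and>
     (\<forall>p\<in>{1..2*N}. \<forall>q\<in>{1..2*N}.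
        c p * c q + c q * c p = (if p = q then 2 else 0) \<cdot>\<^sub>m 1\<^sub>m (2^N))"

definition quad_op :: "nat \<Rightarrow> (nat \<Rightarrow> complex mat) \<Rightarrow> (nat \<Rightarrow> nat \<Rightarrow> real) \<Rightarrow> complex mat" where
  "quad_op N c M = mat (2^N) (2^N) (\<lambda>(a,b).
      (\<i>/4) * (\<Sum>p\<in>{1..2*N}. \<Sum>q\<in>{1..2*N}. complex_of_real (M p q) * (c p * c q) $$ (a,b)))"

definition H0_op :: "nat \<Rightarrow> (nat \<Rightarrow> complex mat) \<Rightarrow> complex mat" where
  "H0_op N c = mat (2^N) (2^N) (\<lambda>(a,b).
      (\<i>/2) * (\<Sum>j\<in>{1..N-1}. (c (2*j) * c (2*j+1)) $$ (a,b)))"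

definition parity_op :: "nat \<Rightarrow> (nat \<Rightarrow> complex mat) \<Rightarrow> complex mat" where
  "parity_op N c = foldl (\<lambda>M j. M * ((-\<i>) \<cdot>\<^sub>m (c (2*j-1) * c (2*j)))) (1\<^sub>m (2^N)) [1..<N+1]"

definition real_antisym :: "nat \<Rightarrow> (nat \<Rightarrow> nat \<Rightarrow> real) \<Rightarrow> bool" where
  "real_antisym n M \<longleftrightarrow> (\<forall>p\<in>{1..n}. \<forall>q\<in>{1..n}. M p q = - M q p)"

definition op_norm :: "nat \<Rightarrow> (nat \<Rightarrow> nat \<Rightarrow> real) \<Rightarrow> real" where
  "op_norm n M = Sup {sqrt (\<Sum>p\<in>{1..n}. (\<Sum>q\<in>{1..n}. M p q * x q)\<^sup>2) | x.
                        (\<Sum>q\<in>{1..n}. (x q)\<^sup>2) \<le> 1}"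

definition has_range :: "nat \<Rightarrow> nat \<Rightarrow> (nat \<Rightarrow> nat \<Rightarrow> real) \<Rightarrow> bool" where
  "has_range n r M \<longleftrightarrow> (\<forall>p\<in>{1..n}. \<forall>q\<in>{1..n}. \<bar>real p - real q\<bar> > real r \<longrightarrow> M p q = 0)"

definition vnorm :: "complex vec \<Rightarrow> real" where
  "vnorm v = sqrt (\<Sum>i<dim_vec v. (cmod (v $ i))\<^sup>2)"

definition ground_state :: "nat \<Rightarrow> complex mat \<Rightarrow> complex mat \<Rightarrow> nat \<Rightarrow> complex vec \<Rightarrow> bool" where
  "ground_state d P H \<sigma> g \<longleftrightarrow>
     g \<in> carrier_vec d \<and> vnorm g = 1 \<and> P *\<^sub>v g = ((-1)^\<sigma>) \<cdot>\<^sub>v g \<and>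
     (\<exists>E. H *\<^sub>v g = E \<cdot>\<^sub>v g \<and>
        (\<forall>w \<mu>. w \<in> carrier_vec d \<and> w \<noteq> 0\<^sub>v d \<and> P *\<^sub>v w = ((-1)^\<sigma>) \<cdot>\<^sub>v w \<and>
               H *\<^sub>v w = \<mu> \<cdot>\<^sub>v w \<longrightarrow> Re E \<le> Re \<mu>))"

text \<open>U solves  dU/du = i Dhat(u) U(u), U(0) = I  on [0,1]; then U 1 is the
  time-ordered exponential T exp[i int_0^1 Dhat].\<close>
definition solves_TO_ode :: "nat \<Rightarrow> (real \<Rightarrow> complex mat) \<Rightarrow> (real \<Rightarrow> complex mat) \<Rightarrow> bool" where
  "solves_TO_ode d Dh U \<longleftrightarrow>
     U 0 = 1\<^sub>m d \<and>
     (\<forall>u\<in>{0..1}. U u \<in> carrier_mat d d \<and>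
        (\<forall>a<d. \<forall>b<d. ((\<lambda>t. U t $$ (a,b)) has_vector_derivative
                        ((\<i> \<cdot>\<^sub>m (Dh u * U u)) $$ (a,b))) (at u within {0..1})))"

end

theory Submission
  imports Defs "HOL-Complex_Analysis.Complex_Analysis" "Jordan_Normal_Form.Spectral_Radius"
begin

text \<open>
  A quadratic Hamiltonian with coefficient matrix \<open>A\<close> is governed by the Hermitian matrix \<open>h = i A\<close>:
  commuting with it acts on linear combinations of Majorana operators as \<open>h\<close> does on their coefficients.
  Along \<open>h s = h 0 + s i V\<close> the spectrum stays within \<open>s \<epsilon>\<close> of \<open>{-1, 0, 1}\<close>, so the Riesz projection
  \<open>P s\<close> onto the eigenvalues near 1 is smooth in \<open>s\<close>. Ground states of either parity are characterised by
  being annihilated by the modes in the range of \<open>P s\<close>: otherwise the energy could be lowered by at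
  least \<open>1 - \<epsilon>\<close>, and the parity repaired at cost at most \<open>\<epsilon>\<close> by a mode near 0.

  The matrices \<open>D u\<close> are Kato's generator for the spectral projections near -1, 0 and 1 at \<open>s = 1 - u\<close>.
  Its flow intertwines the projections, hence carries one ground space to the other. Its norm is
  bounded through a Sylvester equation by \<open>2 \<epsilon> / (1 - 2 \<epsilon>)\<close>. Its entries decay because on the contour
  \<open>|z - 1| = 1/2\<close> the resolvent is a Neumann series in \<open>V\<close> with ratio at most \<open>2 \<epsilon> < 1/2\<close>, whose
  partial sums are band matrices.

  Finite matrices of all sizes are represented in one ring of finitely supported matrices over the
  natural numbers; \<open>corner n\<close> says that the support lies in the leading \<open>n \<times> n\<close> block.
\<close>

section \<open>Finitely supported matrices\<close>

text \<open>The obstacle is the degenerate centre of the spectrum. \<open>h 0\<close> has the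
  eigenvalue 0 twice, from the two unpaired end Majoranas, and a perturbation may split this pair
  anyhow within its strength, so single eigenvectors there cannot be followed with control. Hence
  only the three spectral clusters are transported, and a ground state is pinned down by its
  annihilating modes together with its parity. At the unperturbed end a trace count shows that these
  conditions leave one dimension. Since \<open>i A\<close> is purely imaginary, complex conjugation
  exchanges the clusters near 1 and -1. This makes Kato's generator real; it is antisymmetric
  because the three projections add up to the identity. So it is admissible as a coefficient matrix.
  Grouping it into two terms, each a derivative times a partial reflection, gives the factor 2 in
  its norm bound. One type for all sizes can be an instance of the classes of inner product spaces
  and normed algebras, so that derivatives and integrals apply directly. The price is a ring without
  unit and a space that is not complete.\<close>

typedef fmat = "{f :: nat \<Rightarrow> nat \<Rightarrow> complex. \<exists>n. \<forall>i j. n \<le> i \<or> n \<le> j \<longrightarrow> f i j = 0}"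
  morphisms ent Abs_fmat
  by (intro exI[of _ "\<lambda>_ _. 0"]) auto

setup_lifting type_definition_fmat

lemma fmat_eqI: "(\<And>i j. ent A i j = ent B i j) \<Longrightarrow> A = B"
  by (metis ent_inject ext)

definition corner :: "nat \<Rightarrow> fmat \<Rightarrow> bool" where
  "corner n A \<longleftrightarrow> (\<forall>i j. n \<le> i \<or> n \<le> j \<longrightarrow> ent A i j = 0)"

lemma corner_ex: "\<exists>n. corner n A"
  unfolding corner_def using ent[of A] by auto

lemma corner_mono: "corner n A \<Longrightarrow> n \<le> m \<Longrightarrow> corner m A"
  unfolding corner_def by auto

lemma corner_obtain2:
  obtains n where "corner n A" "corner n B"
  by (metis corner_ex corner_mono linorder_linear)

lemma corner_obtain3:
  obtains n where "corner n A" "corner n B" "corner n C"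
proof -
  obtain k where "corner k A" "corner k B" by (rule corner_obtain2)
  moreover obtain l where "corner l C" using corner_ex by blast
  ultimately have "corner (max k l) A" "corner (max k l) B" "corner (max k l) C"
    by (auto intro: corner_mono)
  then show ?thesis by (rule that)
qed

lemma corner_eqI:
  assumes "corner n A" "corner n B" "\<And>i j. i < n \<Longrightarrow> j < n \<Longrightarrow> ent A i j = ent B i j"
  shows "A = B"
  using assms unfolding corner_def by (intro fmat_eqI) (metis not_le)

instantiation fmat :: "{ab_group_add,times,scaleR}"
begin

lift_definition zero_fmat :: fmat is "\<lambda>_ _. 0" by auto

lift_definition plus_fmat :: "fmat \<Rightarrow> fmat \<Rightarrow> fmat" is "\<lambda>f g i j. f i j + g i j"
proof -
  fix f g :: "nat \<Rightarrow> nat \<Rightarrow> complex"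
  assume "\<exists>n. \<forall>i j. n \<le> i \<or> n \<le> j \<longrightarrow> f i j = 0" "\<exists>n. \<forall>i j. n \<le> i \<or> n \<le> j \<longrightarrow> g i j = 0"
  then obtain k l where "\<forall>i j. k \<le> i \<or> k \<le> j \<longrightarrow> f i j = 0" "\<forall>i j. l \<le> i \<or> l \<le> j \<longrightarrow> g i j = 0"
    by auto
  then show "\<exists>n. \<forall>i j. n \<le> i \<or> n \<le> j \<longrightarrow> f i j + g i j = 0"
    by (intro exI[of _ "max k l"]) auto
qed

lift_definition minus_fmat :: "fmat \<Rightarrow> fmat \<Rightarrow> fmat" is "\<lambda>f g i j. f i j - g i j"
proof -
  fix f g :: "nat \<Rightarrow> nat \<Rightarrow> complex"
  assume "\<exists>n. \<forall>i j. n \<le> i \<or> n \<le> j \<longrightarrow> f i j = 0" "\<exists>n. \<forall>i j. n \<le> i \<or> n \<le> j \<longrightarrow> g i j = 0"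
  then obtain k l where "\<forall>i j. k \<le> i \<or> k \<le> j \<longrightarrow> f i j = 0" "\<forall>i j. l \<le> i \<or> l \<le> j \<longrightarrow> g i j = 0"
    by auto
  then show "\<exists>n. \<forall>i j. n \<le> i \<or> n \<le> j \<longrightarrow> f i j - g i j = 0"
    by (intro exI[of _ "max k l"]) auto
qed

lift_definition uminus_fmat :: "fmat \<Rightarrow> fmat" is "\<lambda>f i j. - f i j" by auto

lift_definition scaleR_fmat :: "real \<Rightarrow> fmat \<Rightarrow> fmat" is "\<lambda>r f i j. complex_of_real r * f i j" by auto

text \<open>Summing over the support of row \<open>i\<close> of the left factor gives a finite sum
  that mentions no size; \<open>ent_mult_left\<close> and \<open>ent_mult_right\<close> recover the
  usual sum from a bound on either factor.\<close>

lift_definition times_fmat :: "fmat \<Rightarrow> fmat \<Rightarrow> fmat" is "\<lambda>f g i j. \<Sum>k | f i k \<noteq> 0. f i k * g k j"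
proof -
  fix f g :: "nat \<Rightarrow> nat \<Rightarrow> complex"
  assume "\<exists>n. \<forall>i j. n \<le> i \<or> n \<le> j \<longrightarrow> f i j = 0" "\<exists>n. \<forall>i j. n \<le> i \<or> n \<le> j \<longrightarrow> g i j = 0"
  then obtain k l where "\<forall>i j. k \<le> i \<or> k \<le> j \<longrightarrow> f i j = 0" "\<forall>i j. l \<le> i \<or> l \<le> j \<longrightarrow> g i j = 0"
    by auto
  then show "\<exists>n. \<forall>i j. n \<le> i \<or> n \<le> j \<longrightarrow> (\<Sum>k | f i k \<noteq> 0. f i k * g k j) = 0"
    by (intro exI[of _ "max k l"]) (auto intro!: sum.neutral)
qed

instance
  by standard (transfer; auto simp: fun_eq_iff)+

end

lemma ent_0 [simp]: "ent 0 i j = 0" by (simp add: zero_fmat.rep_eq)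
lemma ent_add [simp]: "ent (A + B) i j = ent A i j + ent B i j" by (simp add: plus_fmat.rep_eq)
lemma ent_diff [simp]: "ent (A - B) i j = ent A i j - ent B i j" by (simp add: minus_fmat.rep_eq)
lemma ent_uminus [simp]: "ent (- A) i j = - ent A i j" by (simp add: uminus_fmat.rep_eq)
lemma ent_scaleR [simp]: "ent (r *\<^sub>R A) i j = complex_of_real r * ent A i j"
  by (simp add: scaleR_fmat.rep_eq)
lemma ent_sum [simp]: "ent (\<Sum>x\<in>X. F x) i j = (\<Sum>x\<in>X. ent (F x) i j)"
  by (induction X rule: infinite_finite_induct) auto

lemma ent_mult_left: "corner n A \<Longrightarrow> ent (A * B) i j = (\<Sum>k<n. ent A i k * ent B k j)"
  unfolding times_fmat.rep_eq corner_def
  by (rule sum.mono_neutral_left) (auto simp: not_less intro: leI)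

lemma ent_mult_right:
  assumes "corner n B" shows "ent (A * B) i j = (\<Sum>k<n. ent A i k * ent B k j)"
proof -
  obtain m where m: "corner m A" using corner_ex by blast
  have "ent (A * B) i j = (\<Sum>k<max m n. ent A i k * ent B k j)"
    using m by (intro ent_mult_left) (auto intro: corner_mono)
  also have "\<dots> = (\<Sum>k<n. ent A i k * ent B k j)"
    using assms unfolding corner_def by (intro sum.mono_neutral_right) auto
  finally show ?thesis .
qed

instance fmat :: ring
proof
  fix A B C :: fmat
  obtain n where n: "corner n A" "corner n B" "corner n C" by (rule corner_obtain3)
  show "A * B * C = A * (B * C)"
  proof (rule fmat_eqI)
    fix i j
    have "ent (A * B * C) i j = (\<Sum>k<n. \<Sum>l<n. ent A i l * ent B l k * ent C k j)"
      by (simp add: ent_mult_right[OF n(3)] ent_mult_left[OF n(1)] sum_distrib_right)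
    also have "\<dots> = (\<Sum>l<n. \<Sum>k<n. ent A i l * ent B l k * ent C k j)" by (rule sum.swap)
    also have "\<dots> = ent (A * (B * C)) i j"
      by (simp add: ent_mult_right[OF n(3)] ent_mult_left[OF n(1)] sum_distrib_left mult.assoc)
    finally show "ent (A * B * C) i j = ent (A * (B * C)) i j" .
  qed
  show "(A + B) * C = A * C + B * C"
    by (rule fmat_eqI) (simp add: ent_mult_right[OF n(3)] sum.distrib algebra_simps)
  show "A * (B + C) = A * B + A * C"
    by (rule fmat_eqI) (simp add: ent_mult_left[OF n(1)] sum.distrib algebra_simps)
qed

instance fmat :: real_vector
  by standard (auto intro!: fmat_eqI simp: algebra_simps)

instance fmat :: real_algebra
proof
  fix A B :: fmat and r :: real
  obtain n where n: "corner n A" "corner n B" by (rule corner_obtain2)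
  show "r *\<^sub>R A * B = r *\<^sub>R (A * B)"
    by (rule fmat_eqI) (simp add: ent_mult_right[OF n(2)] sum_distrib_left algebra_simps)
  show "A * r *\<^sub>R B = r *\<^sub>R (A * B)"
    by (rule fmat_eqI) (simp add: ent_mult_left[OF n(1)] sum_distrib_left algebra_simps)
qed

section \<open>Complex scalars, adjoint and conjugation\<close>

lift_definition scC :: "complex \<Rightarrow> fmat \<Rightarrow> fmat" (infixr "*\<^sub>C" 75) is "\<lambda>c f i j. c * f i j" by auto
lift_definition adj :: "fmat \<Rightarrow> fmat" is "\<lambda>f i j. cnj (f j i)" by auto
lift_definition cnjm :: "fmat \<Rightarrow> fmat" is "\<lambda>f i j. cnj (f i j)" by auto
lift_definition mk :: "nat \<Rightarrow> (nat \<Rightarrow> nat \<Rightarrow> complex) \<Rightarrow> fmat" is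
  "\<lambda>n f i j. if i < n \<and> j < n then f i j else 0"
  by (metis not_le)

text \<open>The ring has no unit; \<open>idmat n\<close> is the unit of the subring of matrices with
  \<open>corner n\<close>, and inverses are always meant relative to it.\<close>

definition idmat :: "nat \<Rightarrow> fmat" where "idmat n = mk n (\<lambda>i j. if i = j then 1 else 0)"

lemma ent_scC [simp]: "ent (c *\<^sub>C A) i j = c * ent A i j" by (simp add: scC.rep_eq)
lemma ent_adj [simp]: "ent (adj A) i j = cnj (ent A j i)" by (simp add: adj.rep_eq)
lemma ent_cnjm [simp]: "ent (cnjm A) i j = cnj (ent A i j)" by (simp add: cnjm.rep_eq)
lemma ent_mk [simp]: "ent (mk n f) i j = (if i < n \<and> j < n then f i j else 0)" by (simp add: mk.rep_eq)
lemma ent_idmat [simp]: "ent (idmat n) i j = (if i = j \<and> i < n then 1 else 0)" by (auto simp: idmat_def)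

lemma corner_mk [simp]: "corner n (mk n f)" by (simp add: corner_def)
lemma corner_idmat [simp]: "corner n (idmat n)" by (simp add: idmat_def)
lemma corner_0 [simp]: "corner n 0" by (simp add: corner_def)
lemma corner_add [simp, intro]: "corner n A \<Longrightarrow> corner n B \<Longrightarrow> corner n (A + B)" by (simp add: corner_def)
lemma corner_diff [simp, intro]: "corner n A \<Longrightarrow> corner n B \<Longrightarrow> corner n (A - B)" by (simp add: corner_def)
lemma corner_uminus [simp, intro]: "corner n A \<Longrightarrow> corner n (- A)" by (simp add: corner_def)
lemma corner_scC [simp, intro]: "corner n A \<Longrightarrow> corner n (c *\<^sub>C A)" by (simp add: corner_def)
lemma corner_scaleR [simp, intro]: "corner n A \<Longrightarrow> corner n (c *\<^sub>R A)" by (simp add: corner_def)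
lemma corner_adj [simp, intro]: "corner n A \<Longrightarrow> corner n (adj A)" by (simp add: corner_def)
lemma corner_cnjm [simp, intro]: "corner n A \<Longrightarrow> corner n (cnjm A)" by (simp add: corner_def)
lemma corner_sum [simp, intro]: "(\<And>x. x \<in> X \<Longrightarrow> corner n (F x)) \<Longrightarrow> corner n (\<Sum>x\<in>X. F x)"
  by (simp add: corner_def)
lemma corner_mult [simp, intro]: "corner n A \<Longrightarrow> corner n B \<Longrightarrow> corner n (A * B)"
  by (simp add: ent_mult_left[of n A B] corner_def)

lemma idmat_mult [simp]: assumes "corner n A" shows "idmat n * A = A"
proof (rule corner_eqI[of n])
  fix i j assume "i < n" "j < n"
  then have "ent (idmat n * A) i j = (\<Sum>k<n. if i = k then ent A k j else 0)"
    unfolding ent_mult_left[OF corner_idmat] by (intro sum.cong) auto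
  then show "ent (idmat n * A) i j = ent A i j" using \<open>i < n\<close> by simp
qed (use assms in auto)

lemma mult_idmat [simp]: assumes "corner n A" shows "A * idmat n = A"
proof (rule corner_eqI[of n])
  fix i j assume "i < n" "j < n"
  then have "ent (A * idmat n) i j = (\<Sum>k<n. if k = j then ent A i k else 0)"
    unfolding ent_mult_right[OF corner_idmat] by (intro sum.cong) auto
  then show "ent (A * idmat n) i j = ent A i j" using \<open>j < n\<close> by simp
qed (use assms in auto)

lemma scC_add_right: "c *\<^sub>C (A + B) = c *\<^sub>C A + c *\<^sub>C B" by (rule fmat_eqI) (simp add: algebra_simps)
lemma scC_diff_right: "c *\<^sub>C (A - B) = c *\<^sub>C A - c *\<^sub>C B" by (rule fmat_eqI) (simp add: algebra_simps)
lemma scC_add_left: "(c + d) *\<^sub>C A = c *\<^sub>C A + d *\<^sub>C A" by (rule fmat_eqI) (simp add: algebra_simps)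
lemma scC_diff_left: "(c - d) *\<^sub>C A = c *\<^sub>C A - d *\<^sub>C A" by (rule fmat_eqI) (simp add: algebra_simps)
lemma scC_minus_left [simp]: "(- c) *\<^sub>C A = - (c *\<^sub>C A)" by (rule fmat_eqI) simp
lemma scC_minus_right [simp]: "c *\<^sub>C (- A) = - (c *\<^sub>C A)" by (rule fmat_eqI) simp
lemma scC_scC [simp]: "c *\<^sub>C d *\<^sub>C A = (c * d) *\<^sub>C A" by (rule fmat_eqI) simp
lemma scC_1 [simp]: "1 *\<^sub>C A = A" by (rule fmat_eqI) simp
lemma scC_0 [simp]: "0 *\<^sub>C A = 0" by (rule fmat_eqI) simp
lemma scC_0_right [simp]: "c *\<^sub>C 0 = 0" by (rule fmat_eqI) simp
lemma scC_of_real: "complex_of_real r *\<^sub>C A = r *\<^sub>R A" by (rule fmat_eqI) simp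
lemma scC_scaleR: "c *\<^sub>C r *\<^sub>R A = (c * complex_of_real r) *\<^sub>C A" by (rule fmat_eqI) simp
lemma scC_sum_right: "c *\<^sub>C (\<Sum>x\<in>X. F x) = (\<Sum>x\<in>X. c *\<^sub>C F x)"
  by (rule fmat_eqI) (simp add: sum_distrib_left)
lemma scC_sum_left: "(\<Sum>x\<in>X. f x) *\<^sub>C A = (\<Sum>x\<in>X. f x *\<^sub>C A)"
  by (rule fmat_eqI) (simp add: sum_distrib_right)
lemma scC_mult_left [simp]: "c *\<^sub>C A * B = c *\<^sub>C (A * B)"
proof -
  obtain n where n: "corner n A" "corner n B" by (rule corner_obtain2)
  show ?thesis
    by (rule fmat_eqI) (simp add: ent_mult_right[OF n(2)] sum_distrib_left algebra_simps)
qed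
lemma scC_mult_right [simp]: "A * c *\<^sub>C B = c *\<^sub>C (A * B)"
proof -
  obtain n where n: "corner n A" "corner n B" by (rule corner_obtain2)
  show ?thesis
    by (rule fmat_eqI) (simp add: ent_mult_left[OF n(1)] sum_distrib_left algebra_simps)
qed

lemma adj_adj [simp]: "adj (adj A) = A" by (rule fmat_eqI) simp
lemma adj_add: "adj (A + B) = adj A + adj B" by (rule fmat_eqI) simp
lemma adj_diff: "adj (A - B) = adj A - adj B" by (rule fmat_eqI) simp
lemma adj_uminus: "adj (- A) = - adj A" by (rule fmat_eqI) simp
lemma adj_scC: "adj (c *\<^sub>C A) = cnj c *\<^sub>C adj A" by (rule fmat_eqI) simp
lemma adj_scaleR: "adj (c *\<^sub>R A) = c *\<^sub>R adj A" by (rule fmat_eqI) simp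
lemma adj_sum: "adj (\<Sum>x\<in>X. F x) = (\<Sum>x\<in>X. adj (F x))" by (rule fmat_eqI) simp
lemma adj_idmat [simp]: "adj (idmat n) = idmat n" by (rule fmat_eqI) auto
lemma adj_mult: "adj (A * B) = adj B * adj A"
proof -
  obtain n where n: "corner n A" "corner n B" by (rule corner_obtain2)
  show ?thesis
    by (rule fmat_eqI)
       (simp add: ent_mult_left[OF n(1)] ent_mult_right[OF corner_adj[OF n(1)]] mult.commute)
qed

lemma cnjm_0 [simp]: "cnjm 0 = 0" by (rule fmat_eqI) simp
lemma cnjm_cnjm [simp]: "cnjm (cnjm A) = A" by (rule fmat_eqI) simp
lemma cnjm_add: "cnjm (A + B) = cnjm A + cnjm B" by (rule fmat_eqI) simp
lemma cnjm_diff: "cnjm (A - B) = cnjm A - cnjm B" by (rule fmat_eqI) simp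
lemma cnjm_uminus: "cnjm (- A) = - cnjm A" by (rule fmat_eqI) simp
lemma cnjm_scaleR: "cnjm (c *\<^sub>R A) = c *\<^sub>R cnjm A" by (rule fmat_eqI) simp
lemma cnjm_idmat [simp]: "cnjm (idmat n) = idmat n" by (rule fmat_eqI) auto
lemma cnjm_adj: "cnjm (adj A) = adj (cnjm A)" by (rule fmat_eqI) simp
lemma cnjm_mult: "cnjm (A * B) = cnjm A * cnjm B"
proof -
  obtain n where n: "corner n A" "corner n B" by (rule corner_obtain2)
  show ?thesis
    by (rule fmat_eqI) (simp add: ent_mult_left[OF n(1)] ent_mult_left[OF corner_cnjm[OF n(1)]])
qed

lemma Re_cnj_mult_self: "Re (cnj z * z) = (cmod z)\<^sup>2"
  by (simp add: cmod_power2) (simp add: power2_eq_square)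

instantiation fmat :: real_inner
begin

text \<open>The real part of the trace of \<open>adj A * B\<close>, so that the norm is the
  Frobenius norm. The class asks for real values; for self-adjoint \<open>A\<close> the number
  \<open>inner X (A * X)\<close> is still the full quadratic form.\<close>

definition inner_fmat :: "fmat \<Rightarrow> fmat \<Rightarrow> real" where
  "inner A B = (\<Sum>i | \<exists>j. ent A i j \<noteq> 0. \<Sum>j | \<exists>i. ent A i j \<noteq> 0. Re (cnj (ent A i j) * ent B i j))"
definition norm_fmat where "norm (A :: fmat) = sqrt (inner A A)"
definition sgn_fmat where "sgn (A :: fmat) = A /\<^sub>R norm A"
definition dist_fmat where "dist (A :: fmat) B = norm (A - B)"
definition uniformity_fmat where
  "(uniformity :: (fmat \<times> fmat) filter) = (INF e\<in>{0 <..}. principal {(x, y). dist x y < e})"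
definition open_fmat where
  "open (U :: fmat set) = (\<forall>x\<in>U. eventually (\<lambda>(x', y). x' = x \<longrightarrow> y \<in> U) uniformity)"

lemma inner_fmat_left:
  assumes "corner n A"
  shows "inner A B = (\<Sum>i<n. \<Sum>j<n. Re (cnj (ent A i j) * ent B i j))"
proof -
  have "inner A B = (\<Sum>i | \<exists>j. ent A i j \<noteq> 0. \<Sum>j<n. Re (cnj (ent A i j) * ent B i j))"
    unfolding inner_fmat_def
  proof (rule sum.cong[OF refl])
    fix i
    show "(\<Sum>j | \<exists>i. ent A i j \<noteq> 0. Re (cnj (ent A i j) * ent B i j))
      = (\<Sum>j<n. Re (cnj (ent A i j) * ent B i j))"
      using assms by (intro sum.mono_neutral_left) (auto simp: corner_def not_less[symmetric])
  qed
  also have "\<dots> = (\<Sum>i<n. \<Sum>j<n. Re (cnj (ent A i j) * ent B i j))"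
    using assms by (intro sum.mono_neutral_left) (auto simp: corner_def not_less[symmetric])
  finally show ?thesis .
qed

instance
proof
  fix A B C :: fmat and r :: real
  obtain n where n: "corner n A" "corner n B" "corner n C" by (rule corner_obtain3)
  show "inner A B = inner B A"
    by (simp add: inner_fmat_left[OF n(1)] inner_fmat_left[OF n(2)] mult.commute)
  show "inner (A + B) C = inner A C + inner B C"
    by (simp add: inner_fmat_left[OF n(1)] inner_fmat_left[OF n(2)] inner_fmat_left[OF corner_add[OF n(1,2)]]
        sum.distrib algebra_simps)
  show "inner (r *\<^sub>R A) B = r * inner A B"
    by (simp add: inner_fmat_left[OF n(1)] inner_fmat_left[OF corner_scaleR[OF n(1)]]
        sum_distrib_left algebra_simps)
  have eq: "inner A A = (\<Sum>i<n. \<Sum>j<n. (cmod (ent A i j))\<^sup>2)"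
    by (simp only: inner_fmat_left[OF n(1)] Re_cnj_mult_self)
  show "0 \<le> inner A A" unfolding eq by (intro sum_nonneg) auto
  show "inner A A = 0 \<longleftrightarrow> A = 0"
  proof
    assume "inner A A = 0"
    then have "\<forall>i<n. \<forall>j<n. ent A i j = 0"
      unfolding eq by (simp add: sum_nonneg_eq_0_iff sum_nonneg)
    then show "A = 0" by (intro corner_eqI[OF n(1)]) auto
  qed (simp add: inner_fmat_def)
  show "norm A = sqrt (inner A A)" by (rule norm_fmat_def)
qed (rule sgn_fmat_def dist_fmat_def uniformity_fmat_def open_fmat_def)+

end

lemma norm_fmat_sq:
  assumes "corner n A"
  shows "(norm A)\<^sup>2 = (\<Sum>i<n. \<Sum>j<n. (cmod (ent A i j))\<^sup>2)"
  unfolding power2_norm_eq_inner[of A]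
  by (simp only: inner_fmat_left[OF assms] Re_cnj_mult_self)

lemma inner_adj: "inner (A * X) Y = inner X (adj A * Y)"
proof -
  obtain n where n: "corner n A" "corner n X" "corner n Y" by (rule corner_obtain3)
  have "inner (A * X) Y = (\<Sum>i<n. \<Sum>j<n. \<Sum>k<n. Re (cnj (ent A i k * ent X k j) * ent Y i j))"
    by (simp only: inner_fmat_left[OF corner_mult[OF n(1,2)]] ent_mult_left[OF n(1)] cnj_sum
        sum_distrib_right Re_sum)
  also have "\<dots> = (\<Sum>k<n. \<Sum>j<n. \<Sum>i<n. Re (cnj (ent A i k * ent X k j) * ent Y i j))"
    by (subst sum.swap, subst (2) sum.swap, subst sum.swap) (rule refl)
  also have "\<dots> = inner X (adj A * Y)"
    by (simp only: inner_fmat_left[OF n(2)] ent_mult_left[OF corner_adj[OF n(1)]]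
        sum_distrib_left Re_sum ent_adj) (simp add: algebra_simps)
  finally show ?thesis .
qed

lemma norm_adj [simp]: "norm (adj A) = norm A"
proof -
  obtain n where n: "corner n A" using corner_ex by blast
  have "(norm (adj A))\<^sup>2 = (norm A)\<^sup>2"
    unfolding norm_fmat_sq[OF n] norm_fmat_sq[OF corner_adj[OF n]]
    by (subst sum.swap) simp
  then show ?thesis by simp
qed

lemma norm_cnjm [simp]: "norm (cnjm A) = norm A"
proof -
  obtain n where n: "corner n A" using corner_ex by blast
  have "(norm (cnjm A))\<^sup>2 = (norm A)\<^sup>2"
    unfolding norm_fmat_sq[OF n] norm_fmat_sq[OF corner_cnjm[OF n]] by simp
  then show ?thesis by simp
qed

lemma norm_scC [simp]: "norm (c *\<^sub>C A) = cmod c * norm A"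
proof -
  obtain n where n: "corner n A" using corner_ex by blast
  have "(norm (c *\<^sub>C A))\<^sup>2 = (cmod c * norm A)\<^sup>2"
    unfolding power_mult_distrib norm_fmat_sq[OF n] norm_fmat_sq[OF corner_scC[OF n]]
    by (simp add: norm_mult power_mult_distrib sum_distrib_left)
  then show ?thesis by simp
qed

lemma norm_ent_le: "cmod (ent A i j) \<le> norm A"
proof -
  obtain m where m: "corner m A" using corner_ex by blast
  define n where "n = max m (Suc (max i j))"
  have n: "corner n A" "i < n" "j < n" unfolding n_def using m by (auto intro: corner_mono)
  have "(cmod (ent A i j))\<^sup>2 \<le> (\<Sum>j<n. (cmod (ent A i j))\<^sup>2)"
    using n by (intro member_le_sum) auto
  also have "\<dots> \<le> (\<Sum>i<n. \<Sum>j<n. (cmod (ent A i j))\<^sup>2)"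
    using n by (intro member_le_sum[where f = "\<lambda>i. \<Sum>j<n. (cmod (ent A i j))\<^sup>2"]) (auto intro: sum_nonneg)
  finally show ?thesis unfolding norm_fmat_sq[OF n(1), symmetric] by (simp add: power2_le_iff_abs_le)
qed

text \<open>Cauchy-Schwarz applied to each entry of the product. The instance makes multiplication a
  bounded bilinear map, which supplies the product rule and integration under one-sided
  multiplication.\<close>

instance fmat :: real_normed_algebra
proof
  fix A B :: fmat
  obtain n where n: "corner n A" "corner n B" by (rule corner_obtain2)
  have "(norm (A * B))\<^sup>2 = (\<Sum>i<n. \<Sum>j<n. (cmod (\<Sum>k<n. ent A i k * ent B k j))\<^sup>2)"
    by (simp only: norm_fmat_sq[OF corner_mult[OF n]] ent_mult_left[OF n(1)])
  also have "\<dots> \<le> (\<Sum>i<n. \<Sum>j<n. (\<Sum>k<n. (cmod (ent A i k))\<^sup>2) * (\<Sum>k<n. (cmod (ent B k j))\<^sup>2))"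
  proof (intro sum_mono)
    fix i j
    have "(cmod (\<Sum>k<n. ent A i k * ent B k j))\<^sup>2 \<le> (\<Sum>k<n. cmod (ent A i k) * cmod (ent B k j))\<^sup>2"
      by (intro power_mono order.trans[OF norm_sum] sum_mono) (auto simp: norm_mult)
    also have "\<dots> \<le> (\<Sum>k<n. (cmod (ent A i k))\<^sup>2) * (\<Sum>k<n. (cmod (ent B k j))\<^sup>2)"
      by (rule Cauchy_Schwarz_ineq_sum)
    finally show "(cmod (\<Sum>k<n. ent A i k * ent B k j))\<^sup>2
      \<le> (\<Sum>k<n. (cmod (ent A i k))\<^sup>2) * (\<Sum>k<n. (cmod (ent B k j))\<^sup>2)" .
  qed
  also have "\<dots> = (\<Sum>i<n. \<Sum>k<n. (cmod (ent A i k))\<^sup>2) * (\<Sum>j<n. \<Sum>k<n. (cmod (ent B k j))\<^sup>2)"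
    by (simp add: sum_product)
  also have "\<dots> = (norm A * norm B)\<^sup>2"
    unfolding power_mult_distrib norm_fmat_sq[OF n(1)] norm_fmat_sq[OF n(2)]
    by (subst (4) sum.swap) simp
  finally show "norm (A * B) \<le> norm A * norm B" by (simp add: power2_le_iff_abs_le)
qed

section \<open>Operator norm bounds and the spectral theorem\<close>

text \<open>The Frobenius norm treats the columns of \<open>X\<close> independently, so testing on
  all matrices gives the same bounds as testing on vectors. A predicate on bounds avoids a
  supremum.\<close>

definition opnorm_le :: "fmat \<Rightarrow> real \<Rightarrow> bool" where
  "opnorm_le A b \<longleftrightarrow> (\<forall>X. norm (A * X) \<le> b * norm X)"

lemma opbD: "opnorm_le A b \<Longrightarrow> norm (A * X) \<le> b * norm X"
  by (simp add: opnorm_le_def)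

lemma opnorm_le_mono: "opnorm_le A a \<Longrightarrow> a \<le> b \<Longrightarrow> opnorm_le A b"
  unfolding opnorm_le_def by (meson mult_right_mono norm_ge_zero order_trans)

lemma opnorm_le_mult: "opnorm_le A a \<Longrightarrow> opnorm_le B b \<Longrightarrow> 0 \<le> a \<Longrightarrow> opnorm_le (A * B) (a * b)"
  unfolding opnorm_le_def mult.assoc by (meson mult_left_mono order_trans)

lemma opnorm_le_add: "opnorm_le A a \<Longrightarrow> opnorm_le B b \<Longrightarrow> opnorm_le (A + B) (a + b)"
  unfolding opnorm_le_def distrib_right by (meson add_mono norm_triangle_le)

lemma opnorm_le_scC: "opnorm_le A a \<Longrightarrow> opnorm_le (c *\<^sub>C A) (cmod c * a)"
  unfolding opnorm_le_def by (simp add: mult_left_mono mult.assoc)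

lemma opnorm_le_scaleR: "opnorm_le A a \<Longrightarrow> opnorm_le (c *\<^sub>R A) (\<bar>c\<bar> * a)"
  using opnorm_le_scC[of A a "complex_of_real c"] by (simp add: scC_of_real)

lemma opnorm_le_uminus: "opnorm_le A a \<Longrightarrow> opnorm_le (- A) a"
  unfolding opnorm_le_def by simp

lemma opnorm_le_diff: "opnorm_le A a \<Longrightarrow> opnorm_le B b \<Longrightarrow> opnorm_le (A - B) (a + b)"
  using opnorm_le_add[OF _ opnorm_le_uminus] by simp

lemma opnorm_le_cnjm: assumes "opnorm_le A a" shows "opnorm_le (cnjm A) a"
  unfolding opnorm_le_def
proof
  fix X
  have "norm (cnjm A * X) = norm (cnjm (A * cnjm X))" by (simp add: cnjm_mult)
  also have "\<dots> \<le> a * norm X" using opbD[OF assms, of "cnjm X"] by simp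
  finally show "norm (cnjm A * X) \<le> a * norm X" .
qed

lemma opnorm_le_0 [simp]: "0 \<le> a \<Longrightarrow> opnorm_le 0 a"
  by (simp add: opnorm_le_def)

text \<open>Multiplication by the matrix unit at \<open>(j, j)\<close>, which has norm 1, isolates
  column \<open>j\<close>.\<close>

lemma opnorm_le_ent:
  assumes "opnorm_le A a" shows "cmod (ent A i j) \<le> a"
proof -
  define X where "X = mk (Suc j) (\<lambda>k l. if k = j \<and> l = j then 1 else 0)"
  have c: "corner (Suc j) X" by (simp add: X_def)
  have "(norm X)\<^sup>2 = 1"
    unfolding norm_fmat_sq[OF c] by (simp add: X_def sum.neutral)
  then have "norm X = 1" by (simp add: power2_eq_1_iff) (smt (verit) norm_ge_zero)
  moreover have "ent (A * X) i j = ent A i j"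
    unfolding ent_mult_right[OF c] by (simp add: X_def sum.neutral)
  ultimately show ?thesis using norm_ent_le[of "A * X" i j] opbD[OF assms, of X] by simp
qed

lemma opnorm_le_norm: "opnorm_le A a \<Longrightarrow> corner n A \<Longrightarrow> norm A \<le> a * norm (idmat n)"
  using opbD[of A a "idmat n"] by simp

lemma opnorm_le_projection:
  assumes "adj P = P" "P * P = P" shows "opnorm_le P 1"
  unfolding opnorm_le_def
proof
  fix X
  have "(norm (P * X))\<^sup>2 = inner X (P * X)"
    by (simp add: power2_norm_eq_inner inner_adj assms(1) mult.assoc[symmetric] assms(2))
  also have "\<dots> \<le> norm X * norm (P * X)" by (rule norm_cauchy_schwarz)
  finally show "norm (P * X) \<le> 1 * norm X"
    by (cases "norm (P * X) = 0") (simp_all add: power2_eq_square)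
qed

lemma opnorm_le_idmat: "opnorm_le (idmat n) 1"
  by (rule opnorm_le_projection) simp_all

lemma norm_isometry:
  assumes "adj W * W = idmat n" shows "norm (W * X) = norm (idmat n * X)"
proof -
  have "inner (W * X) (W * X) = inner X (idmat n * X)"
    by (simp add: inner_adj mult.assoc[symmetric] assms)
  also have "\<dots> = inner (idmat n * X) (idmat n * X)"
    by (simp add: inner_adj mult.assoc[symmetric])
  finally show ?thesis by (simp add: norm_eq_sqrt_inner)
qed

lemma opnorm_le_isometry: assumes "adj W * W = idmat n" shows "opnorm_le W 1"
  unfolding opnorm_le_def norm_isometry[OF assms] using opbD[OF opnorm_le_idmat] by blast

section \<open>Traces and column vectors\<close>

definition tr :: "nat \<Rightarrow> fmat \<Rightarrow> complex" where
  "tr n A = (\<Sum>i<n. ent A i i)"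

lemma tr_add: "tr n (A + B) = tr n A + tr n B" by (simp add: tr_def sum.distrib)
lemma tr_diff: "tr n (A - B) = tr n A - tr n B" by (simp add: tr_def sum_subtractf)
lemma tr_uminus: "tr n (- A) = - tr n A" by (simp add: tr_def sum_negf)
lemma tr_scC: "tr n (c *\<^sub>C A) = c * tr n A" by (simp add: tr_def sum_distrib_left)

lemma tr_mult_commute:
  assumes "corner n A" "corner n B" shows "tr n (A * B) = tr n (B * A)"
  unfolding tr_def ent_mult_left[OF assms(1)] ent_mult_left[OF assms(2)]
  by (subst sum.swap) (simp add: mult.commute)

lemma tr_adj_mult_self:
  assumes "corner n A" shows "tr n (adj A * A) = complex_of_real ((norm A)\<^sup>2)"
proof -
  have "tr n (adj A * A) = (\<Sum>i<n. \<Sum>j<n. complex_of_real ((cmod (ent A j i))\<^sup>2))"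
    unfolding tr_def ent_mult_left[OF corner_adj[OF assms]] ent_adj
    by (intro sum.cong refl) (metis complex_norm_square mult.commute)
  also have "\<dots> = (\<Sum>j<n. \<Sum>i<n. complex_of_real ((cmod (ent A j i))\<^sup>2))" by (rule sum.swap)
  also have "\<dots> = complex_of_real ((norm A)\<^sup>2)" unfolding norm_fmat_sq[OF assms] by simp
  finally show ?thesis .
qed

text \<open>A column vector is a matrix supported in column 0.\<close>

definition iscol :: "fmat \<Rightarrow> bool" where "iscol X \<longleftrightarrow> X * idmat (Suc 0) = X"

lemma ent_mult_e1: "ent (X * idmat (Suc 0)) i j = (if j = 0 then ent X i 0 else 0)"
  by (simp add: ent_mult_right[OF corner_idmat])

lemma iscol_iff: "iscol X \<longleftrightarrow> (\<forall>i j. j \<noteq> 0 \<longrightarrow> ent X i j = 0)"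
  unfolding iscol_def by (metis ent_mult_e1 fmat_eqI)

lemma iscol_mult [intro]: "iscol X \<Longrightarrow> iscol (A * X)"
  unfolding iscol_def by (simp add: mult.assoc)

text \<open>A scalar product of columns is a matrix with the single entry (0, 0). Written as a
  multiple of \<open>idmat (Suc 0)\<close> it can be pulled out of products, since that matrix is a
  right unit for columns.\<close>

lemma adj_mult_col:
  assumes "iscol X" "iscol Y"
  shows "adj X * Y = ent (adj X * Y) 0 0 *\<^sub>C idmat (Suc 0)"
proof -
  have "adj X = idmat (Suc 0) * adj X" using assms(1) unfolding iscol_def by (metis adj_idmat adj_mult)
  then have "adj X * Y = idmat (Suc 0) * (adj X * Y) * idmat (Suc 0)"
    using assms(2) unfolding iscol_def by (metis mult.assoc)
  also have "\<dots> = ent (adj X * Y) 0 0 *\<^sub>C idmat (Suc 0)"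
    by (rule fmat_eqI) (auto simp: ent_mult_e1 ent_mult_left[OF corner_idmat])
  finally show ?thesis .
qed

lemma col_adj_mult_self:
  assumes "iscol X" shows "ent (adj X * X) 0 0 = complex_of_real ((norm X)\<^sup>2)"
proof -
  obtain m where "corner m X" using corner_ex by blast
  then have n: "corner (Suc m) X" by (auto intro: corner_mono)
  have "tr (Suc m) (adj X * X) = tr (Suc m) (ent (adj X * X) 0 0 *\<^sub>C idmat (Suc 0))"
    using adj_mult_col[OF assms assms] by simp
  also have "\<dots> = ent (adj X * X) 0 0" by (simp add: tr_scC) (simp add: tr_def sum.lessThan_Suc_shift)
  finally show ?thesis using tr_adj_mult_self[OF n] by simp
qed

section \<open>Diagonal matrices and diagonalization\<close>

definition diag :: "nat \<Rightarrow> (nat \<Rightarrow> complex) \<Rightarrow> fmat" where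
  "diag n l = mk n (\<lambda>i j. if i = j then l i else 0)"

lemma ent_diag [simp]: "ent (diag n l) i j = (if i = j \<and> i < n then l i else 0)"
  by (auto simp: diag_def)

lemma corner_diag [simp]: "corner n (diag n l)" by (simp add: diag_def)

lemma ent_diag_mult: "ent (diag n l * X) i j = (if i < n then l i * ent X i j else 0)"
proof -
  have "ent (diag n l * X) i j = (\<Sum>k<n. if i = k then l i * ent X i j else 0)"
    unfolding ent_mult_left[OF corner_diag] by (rule sum.cong) auto
  then show ?thesis by simp
qed

lemma diag_mult_diag: "diag n l * diag n k = diag n (\<lambda>i. l i * k i)"
  by (rule fmat_eqI) (auto simp: ent_diag_mult)

lemma diag_cong: "(\<And>i. i < n \<Longrightarrow> l i = k i) \<Longrightarrow> diag n l = diag n k"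
  by (rule fmat_eqI) auto

lemma opnorm_le_diag:
  assumes "\<And>i. i < n \<Longrightarrow> cmod (l i) \<le> b" "0 \<le> b"
  shows "opnorm_le (diag n l) b"
  unfolding opnorm_le_def
proof
  fix X
  obtain m where m: "corner m X" using corner_ex by blast
  define k where "k = max m n"
  have X: "corner k X" and d: "corner k (diag n l)"
    unfolding k_def by (auto intro: corner_mono[OF m] corner_mono[OF corner_diag])
  have "(norm (diag n l * X))\<^sup>2 \<le> (b * norm X)\<^sup>2"
    unfolding power_mult_distrib norm_fmat_sq[OF X] norm_fmat_sq[OF corner_mult[OF d X]] sum_distrib_left
    using assms by (intro sum_mono) (auto simp: ent_diag_mult norm_mult power_mult_distrib intro!: mult_right_mono power_mono)
  then show "norm (diag n l * X) \<le> b * norm X"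
    using assms(2) by (simp add: power2_le_iff_abs_le)
qed

text \<open>Existence comes from the nonempty spectrum of a complex matrix. The phase is fixed so
  that the last entry is real and at most 0; the eigenvector then differs from the last basis
  vector, and the reflection that exchanges the two is well defined.\<close>

lemma eigenvector_exists:
  assumes "corner (Suc n) h"
  obtains x \<mu> where "corner (Suc n) x" "iscol x" "norm x = 1" "h * x = \<mu> *\<^sub>C x"
    "Im (ent x n 0) = 0" "Re (ent x n 0) \<le> 0"
proof -
  define A where "A = mat (Suc n) (Suc n) (\<lambda>(i,j). ent h i j)"
  have A: "A \<in> carrier_mat (Suc n) (Suc n)" by (simp add: A_def)
  obtain \<mu> v where v: "v \<in> carrier_vec (Suc n)" "v \<noteq> 0\<^sub>v (Suc n)" "A *\<^sub>v v = \<mu> \<cdot>\<^sub>v v"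
  proof -
    have "spectrum A \<noteq> {}" by (rule spectrum_non_empty[OF A]) simp
    then obtain \<mu> v where "eigenvector A v \<mu>" unfolding spectrum_def eigenvalue_def by blast
    then have "v \<in> carrier_vec (Suc n)" "v \<noteq> 0\<^sub>v (Suc n)" "A *\<^sub>v v = \<mu> \<cdot>\<^sub>v v"
      using A unfolding eigenvector_def by simp_all
    then show ?thesis using that by blast
  qed
  define y where "y = mk (Suc n) (\<lambda>i j. if j = 0 then v $ i else 0)"
  have y: "corner (Suc n) y" "iscol y" by (auto simp: y_def iscol_iff)
  have "y \<noteq> 0"
  proof
    assume "y = 0"
    have "v $ i = ent y i 0" if "i < Suc n" for i using that by (simp add: y_def)
    then have "v = 0\<^sub>v (Suc n)" using v(1) \<open>y = 0\<close> by (intro eq_vecI) simp_all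
    then show False using v(2) by simp
  qed
  have hy: "h * y = \<mu> *\<^sub>C y"
  proof (rule corner_eqI[of "Suc n"])
    fix i j assume ij: "i < Suc n" "j < Suc n"
    have "(\<Sum>k<Suc n. ent h i k * v $ k) = (A *\<^sub>v v) $ i"
      using ij v(1) by (simp add: A_def scalar_prod_def atLeast0LessThan del: sum.lessThan_Suc)
    also have "\<dots> = \<mu> * v $ i" using v ij by simp
    finally show "ent (h * y) i j = ent (\<mu> *\<^sub>C y) i j"
      using ij by (simp add: ent_mult_left[OF assms] y_def del: sum.lessThan_Suc cong: if_cong)
  qed (use assms y in auto)
  define p where "p = (if ent y n 0 = 0 then 1 else - cnj (ent y n 0) / cmod (ent y n 0))"
  have p: "cmod p = 1" by (auto simp: p_def norm_divide)
  have py: "p * ent y n 0 = - complex_of_real (cmod (ent y n 0))"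
    using complex_norm_square[of "ent y n 0"] by (auto simp: p_def field_simps power2_eq_square)
  define x where "x = (p / norm y) *\<^sub>C y"
  have "ent x n 0 = complex_of_real (- cmod (ent y n 0) / norm y)"
    using py by (simp add: x_def field_simps)
  then have "Im (ent x n 0) = 0" "Re (ent x n 0) \<le> 0" by (simp_all add: divide_nonpos_nonneg)
  moreover have "corner (Suc n) x" "iscol x" using y by (auto simp: x_def iscol_iff)
  moreover have "norm x = 1" using p \<open>y \<noteq> 0\<close> by (simp add: x_def norm_divide)
  moreover have "h * x = \<mu> *\<^sub>C x" by (simp add: x_def hy mult.commute)
  ultimately show ?thesis using that by blast
qed

text \<open>The Householder reflection that exchanges a unit eigenvector with the last basis vector
  splits off one eigenvalue.\<close>

theorem hermitian_diagonalization:
  assumes "corner n h" "adj h = h"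
  shows "\<exists>W (l :: nat \<Rightarrow> real). corner n W \<and> adj W * W = idmat n \<and> W * adj W = idmat n \<and>
    h = W * diag n (\<lambda>i. complex_of_real (l i)) * adj W"
  using assms
proof (induction n arbitrary: h)
  case 0
  have "corner 0 A \<Longrightarrow> A = 0" for A by (auto simp: corner_def intro: fmat_eqI)
  then have "h = 0" "idmat 0 = 0" using 0 by auto
  then show ?case by (intro exI[of _ 0] exI[of _ "\<lambda>_. 0"]) auto
next
  case (Suc n)
  obtain x \<mu> where x: "corner (Suc n) x" "iscol x" "norm x = 1" "h * x = \<mu> *\<^sub>C x"
    "Im (ent x n 0) = 0" "Re (ent x n 0) \<le> 0"
    using eigenvector_exists[OF Suc.prems(1)] by blast
  define b where "b = mk (Suc n) (\<lambda>i j. if i = n \<and> j = 0 then 1 else 0)"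
  have b: "corner (Suc n) b" "iscol b" by (auto simp: b_def iscol_iff)
  have ent_b: "ent b i j = (if i = n \<and> j = 0 then 1 else 0)" for i j by (simp add: b_def)
  define t where "t = Re (ent x n 0)"
  have t: "ent x n 0 = complex_of_real t" using x(5) by (simp add: t_def complex_eq_iff)
  define u where "u = x - b"
  have u: "corner (Suc n) u" "iscol u" using x b by (auto simp: u_def iscol_iff)
  have ub: "ent (adj u * b) 0 0 = complex_of_real (t - 1)"
    unfolding ent_mult_right[OF b(1)] by (simp add: ent_b u_def t)
  have xb: "ent (adj x * b) 0 0 = complex_of_real t" "ent (adj b * x) 0 0 = complex_of_real t"
    "ent (adj b * b) 0 0 = 1"
    unfolding ent_mult_right[OF b(1)] ent_mult_left[OF corner_adj[OF b(1)]] by (simp_all add: ent_b t)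
  have uu: "ent (adj u * u) 0 0 = complex_of_real (2 - 2 * t)"
    using xb col_adj_mult_self[OF x(2)] x(3)
    by (simp add: u_def adj_diff algebra_simps)
  \<comment> \<open>The squared length of \<open>u\<close>, positive by the choice of phase;
    \<open>H\<close> below is the reflection along \<open>u\<close>.\<close>
  have t2: "2 - 2 * t > 0" using x(6) by (simp add: t_def)
  define c where "c = 2 / (2 - 2 * t)"
  define H where "H = idmat (Suc n) - c *\<^sub>R (u * adj u)"
  have H: "corner (Suc n) H" "adj H = H"
    using u by (auto simp: H_def adj_diff adj_scaleR adj_mult)
  have "u * adj u * (u * adj u) = u * (adj u * u) * adj u" by (simp add: mult.assoc)
  also have "\<dots> = complex_of_real (2 - 2 * t) *\<^sub>C (u * idmat (Suc 0) * adj u)"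
    by (subst adj_mult_col[OF u(2) u(2)]) (simp only: uu scC_mult_left scC_mult_right)
  also have "\<dots> = (2 - 2 * t) *\<^sub>R (u * adj u)" using u(2) by (simp only: iscol_def scC_of_real)
  finally have uuuu: "u * adj u * (u * adj u) = (2 - 2 * t) *\<^sub>R (u * adj u)" .
  have cu: "corner (Suc n) (u * adj u)" using u by auto
  have "(idmat (Suc n) - c *\<^sub>R G) * (idmat (Suc n) - c *\<^sub>R G) = idmat (Suc n) - c *\<^sub>R G - c *\<^sub>R G + (c * c) *\<^sub>R (G * G)"
    if "corner (Suc n) G" for G
    using that by (simp add: algebra_simps)
  then have "H * H = idmat (Suc n) - c *\<^sub>R (u * adj u) - c *\<^sub>R (u * adj u) + (c * c * (2 - 2 * t)) *\<^sub>R (u * adj u)"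
    unfolding H_def using cu by (simp add: uuuu)
  also have "c * c * (2 - 2 * t) = c + c" using t2 by (simp add: c_def field_simps)
  finally have HH: "H * H = idmat (Suc n)" by (simp only: scaleR_left_distrib) simp
  have "u * adj u * b = u * (adj u * b)" by (simp add: mult.assoc)
  also have "\<dots> = (t - 1) *\<^sub>R (u * idmat (Suc 0))"
    by (subst adj_mult_col[OF u(2) b(2)]) (simp only: ub scC_mult_right scC_of_real mult_scaleR_right)
  finally have "u * adj u * b = (t - 1) *\<^sub>R u" using u(2) by (simp add: iscol_def)
  then have "H * b = b - (c * (t - 1)) *\<^sub>R u" using b by (simp add: H_def left_diff_distrib)
  also have "c * (t - 1) = -1" using t2 by (simp add: c_def field_simps)
  finally have Hb: "H * b = x" by (simp add: u_def)
  then have Hx: "H * x = b" using HH b by (metis idmat_mult mult.assoc)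
  define h1 where "h1 = H * h * H"
  have h1: "corner (Suc n) h1" "adj h1 = h1"
    using H Suc.prems by (auto simp: h1_def adj_mult mult.assoc)
  have h_h1: "h = H * h1 * H"
    using HH H Suc.prems(1) by (simp add: h1_def mult.assoc) (simp flip: mult.assoc)
  have "h1 * b = \<mu> *\<^sub>C b" by (simp add: h1_def mult.assoc Hb x(4) Hx)
  moreover have "ent (h1 * b) i 0 = ent h1 i n" for i
    unfolding ent_mult_right[OF b(1)] by (simp add: ent_b)
  ultimately have col: "ent h1 i n = (if i = n then \<mu> else 0)" for i
    by (metis ent_b ent_scC mult.right_neutral mult_zero_right)
  have row: "ent h1 n i = cnj (ent h1 i n)" for i by (metis ent_adj h1(2))
  \<comment> \<open>A diagonal entry of the self-adjoint \<open>h1\<close> is real.\<close>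
  have lam: "\<mu> = complex_of_real (Re \<mu>)"
    using row[of n] col[of n] by (simp add: complex_eq_iff)
  define h' where "h' = mk n (ent h1)"
  have "cnj (ent h1 i j) = ent h1 j i" for i j by (metis ent_adj h1(2))
  then have "adj h' = h'" by (intro fmat_eqI) (auto simp: h'_def)
  then obtain W' l' where W': "corner n W'" "adj W' * W' = idmat n" "W' * adj W' = idmat n"
    "h' = W' * diag n (\<lambda>i. complex_of_real (l' i)) * adj W'"
    using Suc.IH[of h'] by (auto simp: h'_def)
  \<comment> \<open>The matrix unit at \<open>(n, n)\<close>. Its products with everything supported
    in the leading block vanish, so block sums become sums in the ring.\<close>
  define F where "F = idmat (Suc n) - idmat n"
  have entF: "ent F i j = (if i = n \<and> j = n then 1 else 0)" for i j by (auto simp: F_def)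
  have F: "corner (Suc n) F" "adj F = F" by (auto simp: F_def adj_diff corner_mono[OF corner_idmat])
  have Fz: "F * A = 0" "A * F = 0" if "corner n A" for A
    using that corner_mono[of n A "Suc n"] by (simp_all add: F_def algebra_simps)
  have FF: "F * F = F"
    using Fz(2)[OF corner_idmat] F(1) by (metis F_def diff_zero idmat_mult left_diff_distrib)
  define l where "l = (\<lambda>i. if i < n then l' i else Re \<mu>)"
  define W where "W = H * (W' + F)"
  have h1_eq: "h1 = h' + \<mu> *\<^sub>C F"
    by (rule corner_eqI[of "Suc n"])
       (use h1 F col row lam in \<open>auto simp: h'_def entF less_Suc_eq corner_mono[OF corner_mk]\<close>)
  have dl: "diag (Suc n) (\<lambda>i. complex_of_real (l i)) = diag n (\<lambda>i. complex_of_real (l' i)) + \<mu> *\<^sub>C F"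
    using lam by (intro fmat_eqI) (auto simp: entF l_def less_Suc_eq)
  have cW: "corner (Suc n) W'" using W'(1) by (auto intro: corner_mono)
  have a1: "(W' + F) * diag (Suc n) (\<lambda>i. complex_of_real (l i)) * adj (W' + F) = h1"
    using W' F by (simp add: dl h1_eq adj_add algebra_simps Fz FF corner_adj corner_mult)
  have a2: "adj (W' + F) * (W' + F) = idmat (Suc n)" "(W' + F) * adj (W' + F) = idmat (Suc n)"
    using W' F by (simp_all add: adj_add algebra_simps Fz FF corner_adj corner_mult) (simp_all add: F_def)
  have "corner (Suc n) W" using H F cW by (auto simp: W_def)
  moreover have "adj W * W = adj (W' + F) * (H * H) * (W' + F)" by (simp add: W_def adj_mult H mult.assoc)
  then have "adj W * W = idmat (Suc n)" using a2 cW F(1) HH by (simp add: mult.assoc corner_add)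
  moreover have "W * adj W = H * ((W' + F) * adj (W' + F)) * H" by (simp add: W_def adj_mult H mult.assoc)
  then have "W * adj W = idmat (Suc n)" using a2 HH H by simp
  moreover have "W * diag (Suc n) (\<lambda>i. complex_of_real (l i)) * adj W
    = H * ((W' + F) * diag (Suc n) (\<lambda>i. complex_of_real (l i)) * adj (W' + F)) * H"
    by (simp only: W_def adj_mult H mult.assoc)
  then have "h = W * diag (Suc n) (\<lambda>i. complex_of_real (l i)) * adj W" using a1 h_h1 by simp
  ultimately show ?case by blast
qed

section \<open>Resolvents and Riesz projections\<close>

lemma bounded_linear_scC_left: "bounded_linear (\<lambda>c. c *\<^sub>C A)"
  by (rule bounded_linear_intro[where K = "norm A"])
     (auto simp: scC_add_left scaleR_conv_of_real scC_of_real[symmetric])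

lemma bounded_linear_ent: "bounded_linear (\<lambda>A. ent A i j)"
  by (rule bounded_linear_intro[where K = 1]) (auto simp: scaleR_conv_of_real norm_ent_le)

lemma bounded_linear_cnjm: "bounded_linear cnjm"
  by (rule bounded_linear_intro[where K = 1]) (auto simp: cnjm_add cnjm_scaleR)

lemma mk_ent: "corner n A \<Longrightarrow> mk n (ent A) = A"
  by (rule corner_eqI[of n]) auto

text \<open>Expansion in matrix units: the coefficients are scalars and the matrices fixed, so
  integrals and derivatives of \<open>mk n (F t)\<close> reduce to those of the entries.\<close>

lemma mk_sum:
  "mk n G = (\<Sum>i<n. \<Sum>j<n. G i j *\<^sub>C mk n (\<lambda>k l. if k = i \<and> l = j then 1 else 0))"
proof (rule fmat_eqI)
  fix k l
  let ?S = "\<Sum>i<n. \<Sum>j<n. G i j *\<^sub>C mk n (\<lambda>k l. if k = i \<and> l = j then 1 else 0)"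
  have delta: "a * (if Q then 1 else 0) = (if Q then a else 0)" for a :: complex and Q by simp
  show "ent (mk n G) k l = ent ?S k l"
  proof (cases "k < n \<and> l < n")
    case True
    have "ent ?S k l = (\<Sum>i<n. if i = k then (\<Sum>j<n. if j = l then G i j else 0) else 0)"
      unfolding ent_sum ent_scC ent_mk using True
      by (intro sum.cong refl) (auto simp: delta intro!: sum.neutral)
    then show ?thesis using True by simp
  qed auto
qed

lemma has_integral_mk:
  assumes "\<And>i j. i < n \<Longrightarrow> j < n \<Longrightarrow> ((\<lambda>t. F t i j) has_integral I i j) S"
  shows "((\<lambda>t. mk n (F t)) has_integral mk n I) S"
  unfolding mk_sum[of n "F _"] mk_sum[of n I]
  using has_integral_linear[OF assms bounded_linear_scC_left]
  by (intro has_integral_sum) (auto simp: o_def)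

text \<open>The space \<open>fmat\<close> is not complete, so continuity alone does not yield
  integrability. Inside a fixed corner the integral is assembled from the scalar integrals of the
  entries.\<close>

lemma continuous_corner_integrable:
  assumes "continuous_on {a..b::real} F" "\<And>t. t \<in> {a..b} \<Longrightarrow> corner n (F t)"
  shows "F integrable_on {a..b}"
proof -
  have "continuous_on {a..b} (\<lambda>t. ent (F t) i j)" for i j
    using continuous_on_compose2[OF linear_continuous_on[OF bounded_linear_ent] assms(1)] by auto
  then have "((\<lambda>t. ent (F t) i j) has_integral integral {a..b} (\<lambda>t. ent (F t) i j)) {a..b}" for i j
    by (intro integrable_integral integrable_continuous_real)
  then have "((\<lambda>t. mk n (ent (F t))) has_integral mk n (\<lambda>i j. integral {a..b} (\<lambda>t. ent (F t) i j))) {a..b}"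
    by (rule has_integral_mk)
  then have "(F has_integral mk n (\<lambda>i j. integral {a..b} (\<lambda>t. ent (F t) i j))) {a..b}"
    by (rule has_integral_eq[rotated]) (use assms mk_ent in auto)
  then show ?thesis by blast
qed

lemma has_integral_lin:
  "(F has_integral I) S \<Longrightarrow> bounded_linear h \<Longrightarrow> ((\<lambda>t. h (F t)) has_integral h I) S"
  using has_integral_linear[of F I S h] by (simp add: o_def)

lemma corner_has_integral:
  assumes "(F has_integral I) S" "\<And>t. t \<in> S \<Longrightarrow> corner n (F t)"
  shows "corner n I"
  unfolding corner_def
proof (intro allI impI)
  fix i j assume ij: "n \<le> i \<or> n \<le> j"
  have "((\<lambda>t. ent (F t) i j) has_integral ent I i j) S"
    by (rule has_integral_lin[OF assms(1) bounded_linear_ent])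
  then have "((\<lambda>t. 0) has_integral ent I i j) S"
    by (rule has_integral_eq[rotated]) (use assms(2) ij in \<open>auto simp: corner_def\<close>)
  then show "ent I i j = 0" using has_integral_unique[OF has_integral_0] by metis
qed

lemma opnorm_le_has_integral:
  assumes "(F has_integral I) {0..1::real}" "\<And>t. t \<in> {0..1} \<Longrightarrow> opnorm_le (F t) b" "0 \<le> b"
  shows "opnorm_le I b"
  unfolding opnorm_le_def
proof
  fix X
  have "((\<lambda>t. F t * X) has_integral I * X) (cbox 0 1)"
    using has_integral_lin[OF assms(1) bounded_linear_mult_left] by simp
  from has_integral_bound[OF _ this, of "b * norm X"]
  show "norm (I * X) \<le> b * norm X" using assms(2,3) by (simp add: opnorm_le_def)
qed

section \<open>Spectra and resolvents of self-adjoint matrices\<close>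

definition spec :: "nat \<Rightarrow> fmat \<Rightarrow> real set" where
  "spec n h = {\<mu>. \<exists>x. corner n x \<and> x \<noteq> 0 \<and> h * x = complex_of_real \<mu> *\<^sub>C x}"

text \<open>Each \<open>l i\<close> is recorded as a member of \<open>spec n h\<close>, so that
  hypotheses about the spectrum apply to the diagonal entries directly.\<close>

definition diagonalizes :: "nat \<Rightarrow> fmat \<Rightarrow> fmat \<Rightarrow> (nat \<Rightarrow> real) \<Rightarrow> bool" where
  "diagonalizes n h W l \<longleftrightarrow> corner n W \<and> adj W * W = idmat n \<and> W * adj W = idmat n \<and>
    h = W * diag n (\<lambda>i. complex_of_real (l i)) * adj W \<and> (\<forall>i<n. l i \<in> spec n h)"

lemma diagonalizes_ex:
  assumes "corner n h" "adj h = h"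
  obtains W l where "diagonalizes n h W l"
proof -
  obtain W and l :: "nat \<Rightarrow> real" where W: "corner n W" "adj W * W = idmat n" "W * adj W = idmat n"
    "h = W * diag n (\<lambda>i. complex_of_real (l i)) * adj W"
    using hermitian_diagonalization[OF assms] by blast
  have "l i \<in> spec n h" if i: "i < n" for i
  proof -
    define b where "b = diag n (\<lambda>j. if j = i then 1 else 0)"
    have b: "corner n b" by (simp add: b_def)
    have "ent b i i \<noteq> 0" using i by (simp add: b_def)
    then have "b \<noteq> 0" by auto
    then have "W * b \<noteq> 0" using norm_isometry[OF W(2), of b] b by auto
    moreover have "h * (W * b) = W * diag n (\<lambda>i. complex_of_real (l i)) * (adj W * W) * b"
      unfolding W(4) by (simp only: mult.assoc)
    then have "h * (W * b) = W * (diag n (\<lambda>i. complex_of_real (l i)) * b)"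
      using W(2) by (simp add: mult.assoc b)
    moreover have "diag n (\<lambda>i. complex_of_real (l i)) * b = complex_of_real (l i) *\<^sub>C b"
      by (rule fmat_eqI) (auto simp: b_def ent_diag_mult)
    ultimately show ?thesis unfolding spec_def using W(1) b by (auto intro!: exI[of _ "W * b"])
  qed
  then show ?thesis using that W unfolding diagonalizes_def by blast
qed

definition is_res :: "nat \<Rightarrow> fmat \<Rightarrow> complex \<Rightarrow> fmat \<Rightarrow> bool" where
  "is_res n h z R \<longleftrightarrow> corner n R \<and> (z *\<^sub>C idmat n - h) * R = idmat n \<and> R * (z *\<^sub>C idmat n - h) = idmat n"

definition res :: "nat \<Rightarrow> fmat \<Rightarrow> complex \<Rightarrow> fmat" where
  "res n h z = (THE R. is_res n h z R)"

lemma is_res_unique: "is_res n h z R \<Longrightarrow> is_res n h z R' \<Longrightarrow> R = R'"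
proof -
  assume R: "is_res n h z R" "is_res n h z R'"
  have "R' = R' * ((z *\<^sub>C idmat n - h) * R)" using R by (simp add: is_res_def)
  also have "\<dots> = R' * (z *\<^sub>C idmat n - h) * R" by (simp only: mult.assoc)
  also have "\<dots> = R" using R by (simp add: is_res_def)
  finally show "R = R'" by simp
qed

lemma res_eqI: "is_res n h z R \<Longrightarrow> res n h z = R"
  unfolding res_def by (rule the_equality) (auto intro: is_res_unique)

text \<open>In an eigenbasis \<open>z - h\<close> is inverted entry by entry. The explicit formula
  is kept because the contour integral is later evaluated in the same basis.\<close>

lemma resolvent:
  assumes "corner n h" "\<delta> > 0" "\<And>\<mu>. \<mu> \<in> spec n h \<Longrightarrow> \<delta> \<le> cmod (z - complex_of_real \<mu>)"
    and W: "diagonalizes n h W l"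
  shows "is_res n h z (W * diag n (\<lambda>i. 1 / (z - complex_of_real (l i))) * adj W)"
    and "opnorm_le (W * diag n (\<lambda>i. 1 / (z - complex_of_real (l i))) * adj W) (1 / \<delta>)"
proof -
  note W = W[unfolded diagonalizes_def]
  let ?d = "diag n (\<lambda>i. 1 / (z - complex_of_real (l i)))"
  let ?D = "diag n (\<lambda>i. z - complex_of_real (l i))"
  have z: "\<delta> \<le> cmod (z - complex_of_real (l i))" if "i < n" for i using W assms(3) that by blast
  have eq: "?D = z *\<^sub>C idmat n - diag n (\<lambda>i. complex_of_real (l i))" by (rule fmat_eqI) auto
  have zh: "z *\<^sub>C idmat n - h = W * ?D * adj W"
    unfolding eq using W by (simp add: right_diff_distrib left_diff_distrib)
  have nz: "z - complex_of_real (l i) \<noteq> 0" if "i < n" for i using z[OF that] assms(2) by auto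
  have dD: "?d * ?D = idmat n" "?D * ?d = idmat n"
    using nz by (auto simp: diag_mult_diag intro!: fmat_eqI)
  have "(W * ?D * adj W) * (W * ?d * adj W) = W * ?D * (adj W * W) * ?d * adj W"
    by (simp only: mult.assoc)
  also have "\<dots> = W * (?D * ?d) * adj W" using W by (simp add: mult.assoc)
  also have "\<dots> = idmat n" using W by (simp add: dD)
  finally have 1: "(W * ?D * adj W) * (W * ?d * adj W) = idmat n" .
  have "(W * ?d * adj W) * (W * ?D * adj W) = W * ?d * (adj W * W) * ?D * adj W"
    by (simp only: mult.assoc)
  also have "\<dots> = W * (?d * ?D) * adj W" using W by (simp add: mult.assoc)
  also have "\<dots> = idmat n" using W by (simp add: dD)
  finally have 2: "(W * ?d * adj W) * (W * ?D * adj W) = idmat n" .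
  show "is_res n h z (W * ?d * adj W)" unfolding is_res_def zh using 1 2 W by simp
  have "opnorm_le ?d (1 / \<delta>)"
  proof (rule opnorm_le_diag)
    fix i assume "i < n"
    then show "cmod (1 / (z - complex_of_real (l i))) \<le> 1 / \<delta>"
      using z[of i] assms(2) by (simp add: norm_divide frac_le)
  qed (use assms in auto)
  moreover have "opnorm_le W 1" "opnorm_le (adj W) 1" using W by (auto intro: opnorm_le_isometry)
  ultimately show "opnorm_le (W * ?d * adj W) (1 / \<delta>)"
    using opnorm_le_mult[OF opnorm_le_mult[of W 1 ?d "1 / \<delta>"], of "adj W" 1] assms(2) by simp
qed

lemma res_spectral:
  assumes "corner n h" "adj h = h" "\<delta> > 0" "\<And>\<mu>. \<mu> \<in> spec n h \<Longrightarrow> \<delta> \<le> cmod (z - complex_of_real \<mu>)"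
  shows "is_res n h z (res n h z)" "opnorm_le (res n h z) (1 / \<delta>)"
proof -
  obtain W l where W: "diagonalizes n h W l" using diagonalizes_ex assms by blast
  from resolvent[OF assms(1,3,4) W] show "is_res n h z (res n h z)" "opnorm_le (res n h z) (1 / \<delta>)"
    using res_eqI by auto
qed

text \<open>Both arguments are left free: \<open>h = h'\<close> gives continuity along the contour,
  \<open>z = z'\<close> the dependence on the perturbation parameter.\<close>

lemma res_identity:
  assumes "corner n h" "corner n h'" "is_res n h z R" "is_res n h' z' R'"
  shows "R' - R = R' * (z *\<^sub>C idmat n - h - (z' *\<^sub>C idmat n - h')) * R"
proof -
  have "R' * (z *\<^sub>C idmat n - h) * R = R'" "R' * (z' *\<^sub>C idmat n - h') * R = R"
    using assms by (simp_all add: is_res_def mult.assoc)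
  then show ?thesis by (simp only: right_diff_distrib left_diff_distrib)
qed

section \<open>The contour and the Riesz projection\<close>

definition contour_pt :: "real \<Rightarrow> complex" where "contour_pt t = exp (2 * of_real pi * \<i> * of_real t) / 2"

lemma norm_contour_pt [simp]: "cmod (contour_pt t) = 1 / 2"
  by (simp add: contour_pt_def norm_divide)

lemma continuous_contour_pt: "continuous_on S contour_pt"
  unfolding contour_pt_def by (intro continuous_intros) auto

text \<open>With \<open>w = 1 + contour_pt t\<close> the differential \<open>dw\<close> is
  \<open>2 pi i contour_pt t dt\<close>, so the integral is the winding number around
  \<open>\<mu>\<close> of the circle of radius 1/2 about 1.\<close>

lemma contour_pt_integral:
  assumes "cmod (\<mu> - 1) \<noteq> 1 / 2"
  shows "((\<lambda>t. contour_pt t / (1 + contour_pt t - \<mu>)) has_integral (if cmod (\<mu> - 1) < 1 / 2 then 1 else 0)) {0..1}"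
proof -
  let ?g = "circlepath 1 (1/2)"
  have notin: "\<mu> \<notin> path_image ?g" using assms by (simp add: dist_norm norm_minus_commute)
  have wn: "winding_number ?g \<mu> = (if cmod (\<mu> - 1) < 1 / 2 then 1 else 0)"
  proof (cases "cmod (\<mu> - 1) < 1 / 2")
    case True then show ?thesis by (simp add: winding_number_circlepath)
  next
    case False
    have "winding_number ?g \<mu> = 0"
      by (rule winding_number_zero_outside[of _ "cball 1 (1/2)"])
         (use False assms in \<open>auto simp: dist_norm norm_minus_commute\<close>)
    then show ?thesis using False by simp
  qed
  have "((\<lambda>w. 1 / (w - \<mu>)) has_contour_integral (2 * of_real pi * \<i> * winding_number ?g \<mu>)) ?g"
    using has_contour_integral_winding_number[OF valid_path_circlepath notin] by simp
  then have "((\<lambda>t. 1 / (?g t - \<mu>) * vector_derivative ?g (at t within {0..1}))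
      has_integral (2 * of_real pi * \<i> * winding_number ?g \<mu>)) {0..1}"
    by (simp add: has_contour_integral_def)
  from has_integral_mult_right[OF this, of "1 / (2 * of_real pi * \<i>)"]
  have "((\<lambda>t. 1 / (2 * of_real pi * \<i>) * (1 / (?g t - \<mu>) * vector_derivative ?g (at t within {0..1})))
      has_integral winding_number ?g \<mu>) {0..1}" by simp
  moreover have "1 / (2 * of_real pi * \<i>) * (1 / (?g t - \<mu>) * vector_derivative ?g (at t within {0..1}))
      = contour_pt t / (1 + contour_pt t - \<mu>)" if "t \<in> {0..1}" for t
  proof -
    have "vector_derivative ?g (at t within {0..1}) = 2 * of_real pi * \<i> * contour_pt t"
      using that by (subst vector_derivative_circlepath01) (auto simp: contour_pt_def)
    moreover have "?g t = 1 + contour_pt t" by (simp add: circlepath contour_pt_def)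
    ultimately show ?thesis by simp
  qed
  ultimately show ?thesis unfolding wn by (rule has_integral_eq[rotated])
qed

text \<open>Every point of the circle \<open>|z - 1| = 1/2\<close> has distance at least 1/2 from
  -1, 0 and 1. Hence \<open>d\<close> bounds from below the distance between the spectrum and the
  contour.\<close>

definition gapped :: "nat \<Rightarrow> fmat \<Rightarrow> real \<Rightarrow> bool" where
  "gapped n h d \<longleftrightarrow> corner n h \<and> adj h = h \<and> d > 0 \<and>
    (\<forall>\<mu>\<in>spec n h. \<exists>k\<in>{-1, 0, 1}. \<bar>\<mu> - k\<bar> \<le> 1/2 - d)"

lemma gapped_contour:
  assumes "gapped n h d" "\<mu> \<in> spec n h"
  shows "d \<le> cmod (1 + contour_pt t - complex_of_real \<mu>)"
proof -
  obtain k :: real where k: "k \<in> {-1, 0, 1}" "\<bar>\<mu> - k\<bar> \<le> 1/2 - d" using assms unfolding gapped_def by blast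
  have "1/2 \<le> cmod (1 + contour_pt t - complex_of_real k)"
  proof -
    have "cmod (complex_of_real (k - 1)) - cmod (contour_pt t) \<le> cmod (complex_of_real (k - 1) - contour_pt t)"
      by (rule norm_triangle_ineq2)
    also have "\<dots> = cmod (1 + contour_pt t - complex_of_real k)"
      by (subst norm_minus_cancel[symmetric]) (simp add: algebra_simps)
    finally show ?thesis using k(1) by (auto simp: norm_minus_commute simp del: of_real_diff)
  qed
  also have "\<dots> \<le> cmod (1 + contour_pt t - complex_of_real \<mu>) + cmod (complex_of_real (\<mu> - k))"
    by (rule order.trans[OF _ norm_triangle_ineq]) (simp add: algebra_simps)
  finally show ?thesis using k(2) by (simp del: of_real_diff)
qed

definition contour_res :: "nat \<Rightarrow> fmat \<Rightarrow> real \<Rightarrow> fmat" where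
  "contour_res n h t = res n h (1 + contour_pt t)"

lemma contour_res:
  assumes "gapped n h d"
  shows "is_res n h (1 + contour_pt t) (contour_res n h t)" "opnorm_le (contour_res n h t) (1 / d)" "corner n (contour_res n h t)"
proof -
  show 1: "is_res n h (1 + contour_pt t) (contour_res n h t)" and "opnorm_le (contour_res n h t) (1 / d)"
    unfolding contour_res_def using assms gapped_contour[OF assms]
    by (auto simp: gapped_def intro!: res_spectral)
  then show "corner n (contour_res n h t)" by (simp add: is_res_def)
qed

lemma norm_contour_res: "gapped n h d \<Longrightarrow> norm (contour_res n h t) \<le> norm (idmat n) / d"
  using opnorm_le_norm[OF contour_res(2,3)] by simp

text \<open>The resolvent identity and the uniform norm bound make the resolvent Lipschitz in the
  contour point.\<close>

lemma continuous_contour_res: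
  assumes "gapped n h d" shows "continuous_on S (contour_res n h)"
proof -
  let ?B = "norm (idmat n) / d"
  have B: "0 \<le> ?B" using assms by (simp add: gapped_def)
  have h: "corner n h" using assms by (simp add: gapped_def)
  have lip: "norm (contour_res n h t' - contour_res n h t) \<le> ?B * ?B * cmod (contour_pt t' - contour_pt t)" for t t'
  proof -
    have "contour_res n h t' - contour_res n h t = contour_res n h t' * ((1 + contour_pt t) *\<^sub>C idmat n - h - ((1 + contour_pt t') *\<^sub>C idmat n - h)) * contour_res n h t"
      by (rule res_identity[OF h h contour_res(1)[OF assms] contour_res(1)[OF assms]])
    also have "(1 + contour_pt t) *\<^sub>C idmat n - h - ((1 + contour_pt t') *\<^sub>C idmat n - h) = (contour_pt t - contour_pt t') *\<^sub>C idmat n"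
      by (simp add: scC_add_left scC_diff_left)
    also have "contour_res n h t' * \<dots> * contour_res n h t = (contour_pt t - contour_pt t') *\<^sub>C (contour_res n h t' * contour_res n h t)"
      using contour_res(3)[OF assms] by simp
    also have "norm \<dots> = cmod (contour_pt t' - contour_pt t) * norm (contour_res n h t' * contour_res n h t)"
      by (simp add: norm_minus_commute)
    also have "\<dots> \<le> cmod (contour_pt t' - contour_pt t) * (?B * ?B)"
      by (intro mult_left_mono order.trans[OF norm_mult_ineq] mult_mono norm_contour_res assms) (auto simp: B)
    finally show ?thesis by (simp add: mult.commute)
  qed
  show ?thesis
    unfolding continuous_on_def
  proof
    fix t assume "t \<in> S"
    have "((\<lambda>t'. ?B * ?B * cmod (contour_pt t' - contour_pt t)) \<longlongrightarrow> ?B * ?B * cmod (contour_pt t - contour_pt t)) (at t within S)"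
      using continuous_contour_pt[of S] \<open>t \<in> S\<close> unfolding continuous_on_def by (intro tendsto_intros) auto
    then have "((\<lambda>t'. ?B * ?B * cmod (contour_pt t' - contour_pt t)) \<longlongrightarrow> 0) (at t within S)" by simp
    moreover have "\<forall>\<^sub>F t' in at t within S. dist (contour_res n h t') (contour_res n h t) \<le> dist (?B * ?B * cmod (contour_pt t' - contour_pt t)) 0"
    proof (rule always_eventually, rule allI)
      fix t' show "dist (contour_res n h t') (contour_res n h t) \<le> dist (?B * ?B * cmod (contour_pt t' - contour_pt t)) 0"
        using lip[of t' t] unfolding dist_norm by simp
    qed
    ultimately show "(contour_res n h \<longlongrightarrow> contour_res n h t) (at t within S)"
      by (rule metric_tendsto_imp_tendsto)
  qed
qed

text \<open>The contour integral of the resolvent divided by \<open>2 pi i\<close>; the factor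
  \<open>contour_pt t\<close> is what remains of \<open>dz / (2 pi i)\<close>.\<close>

definition riesz :: "nat \<Rightarrow> fmat \<Rightarrow> fmat" where
  "riesz n h = integral {0..1} (\<lambda>t. contour_pt t *\<^sub>C contour_res n h t)"

lemma continuous_scC:
  "continuous_on S f \<Longrightarrow> continuous_on S F \<Longrightarrow> continuous_on S (\<lambda>t. f t *\<^sub>C F t)"
proof -
  interpret bounded_bilinear scC
    by standard (auto simp: scC_add_left scC_add_right scaleR_conv_of_real scC_of_real[symmetric] mult.commute intro!: exI[of _ 1])
  show "continuous_on S f \<Longrightarrow> continuous_on S F \<Longrightarrow> continuous_on S (\<lambda>t. f t *\<^sub>C F t)"
    by (rule continuous_on)
qed

lemma riesz_has_integral:
  assumes "gapped n h d"
  shows "((\<lambda>t. contour_pt t *\<^sub>C contour_res n h t) has_integral riesz n h) {0..1}"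
  unfolding riesz_def
  by (intro integrable_integral continuous_corner_integrable[of _ _ _ n] continuous_scC continuous_contour_pt
      continuous_contour_res[OF assms] corner_scC contour_res(3)[OF assms])

text \<open>Integration commutes with the change of basis by \<open>W\<close>, and each diagonal
  entry integrates to a winding number: 1 for eigenvalues inside the circle, 0 for those
  outside.\<close>

lemma riesz_spectral:
  assumes "gapped n h d" "diagonalizes n h W l"
  shows "riesz n h = W * diag n (\<lambda>i. if \<bar>l i - 1\<bar> < 1/2 then 1 else 0) * adj W"
proof -
  have l: "cmod (complex_of_real (l i) - 1) \<noteq> 1/2" "\<bar>l i - 1\<bar> = cmod (complex_of_real (l i) - 1)" if "i < n" for i
  proof -
    show eq: "\<bar>l i - 1\<bar> = cmod (complex_of_real (l i) - 1)" by (metis norm_of_real of_real_1 of_real_diff real_norm_def)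
    have "l i \<in> spec n h" using assms(2) that unfolding diagonalizes_def by blast
    then obtain k :: real where "k \<in> {-1, 0, 1}" "\<bar>l i - k\<bar> \<le> 1/2 - d" "d > 0" using assms(1) unfolding gapped_def by blast
    then show "cmod (complex_of_real (l i) - 1) \<noteq> 1/2" unfolding eq[symmetric] by (auto simp: abs_if split: if_splits)
  qed
  have "((\<lambda>t. mk n (\<lambda>i j. if i = j then contour_pt t / (1 + contour_pt t - complex_of_real (l i)) else 0)) has_integral
     mk n (\<lambda>i j. if i = j then (if \<bar>l i - 1\<bar> < 1/2 then 1 else 0) else 0)) {0..1}"
  proof (rule has_integral_mk)
    fix i j assume "i < n" "j < n"
    show "((\<lambda>t. if i = j then contour_pt t / (1 + contour_pt t - complex_of_real (l i)) else 0) has_integral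
      (if i = j then if \<bar>l i - 1\<bar> < 1/2 then 1 else 0 else 0)) {0..1}"
      using contour_pt_integral[OF l(1)[OF \<open>i < n\<close>]] l(2)[OF \<open>i < n\<close>] by (cases "i = j") simp_all
  qed
  then have "((\<lambda>t. diag n (\<lambda>i. contour_pt t / (1 + contour_pt t - complex_of_real (l i)))) has_integral
     diag n (\<lambda>i. if \<bar>l i - 1\<bar> < 1/2 then 1 else 0)) {0..1}"
    unfolding diag_def .
  from has_integral_lin[OF has_integral_lin[OF this bounded_linear_mult_right[of W]] bounded_linear_mult_left[of "adj W"]]
  have "((\<lambda>t. W * diag n (\<lambda>i. contour_pt t / (1 + contour_pt t - complex_of_real (l i))) * adj W) has_integral
     W * diag n (\<lambda>i. if \<bar>l i - 1\<bar> < 1/2 then 1 else 0) * adj W) {0..1}" .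
  moreover have "W * diag n (\<lambda>i. contour_pt t / (1 + contour_pt t - complex_of_real (l i))) * adj W = contour_pt t *\<^sub>C contour_res n h t" for t
  proof -
    have "contour_res n h t = W * diag n (\<lambda>i. 1 / (1 + contour_pt t - complex_of_real (l i))) * adj W"
      unfolding contour_res_def using assms gapped_contour[OF assms(1)]
      by (intro res_eqI resolvent(1)[of n h d]) (auto simp: gapped_def)
    moreover have "contour_pt t *\<^sub>C diag n (\<lambda>i. 1 / (1 + contour_pt t - complex_of_real (l i)))
        = diag n (\<lambda>i. contour_pt t / (1 + contour_pt t - complex_of_real (l i)))"
      by (rule fmat_eqI) auto
    moreover have "W * (contour_pt t *\<^sub>C A) * adj W = contour_pt t *\<^sub>C (W * A * adj W)" for A by simp
    ultimately show ?thesis by metis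
  qed
  ultimately have "((\<lambda>t. contour_pt t *\<^sub>C contour_res n h t) has_integral
     W * diag n (\<lambda>i. if \<bar>l i - 1\<bar> < 1/2 then 1 else 0) * adj W) {0..1}" by simp
  then show ?thesis by (rule has_integral_unique[OF riesz_has_integral[OF assms(1)]])
qed

lemma inner_diag:
  assumes "corner n Y"
  shows "inner Y (diag n (\<lambda>i. complex_of_real (l i)) * Y) = (\<Sum>i<n. l i * (\<Sum>j<n. (cmod (ent Y i j))\<^sup>2))"
proof -
  have *: "cnj z * (complex_of_real a * z) = complex_of_real (a * (cmod z)\<^sup>2)" for z a
    using complex_norm_square[of z] by (simp add: mult_ac)
  show ?thesis
    unfolding inner_fmat_left[OF assms]
    by (intro sum.cong refl) (simp add: ent_diag_mult * sum_distrib_left del: of_real_mult of_real_power)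
qed

text \<open>Everything is read off the eigenbasis, where the projection is a diagonal matrix of
  zeros and ones. The last two claims turn the gap into bounds on the quadratic form: an eigenvalue
  inside the circle is at least \<open>1/2 + d\<close>, one outside at most
  \<open>1/2 - d\<close>.\<close>

lemma riesz_projection:
  assumes "gapped n h d"
  shows "corner n (riesz n h)" "adj (riesz n h) = riesz n h" "riesz n h * riesz n h = riesz n h" "riesz n h * h = h * riesz n h"
    and "\<And>X. corner n X \<Longrightarrow> riesz n h * X = X \<Longrightarrow> inner X (h * X) \<ge> (1/2 + d) * (norm X)\<^sup>2"
    and "\<And>X. corner n X \<Longrightarrow> riesz n h * X = 0 \<Longrightarrow> inner X (h * X) \<le> (1/2 - d) * (norm X)\<^sup>2"
proof -
  obtain W l where Wl: "diagonalizes n h W l" using diagonalizes_ex assms unfolding gapped_def by blast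
  note W = Wl[unfolded diagonalizes_def]
  define ch where "ch = (\<lambda>i. if \<bar>l i - 1\<bar> < 1/2 then 1 else 0 :: complex)"
  have P: "riesz n h = W * diag n ch * adj W" unfolding ch_def by (rule riesz_spectral[OF assms Wl])
  show "corner n (riesz n h)" unfolding P using W by simp
  have "adj (diag n ch) = diag n ch" by (rule fmat_eqI) (auto simp: ch_def)
  then show "adj (riesz n h) = riesz n h" unfolding P by (simp add: adj_mult mult.assoc)
  have mm: "W * A * adj W * (W * B * adj W) = W * (A * B) * adj W" if "corner n A" for A B
  proof -
    have "W * A * adj W * (W * B * adj W) = W * (A * (adj W * W) * B) * adj W" by (simp only: mult.assoc)
    then show ?thesis using W that by simp
  qed
  have "diag n ch * diag n ch = diag n ch" by (auto simp: diag_mult_diag ch_def intro!: diag_cong)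
  then show "riesz n h * riesz n h = riesz n h" unfolding P by (simp add: mm)
  have h: "h = W * diag n (\<lambda>i. complex_of_real (l i)) * adj W" using W by blast
  have "diag n ch * diag n (\<lambda>i. complex_of_real (l i)) = diag n (\<lambda>i. complex_of_real (l i)) * diag n ch"
    by (simp add: diag_mult_diag mult.commute)
  then have "riesz n h * (W * diag n (\<lambda>i. complex_of_real (l i)) * adj W)
      = W * diag n (\<lambda>i. complex_of_real (l i)) * adj W * riesz n h"
    unfolding P by (simp add: mm)
  then show "riesz n h * h = h * riesz n h" unfolding h[symmetric] .
  have lb: "\<bar>l i - 1\<bar> < 1/2 \<and> l i \<ge> 1/2 + d \<or> \<not> \<bar>l i - 1\<bar> < 1/2 \<and> l i \<le> 1/2 - d" if "i < n" for i
  proof -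
    have "l i \<in> spec n h" using W that by blast
    then obtain k :: real where "k \<in> {-1, 0, 1}" "\<bar>l i - k\<bar> \<le> 1/2 - d" "d > 0" using assms unfolding gapped_def by blast
    then show ?thesis by (auto simp: abs_if split: if_splits)
  qed
  have quad: "inner X (h * X) = (\<Sum>i<n. l i * (\<Sum>j<n. (cmod (ent (adj W * X) i j))\<^sup>2))"
    and nrm: "(norm X)\<^sup>2 = (\<Sum>i<n. \<Sum>j<n. (cmod (ent (adj W * X) i j))\<^sup>2)" if "corner n X" for X
  proof -
    have Y: "corner n (adj W * X)" using W that by auto
    have "inner X (h * X) = inner (adj W * X) (diag n (\<lambda>i. complex_of_real (l i)) * (adj W * X))"
      by (subst h) (simp add: inner_adj mult.assoc)
    then show "inner X (h * X) = (\<Sum>i<n. l i * (\<Sum>j<n. (cmod (ent (adj W * X) i j))\<^sup>2))"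
      unfolding inner_diag[OF Y] .
    have "norm (adj W * X) = norm X" using norm_isometry[of "adj W" n X] W that by simp
    then show "(norm X)\<^sup>2 = (\<Sum>i<n. \<Sum>j<n. (cmod (ent (adj W * X) i j))\<^sup>2)"
      using norm_fmat_sq[OF Y] by simp
  qed
  have WP: "adj W * (riesz n h * X) = diag n ch * (adj W * X)" for X
  proof -
    have "adj W * (riesz n h * X) = (adj W * W) * diag n ch * (adj W * X)" unfolding P by (simp only: mult.assoc)
    then show ?thesis using W by simp
  qed
  show "(1/2 + d) * (norm X)\<^sup>2 \<le> inner X (h * X)" if X: "corner n X" "riesz n h * X = X" for X
  proof -
    have z: "ent (adj W * X) i j = 0" if "\<not> \<bar>l i - 1\<bar> < 1/2" "i < n" for i j
    proof -
      have "ent (diag n ch * (adj W * X)) i j = ent (adj W * X) i j" using WP[of X] X(2) by simp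
      then show ?thesis using that by (simp add: ent_diag_mult ch_def)
    qed
    show ?thesis
      unfolding quad[OF X(1)] nrm[OF X(1)]
    proof (subst sum_distrib_left, rule sum_mono)
      fix i assume "i \<in> {..<n}"
      then consider "l i \<ge> 1/2 + d" | "\<forall>j. ent (adj W * X) i j = 0" using lb[of i] z[of i] by auto
      then show "(1/2 + d) * (\<Sum>j<n. (cmod (ent (adj W * X) i j))\<^sup>2) \<le> l i * (\<Sum>j<n. (cmod (ent (adj W * X) i j))\<^sup>2)"
        by cases (auto intro!: mult_right_mono sum_nonneg)
    qed
  qed
  show "inner X (h * X) \<le> (1/2 - d) * (norm X)\<^sup>2" if X: "corner n X" "riesz n h * X = 0" for X
  proof -
    have z: "ent (adj W * X) i j = 0" if "\<bar>l i - 1\<bar> < 1/2" "i < n" for i j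
    proof -
      have "ent (diag n ch * (adj W * X)) i j = 0" using WP[of X] X(2) by simp
      then show ?thesis using that by (simp add: ent_diag_mult ch_def)
    qed
    show ?thesis
      unfolding quad[OF X(1)] nrm[OF X(1)]
    proof (subst sum_distrib_left, rule sum_mono)
      fix i assume "i \<in> {..<n}"
      then consider "l i \<le> 1/2 - d" | "\<forall>j. ent (adj W * X) i j = 0" using lb[of i] z[of i] by auto
      then show "l i * (\<Sum>j<n. (cmod (ent (adj W * X) i j))\<^sup>2) \<le> (1/2 - d) * (\<Sum>j<n. (cmod (ent (adj W * X) i j))\<^sup>2)"
        by cases (auto intro!: mult_right_mono sum_nonneg)
    qed
  qed
qed

text \<open>\<open>A\<close> commutes with every resolvent on the contour, hence with their
  integral. It is applied to \<open>M s\<close>, which commutes with \<open>h s\<close>.\<close>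

lemma riesz_commute:
  assumes "gapped n h d" "corner n A" "A * h = h * A"
  shows "A * riesz n h = riesz n h * A"
proof -
  have AR: "A * contour_res n h t = contour_res n h t * A" for t
  proof -
    let ?R = "contour_res n h t" and ?z = "(1 + contour_pt t) *\<^sub>C idmat n - h"
    have R: "?z * ?R = idmat n" "?R * ?z = idmat n" "corner n ?R" using contour_res[OF assms(1)] by (auto simp: is_res_def)
    have "A * ?z = ?z * A" using assms by (simp add: left_diff_distrib right_diff_distrib)
    then have "?R * (A * ?z) * ?R = ?R * (?z * A) * ?R" by simp
    moreover have "?R * (A * ?z) * ?R = ?R * A"
      using R assms(2) by (simp add: mult.assoc)
    moreover have "?R * (?z * A) * ?R = A * ?R"
    proof -
      have "?R * (?z * A) * ?R = (?R * ?z) * (A * ?R)" by (simp only: mult.assoc)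
      then show ?thesis using R assms(2) by simp
    qed
    ultimately show ?thesis by simp
  qed
  note I = riesz_has_integral[OF assms(1)]
  have "((\<lambda>t. A * (contour_pt t *\<^sub>C contour_res n h t)) has_integral A * riesz n h) {0..1}"
    by (rule has_integral_lin[OF I bounded_linear_mult_right])
  moreover have "((\<lambda>t. contour_pt t *\<^sub>C contour_res n h t * A) has_integral riesz n h * A) {0..1}"
    by (rule has_integral_lin[OF I bounded_linear_mult_left])
  ultimately show ?thesis by (simp add: AR has_integral_unique)
qed

section \<open>The Kato generator of a gapped family\<close>

text \<open>Resolvent identities yield remainders with an explicit factor \<open>(s' - s)^2\<close>,
  so a quadratic error bound is the convenient criterion for differentiability.\<close>

lemma has_vector_derivative_quadratic:
  fixes f :: "real \<Rightarrow> 'a::real_normed_vector"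
  assumes "\<And>s'. s' \<in> S \<Longrightarrow> norm (f s' - f s - (s' - s) *\<^sub>R D) \<le> C * (s' - s)\<^sup>2"
  shows "(f has_vector_derivative D) (at s within S)"
  unfolding has_vector_derivative_def has_derivative_within
proof (intro conjI)
  show "bounded_linear (\<lambda>x. x *\<^sub>R D)" by (rule bounded_linear_scaleR_left)
  have "((\<lambda>y. C * norm (y - s)) \<longlongrightarrow> C * norm (s - s)) (at s within S)" by (intro tendsto_intros)
  then have lim: "((\<lambda>y. C * norm (y - s)) \<longlongrightarrow> 0) (at s within S)" by simp
  show "((\<lambda>y. (1 / norm (y - s)) *\<^sub>R (f y - (f s + (y - s) *\<^sub>R D))) \<longlongrightarrow> 0) (at s within S)"
  proof (rule Lim_null_comparison[OF _ lim], unfold eventually_at_filter, rule always_eventually, intro allI impI)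
    fix y assume y: "y \<noteq> s" "y \<in> S"
    have "norm ((1 / norm (y - s)) *\<^sub>R (f y - (f s + (y - s) *\<^sub>R D)))
      = norm (f y - f s - (y - s) *\<^sub>R D) / norm (y - s)" by (simp add: diff_diff_eq[symmetric])
    also have "\<dots> \<le> C * (y - s)\<^sup>2 / norm (y - s)" by (intro divide_right_mono assms y) simp
    also have "\<dots> = C * norm (y - s)"
      using y by (auto simp: power2_eq_square abs_if field_simps)
    finally show "norm ((1 / norm (y - s)) *\<^sub>R (f y - (f s + (y - s) *\<^sub>R D))) \<le> C * norm (y - s)" .
  qed
qed

lemma scaleR_scC: "a *\<^sub>R c *\<^sub>C A = c *\<^sub>C a *\<^sub>R A"
  by (rule fmat_eqI) simp

lemma vector_derivative_unique_Icc:
  assumes "s \<in> {0..1::real}" "(f has_vector_derivative A) (at s within {0..1})"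
    "(f has_vector_derivative B) (at s within {0..1})"
  shows "A = B"
  using vector_derivative_unique_within_closed_interval[of 0 1 s f A B] assms by simp

lemma has_integral_norm_le:
  fixes F :: "real \<Rightarrow> fmat"
  assumes "(F has_integral I) {0..1}" "\<And>t. t \<in> {0..1} \<Longrightarrow> norm (F t) \<le> B"
  shows "norm I \<le> B"
proof -
  have "0 \<le> B" by (rule order_trans[OF norm_ge_zero assms(2)[of 0]]) simp
  then show ?thesis using has_integral_bound[of B F I 0 1] assms by simp
qed

lemma opnorm_le_spec:
  assumes "corner n A" "adj A = A" "\<And>\<mu>. \<mu> \<in> spec n A \<Longrightarrow> \<bar>\<mu>\<bar> \<le> b" "0 \<le> b"
  shows "opnorm_le A b"
proof -
  obtain W l where W: "diagonalizes n A W l" using diagonalizes_ex assms by blast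
  note W = W[unfolded diagonalizes_def]
  have "opnorm_le W 1" "opnorm_le (adj W) 1" using W by (auto intro: opnorm_le_isometry)
  moreover have "opnorm_le (diag n (\<lambda>i. complex_of_real (l i))) b"
    using W assms(3,4) by (intro opnorm_le_diag) auto
  ultimately have "opnorm_le (W * diag n (\<lambda>i. complex_of_real (l i)) * adj W) (1 * b * 1)"
    using assms(4) by (intro opnorm_le_mult) auto
  then show ?thesis using W by simp
qed

text \<open>The length of \<open>A * X\<close> equals that of \<open>Q * X\<close>, because
  \<open>A\<close> is self-adjoint and squares to the projection \<open>Q\<close>.\<close>

lemma opnorm_le_partial_reflection:
  assumes "adj A = A" "adj Q = Q" "A * A = Q" "Q * Q = Q" shows "opnorm_le A 1"
  unfolding opnorm_le_def
proof
  fix X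
  have "(norm (A * X))\<^sup>2 = inner X (A * A * X)"
    by (simp add: power2_norm_eq_inner inner_adj assms(1) mult.assoc)
  also have "\<dots> = (norm (Q * X))\<^sup>2"
    unfolding assms(3) by (simp add: power2_norm_eq_inner inner_adj assms(2,4) mult.assoc[symmetric])
  also have "\<dots> \<le> (norm X)\<^sup>2" using opbD[OF opnorm_le_projection[OF assms(2,4)], of X] by (simp add: power_mono)
  finally show "norm (A * X) \<le> 1 * norm X" by (simp add: power2_le_iff_abs_le)
qed

text \<open>The cubic relation confines the spectrum of \<open>h0\<close> to -1, 0, 1. The two
  conjugation hypotheses say that \<open>h0\<close> and \<open>v\<close> are \<open>i\<close> times
  real matrices, so that conjugation reverses the sign of the spectrum.\<close>

locale perturbation =
  fixes n :: nat and h0 v :: fmat and \<epsilon> :: real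
  assumes h0: "corner n h0" "adj h0 = h0" "h0 * h0 * h0 = h0" "cnjm h0 = - h0"
    and v: "corner n v" "adj v = v" "cnjm v = - v" "opnorm_le v \<epsilon>"
    and eps: "0 \<le> \<epsilon>" "\<epsilon> < 1/2"
begin

definition h :: "real \<Rightarrow> fmat" where "h s = h0 + s *\<^sub>R v"

lemma h: "corner n (h s)" "adj (h s) = h s" "cnjm (h s) = - h s"
  using h0 v by (simp_all add: h_def adj_add adj_scaleR cnjm_add cnjm_scaleR)

lemma spec_h0: "\<mu> \<in> spec n h0 \<Longrightarrow> \<mu> \<in> {-1, 0, 1}"
proof -
  assume "\<mu> \<in> spec n h0"
  then obtain x where x: "x \<noteq> 0" "h0 * x = complex_of_real \<mu> *\<^sub>C x" unfolding spec_def by blast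
  have "h0 * h0 * h0 * x = complex_of_real (\<mu> * \<mu> * \<mu>) *\<^sub>C x" by (simp add: mult.assoc x(2))
  then have "complex_of_real (\<mu> * \<mu> * \<mu> - \<mu>) *\<^sub>C x = 0" by (simp add: h0(3) x(2) scC_diff_left)
  then have "cmod (complex_of_real (\<mu> * \<mu> * \<mu> - \<mu>)) * norm x = 0" by (metis norm_scC norm_zero)
  then have "\<mu> * \<mu> * \<mu> - \<mu> = 0" using x(1) by (simp del: of_real_diff of_real_mult)
  then have "\<mu> * (\<mu> - 1) * (\<mu> + 1) = 0" by (simp add: algebra_simps)
  then show ?thesis by auto
qed

text \<open>If \<open>\<mu>\<close> had distance more than \<open>s * \<epsilon>\<close> from -1, 0
  and 1, its eigenvector would satisfy \<open>x = s R v x\<close> with \<open>R\<close> the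
  resolvent of \<open>h0\<close> at \<open>\<mu>\<close>, and \<open>s R v\<close> would have norm
  below 1.\<close>

lemma gapped_h:
  assumes "s \<in> {0..1}" shows "gapped n (h s) (1/2 - s * \<epsilon>)"
proof -
  have se: "s * \<epsilon> \<le> \<epsilon>" "0 \<le> s * \<epsilon>" using assms eps by (auto simp: mult_left_le_one_le)
  have "\<exists>k\<in>{-1, 0, 1}. \<bar>\<mu> - k\<bar> \<le> 1/2 - (1/2 - s * \<epsilon>)" if \<mu>: "\<mu> \<in> spec n (h s)" for \<mu>
  proof (rule ccontr)
    assume "\<not> ?thesis"
    then have far: "s * \<epsilon> < \<bar>\<mu> - k\<bar>" if "k \<in> {-1, 0, 1}" for k using that by force
    define \<delta> where "\<delta> = min \<bar>\<mu> - (-1)\<bar> (min \<bar>\<mu> - 0\<bar> \<bar>\<mu> - 1\<bar>)"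
    have \<delta>: "s * \<epsilon> < \<delta>" unfolding \<delta>_def using far[of "-1"] far[of 0] far[of 1] by simp
    obtain x where x: "corner n x" "x \<noteq> 0" "h s * x = complex_of_real \<mu> *\<^sub>C x"
      using \<mu> unfolding spec_def by blast
    have d: "\<delta> \<le> cmod (complex_of_real \<mu> - complex_of_real k)" if "k \<in> spec n h0" for k
    proof -
      have "\<delta> \<le> \<bar>\<mu> - k\<bar>" using spec_h0[OF that] unfolding \<delta>_def by auto
      then show ?thesis by (metis norm_of_real of_real_diff real_norm_def)
    qed
    let ?R = "res n h0 (complex_of_real \<mu>)"
    have R: "is_res n h0 (complex_of_real \<mu>) ?R" "opnorm_le ?R (1 / \<delta>)"
      using res_spectral[OF h0(1,2) _ d] \<delta> se by auto
    have "(complex_of_real \<mu> *\<^sub>C idmat n - h0) * x = s *\<^sub>R (v * x)"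
      using x by (simp add: h_def algebra_simps)
    then have "?R * ((complex_of_real \<mu> *\<^sub>C idmat n - h0) * x) = s *\<^sub>R (?R * (v * x))" by simp
    moreover have "?R * ((complex_of_real \<mu> *\<^sub>C idmat n - h0) * x) = x"
      using R(1) x(1) unfolding mult.assoc[symmetric] is_res_def by simp
    ultimately have "norm x = s * norm (?R * (v * x))" using assms by (metis abs_of_nonneg atLeastAtMost_iff norm_scaleR)
    also have "\<dots> \<le> s * (1 / \<delta> * (\<epsilon> * norm x))"
      using assms \<delta> se by (intro mult_left_mono order.trans[OF opbD[OF R(2)]] opbD[OF v(4)]) auto
    also have "\<dots> = (s * \<epsilon> / \<delta>) * norm x" by simp
    also have "\<dots> < 1 * norm x" using \<delta> se x(2) by (intro mult_strict_right_mono) auto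
    finally show False by simp
  qed
  then show ?thesis unfolding gapped_def using h se eps by auto
qed

definition R :: "real \<Rightarrow> real \<Rightarrow> fmat" where "R s t = contour_res n (h s) t"
definition P :: "real \<Rightarrow> fmat" where "P s = riesz n (h s)"
text \<open>The integral for \<open>P\<close> differentiated under the integral sign, using that the
  derivative of the resolvent in \<open>s\<close> is \<open>R v R\<close>; \<open>P_deriv\<close>
  justifies this.\<close>

definition P' :: "real \<Rightarrow> fmat" where "P' s = integral {0..1} (\<lambda>t. contour_pt t *\<^sub>C (R s t * v * R s t))"
text \<open>A Frobenius bound on all resolvents of the family. It grows with \<open>n\<close> and
  enters only qualitative statements: differentiability of \<open>P\<close> and continuity of
  \<open>P'\<close>.\<close>

definition BR :: real where "BR = norm (idmat n) / (1/2 - \<epsilon>)"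

lemma R_opnorm_le: assumes "s \<in> {0..1}" shows "opnorm_le (R s t) (1 / (1/2 - \<epsilon>))"
proof (rule opnorm_le_mono)
  show "opnorm_le (R s t) (1 / (1/2 - s * \<epsilon>))" unfolding R_def by (rule contour_res(2)[OF gapped_h[OF assms]])
  have "s * \<epsilon> \<le> \<epsilon>" using assms eps by (auto simp: mult_left_le_one_le)
  then show "1 / (1/2 - s * \<epsilon>) \<le> 1 / (1/2 - \<epsilon>)" using eps by (intro divide_left_mono mult_pos_pos) auto
qed

lemma R_corner [simp]: "s \<in> {0..1} \<Longrightarrow> corner n (R s t)"
  unfolding R_def by (rule contour_res(3)[OF gapped_h])

lemma norm_R: "s \<in> {0..1} \<Longrightarrow> norm (R s t) \<le> BR"
  using opnorm_le_norm[OF R_opnorm_le R_corner] by (simp add: BR_def)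

lemma BR_nonneg: "0 \<le> BR" using eps by (simp add: BR_def)

lemma continuous_R: "s \<in> {0..1} \<Longrightarrow> continuous_on S (R s)"
  unfolding R_def by (rule continuous_contour_res[OF gapped_h])

lemma R_diff:
  assumes "s \<in> {0..1}" "s' \<in> {0..1}"
  shows "R s' t - R s t = (s' - s) *\<^sub>R (R s' t * v * R s t)"
proof -
  have "R s' t - R s t = R s' t * ((1 + contour_pt t) *\<^sub>C idmat n - h s - ((1 + contour_pt t) *\<^sub>C idmat n - h s')) * R s t"
    unfolding R_def by (rule res_identity[OF h(1) h(1) contour_res(1)[OF gapped_h] contour_res(1)[OF gapped_h]]) (use assms in auto)
  also have "(1 + contour_pt t) *\<^sub>C idmat n - h s - ((1 + contour_pt t) *\<^sub>C idmat n - h s') = (s' - s) *\<^sub>R v"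
    by (simp add: h_def algebra_simps)
  finally show ?thesis by simp
qed

lemma P_int: "s \<in> {0..1} \<Longrightarrow> ((\<lambda>t. contour_pt t *\<^sub>C R s t) has_integral P s) {0..1}"
  unfolding R_def P_def by (rule riesz_has_integral[OF gapped_h])

lemma P'_int: "s \<in> {0..1} \<Longrightarrow> ((\<lambda>t. contour_pt t *\<^sub>C (R s t * v * R s t)) has_integral P' s) {0..1}"
  unfolding P'_def
  by (intro integrable_integral continuous_corner_integrable[of _ _ _ n] continuous_scC continuous_contour_pt
      continuous_on_mult continuous_R continuous_on_const) (auto simp: v)

text \<open>By \<open>R_diff\<close> used twice, the error in the linear approximation of the
  resolvent is exactly \<open>(s' - s)^2\<close> times the product of \<open>R s'\<close>,
  \<open>v\<close>, \<open>R s\<close>, \<open>v\<close>, \<open>R s\<close>, which is bounded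
  uniformly on the contour.\<close>

lemma P_deriv:
  assumes "s \<in> {0..1}"
  shows "(P has_vector_derivative P' s) (at s within {0..1})"
proof (rule has_vector_derivative_quadratic)
  fix s' :: real assume s': "s' \<in> {0..1}"
  let ?C = "BR * norm v * (BR * norm v * BR)"
  have "((\<lambda>t. contour_pt t *\<^sub>C R s' t - contour_pt t *\<^sub>C R s t - (s' - s) *\<^sub>R (contour_pt t *\<^sub>C (R s t * v * R s t)))
     has_integral (P s' - P s - (s' - s) *\<^sub>R P' s)) {0..1}"
    by (intro has_integral_diff has_integral_cmul P_int P'_int assms s')
  then show "norm (P s' - P s - (s' - s) *\<^sub>R P' s) \<le> ?C * (s' - s)\<^sup>2"
  proof (rule has_integral_norm_le)
    fix t :: real
    have "R s' t - R s t - (s' - s) *\<^sub>R (R s t * v * R s t) = (s' - s) *\<^sub>R ((R s' t - R s t) * v * R s t)"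
      using R_diff[OF assms s', of t] by (simp add: algebra_simps)
    also have "\<dots> = (s' - s)\<^sup>2 *\<^sub>R (R s' t * v * (R s t * v * R s t))"
      unfolding R_diff[OF assms s'] by (simp add: mult.assoc power2_eq_square)
    finally have "contour_pt t *\<^sub>C R s' t - contour_pt t *\<^sub>C R s t - (s' - s) *\<^sub>R (contour_pt t *\<^sub>C (R s t * v * R s t))
      = contour_pt t *\<^sub>C ((s' - s)\<^sup>2 *\<^sub>R (R s' t * v * (R s t * v * R s t)))"
      by (simp only: scaleR_scC scC_diff_right[symmetric])
    then have "norm (contour_pt t *\<^sub>C R s' t - contour_pt t *\<^sub>C R s t - (s' - s) *\<^sub>R (contour_pt t *\<^sub>C (R s t * v * R s t)))
      = 1/2 * ((s' - s)\<^sup>2 * norm (R s' t * v * (R s t * v * R s t)))" by simp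
    also have "\<dots> \<le> 1 * ((s' - s)\<^sup>2 * ?C)"
      by (intro mult_mono mult_left_mono order.trans[OF norm_mult_ineq] norm_R assms s')
         (auto simp: BR_nonneg)
    finally show "norm (contour_pt t *\<^sub>C R s' t - contour_pt t *\<^sub>C R s t - (s' - s) *\<^sub>R (contour_pt t *\<^sub>C (R s t * v * R s t)))
      \<le> ?C * (s' - s)\<^sup>2" by (simp add: mult.commute)
  qed
qed

lemma P'_continuous: "continuous_on {0..1} P'"
proof -
  let ?C = "2 * (BR * norm v * (BR * norm v * BR))"
  have lip: "dist (P' s') (P' s) \<le> ?C * dist s' s" if s: "s \<in> {0..1}" "s' \<in> {0..1}" for s s'
  proof -
    have "((\<lambda>t. contour_pt t *\<^sub>C (R s' t * v * R s' t) - contour_pt t *\<^sub>C (R s t * v * R s t)) has_integral (P' s' - P' s)) {0..1}"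
      by (intro has_integral_diff P'_int s)
    then have "norm (P' s' - P' s) \<le> ?C * \<bar>s' - s\<bar>"
    proof (rule has_integral_norm_le)
      fix t :: real
      have "R s' t * v * R s' t - R s t * v * R s t = (R s' t - R s t) * v * R s' t + R s t * v * (R s' t - R s t)"
        by (simp add: algebra_simps)
      also have "\<dots> = (s' - s) *\<^sub>R (R s' t * v * (R s t * v * R s' t) + R s t * v * (R s' t * v * R s t))"
        unfolding R_diff[OF s] by (simp add: algebra_simps)
      finally have "norm (contour_pt t *\<^sub>C (R s' t * v * R s' t) - contour_pt t *\<^sub>C (R s t * v * R s t))
        = 1/2 * (\<bar>s' - s\<bar> * norm (R s' t * v * (R s t * v * R s' t) + R s t * v * (R s' t * v * R s t)))"
        by (simp flip: scC_diff_right)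
      also have "\<dots> \<le> 1 * (\<bar>s' - s\<bar> * (BR * norm v * (BR * norm v * BR) + BR * norm v * (BR * norm v * BR)))"
        by (intro mult_mono mult_left_mono order.trans[OF norm_mult_ineq] order.trans[OF norm_triangle_ineq]
            add_mono norm_R s) (auto simp: BR_nonneg)
      finally show "norm (contour_pt t *\<^sub>C (R s' t * v * R s' t) - contour_pt t *\<^sub>C (R s t * v * R s t)) \<le> ?C * \<bar>s' - s\<bar>"
        by (simp add: algebra_simps)
    qed
    then show ?thesis by (simp add: dist_norm)
  qed
  have "?C-lipschitz_on {0..1} P'"
    by (rule lipschitz_onI) (use lip BR_nonneg in auto)
  then show ?thesis by (rule lipschitz_on_continuous_on)
qed

lemma P_continuous: "continuous_on {0..1} P"
  by (rule continuous_on_vector_derivative[of _ _ P']) (rule P_deriv)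

lemma P_proj:
  assumes "s \<in> {0..1}"
  shows "corner n (P s)" "adj (P s) = P s" "P s * P s = P s" "P s * h s = h s * P s"
  using riesz_projection(1-4)[OF gapped_h[OF assms]] by (simp_all add: P_def)

text \<open>Conjugation sends \<open>h s\<close> to \<open>- h s\<close>, so this is the projection
  near -1. Defining it as a conjugate instead of by a second contour makes the reality of
  \<open>K\<close> immediate.\<close>

definition M :: "real \<Rightarrow> fmat" where "M s = cnjm (P s)"
definition M' :: "real \<Rightarrow> fmat" where "M' s = cnjm (P' s)"

lemma M_proj:
  assumes "s \<in> {0..1}"
  shows "corner n (M s)" "adj (M s) = M s" "M s * M s = M s" "M s * h s = h s * M s"
proof -
  show "corner n (M s)" "adj (M s) = M s" "M s * M s = M s"
    using P_proj[OF assms] by (simp_all add: M_def cnjm_adj[symmetric] cnjm_mult[symmetric])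
  have "cnjm (P s * h s) = cnjm (h s * P s)" using P_proj[OF assms] by simp
  then show "M s * h s = h s * M s" by (simp add: M_def cnjm_mult h)
qed

text \<open>Both \<open>X = P s * M s\<close> and its conjugate are fixed by \<open>P s\<close>,
  where the form of \<open>h s\<close> is positive; but conjugation reverses the sign of the form.
  Hence \<open>X\<close> vanishes.\<close>

lemma P_M: assumes "s \<in> {0..1}" shows "P s * M s = 0" "M s * P s = 0"
proof -
  note g = gapped_h[OF assms]
  have comm: "M s * P s = P s * M s"
    unfolding P_def using M_proj[OF assms] by (intro riesz_commute[OF g]) auto
  define X where "X = P s * M s"
  have cX: "corner n X" using P_proj[OF assms] M_proj[OF assms] by (simp add: X_def)
  have PX: "P s * X = X" using P_proj[OF assms] by (simp add: X_def mult.assoc[symmetric])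
  have MX: "M s * X = X"
    unfolding X_def comm[symmetric] using M_proj[OF assms] by (simp add: mult.assoc[symmetric])
  have pos: "(1/2 + (1/2 - s * \<epsilon>)) * (norm X)\<^sup>2 \<le> inner X (h s * X)"
    using riesz_projection(5)[OF g cX] PX by (simp add: P_def)
  have "P s * cnjm X = cnjm X" using arg_cong[OF MX, of cnjm] by (simp add: M_def cnjm_mult)
  then have "(1/2 + (1/2 - s * \<epsilon>)) * (norm (cnjm X))\<^sup>2 \<le> inner (cnjm X) (h s * cnjm X)"
    using riesz_projection(5)[OF g, of "cnjm X"] cX by (simp add: P_def)
  moreover have "inner (cnjm X) (h s * cnjm X) = - inner X (h s * X)"
  proof -
    have "h s * cnjm X = cnjm (- (h s * X))" by (simp add: cnjm_mult cnjm_uminus h)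
    moreover have "inner (cnjm X) (cnjm Y) = inner X Y" for Y
      unfolding inner_fmat_left[OF cX] inner_fmat_left[OF corner_cnjm[OF cX]] by simp
    ultimately show ?thesis by simp
  qed
  ultimately have "(1/2 + (1/2 - s * \<epsilon>)) * (norm X)\<^sup>2 \<le> 0" using pos by simp
  moreover have "s * \<epsilon> \<le> \<epsilon>" using assms eps by (auto simp: mult_left_le_one_le)
  ultimately have "norm X = 0" using eps by (simp add: mult_le_0_iff)
  then show "P s * M s = 0" "M s * P s = 0" using comm by (simp_all add: X_def)
qed

lemma M_deriv: "s \<in> {0..1} \<Longrightarrow> (M has_vector_derivative M' s) (at s within {0..1})"
  unfolding M_def[abs_def] M'_def
  by (rule bounded_linear.has_vector_derivative[OF bounded_linear_cnjm P_deriv])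

lemma P'_corner [simp]: "s \<in> {0..1} \<Longrightarrow> corner n (P' s)"
  by (rule corner_has_integral[OF P'_int]) (auto simp: v)

lemma bounded_linear_adj: "bounded_linear adj"
  by (rule bounded_linear_intro[where K = 1]) (auto simp: adj_add adj_scaleR)

text \<open>Each identity is the derivative of one for the projections: self-adjointness,
  idempotence, \<open>P s * M s = 0\<close>, and commutation with \<open>h s\<close>.\<close>

lemma P'_rel:
  assumes "s \<in> {0..1}"
  shows "adj (P' s) = P' s" "P' s * P s + P s * P' s = P' s"
    "P' s * M s + P s * M' s = 0" "v * P s + h s * P' s = P' s * h s + P s * v"
proof -
  note d = P_deriv[OF assms] and m = M_deriv[OF assms]
  note tr = has_vector_derivative_transform[OF assms]
  have "((\<lambda>s. adj (P s)) has_vector_derivative adj (P' s)) (at s within {0..1})"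
    by (rule bounded_linear.has_vector_derivative[OF bounded_linear_adj d])
  then have "(P has_vector_derivative adj (P' s)) (at s within {0..1})"
    by (rule tr[rotated]) (simp add: P_proj)
  then show "adj (P' s) = P' s" using d by (rule vector_derivative_unique_Icc[OF assms])
  have "((\<lambda>s. P s * P s) has_vector_derivative (P s * P' s + P' s * P s)) (at s within {0..1})"
    by (rule has_vector_derivative_mult[OF d d])
  then have "(P has_vector_derivative (P s * P' s + P' s * P s)) (at s within {0..1})"
    by (rule tr[rotated]) (simp add: P_proj)
  then have "P s * P' s + P' s * P s = P' s" using d by (rule vector_derivative_unique_Icc[OF assms])
  then show "P' s * P s + P s * P' s = P' s" by (simp add: add.commute)
  have "((\<lambda>s. P s * M s) has_vector_derivative (P s * M' s + P' s * M s)) (at s within {0..1})"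
    by (rule has_vector_derivative_mult[OF d m])
  then have "((\<lambda>s. 0) has_vector_derivative (P s * M' s + P' s * M s)) (at s within {0..1})"
    by (rule tr[rotated]) (simp add: P_M)
  then have "P s * M' s + P' s * M s = 0"
    by (rule vector_derivative_unique_Icc[OF assms _ has_vector_derivative_const])
  then show "P' s * M s + P s * M' s = 0" by (simp add: add.commute)
  have hd: "(h has_vector_derivative v) (at s within {0..1})"
    unfolding h_def[abs_def] by (auto intro!: derivative_eq_intros)
  have a: "((\<lambda>s. h s * P s) has_vector_derivative (h s * P' s + v * P s)) (at s within {0..1})"
    by (rule has_vector_derivative_mult[OF hd d])
  have "((\<lambda>s. P s * h s) has_vector_derivative (P s * v + P' s * h s)) (at s within {0..1})"
    by (rule has_vector_derivative_mult[OF d hd])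
  then have "((\<lambda>s. h s * P s) has_vector_derivative (P s * v + P' s * h s)) (at s within {0..1})"
    by (rule tr[rotated]) (simp add: P_proj)
  then have "h s * P' s + v * P s = P s * v + P' s * h s" using a vector_derivative_unique_Icc[OF assms] by blast
  then show "v * P s + h s * P' s = P' s * h s + P s * v" by (simp add: add.commute)
qed

text \<open>Testing the derived commutation relation on an eigenvector of \<open>P' s\<close>, whose two components
  in the ranges of \<open>P s\<close> and its complement have equal length, bounds the eigenvalue by the gap.\<close>

lemma P'_opb: assumes "s \<in> {0..1}" shows "opnorm_le (P' s) (\<epsilon> / (1 - 2 * s * \<epsilon>))"
proof (rule opnorm_le_spec)
  have se: "s * \<epsilon> \<le> \<epsilon>" using assms eps by (auto simp: mult_left_le_one_le)
  then have g: "0 < 1 - 2 * s * \<epsilon>" using eps by simp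
  then show "0 \<le> \<epsilon> / (1 - 2 * s * \<epsilon>)" using eps by simp
  show "corner n (P' s)" "adj (P' s) = P' s" using assms P'_rel by auto
  fix \<mu> assume "\<mu> \<in> spec n (P' s)"
  then obtain x where x: "corner n x" "x \<noteq> 0" "P' s * x = complex_of_real \<mu> *\<^sub>C x" unfolding spec_def by blast
  have x3: "P' s * x = \<mu> *\<^sub>R x" using x(3) by (simp add: scC_of_real)
  note Pr = P_proj[OF assms] and Pd = P'_rel[OF assms]
  define a b where "a = P s * x" and "b = x - a"
  have ab: "corner n a" "corner n b" using x Pr by (simp_all add: a_def b_def)
  have Pa: "P s * a = a" using Pr by (simp add: a_def mult.assoc[symmetric])
  have Pb: "P s * b = 0" using Pa by (simp add: b_def right_diff_distrib a_def)
  \<comment> \<open>\<open>P'\<close> is off-diagonal with respect to \<open>P\<close>, so it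
    exchanges the two components of its eigenvector: \<open>P' a = \<mu> b\<close> and
    \<open>P' b = \<mu> a\<close>.\<close>
  have "P s * (P' s * P s + P s * P' s) * P s = P s * P' s * P s" using Pd by simp
  moreover have "P s * (P' s * P s + P s * P' s) * P s = P s * P' s * (P s * P s) + (P s * P s) * P' s * P s"
    by (simp add: algebra_simps)
  ultimately have PPP: "P s * P' s * P s = 0" using Pr by simp
  have P'b: "P' s * b = \<mu> *\<^sub>R a"
  proof -
    have "P' s * b = (P' s * P s + P s * P' s) * b" using Pd by simp
    also have "\<dots> = P s * (P' s * b)" by (simp add: distrib_right mult.assoc Pb)
    also have "\<dots> = P s * (P' s * x) - P s * P' s * P s * x" by (simp add: b_def a_def algebra_simps)
    also have "\<dots> = \<mu> *\<^sub>R a" by (simp add: PPP x3 a_def)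
    finally show ?thesis .
  qed
  have P'a: "P' s * a = \<mu> *\<^sub>R b"
  proof -
    have "P' s * a = P' s * x - P' s * b" by (simp add: b_def algebra_simps)
    then have "P' s * a = \<mu> *\<^sub>R x - \<mu> *\<^sub>R a" by (simp only: P'b x3)
    then show ?thesis by (simp only: b_def scaleR_right_diff_distrib)
  qed
  show "\<bar>\<mu>\<bar> \<le> \<epsilon> / (1 - 2 * s * \<epsilon>)"
  proof (cases "\<mu> = 0")
    case True then show ?thesis using g eps by simp
  next
    case False
    have "inner (P' s * b) a = inner b (P' s * a)" by (simp add: inner_adj Pd)
    then have "inner a a = inner b b" using False by (simp add: P'a P'b)
    then have nab: "norm a = norm b" by (simp add: norm_eq_sqrt_inner)
    have "a \<noteq> 0" using nab x(2) by (auto simp: b_def)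
    have "(v * P s + h s * P' s) * a = (P' s * h s + P s * v) * a" using Pd by simp
    then have "v * a + \<mu> *\<^sub>R (h s * b) = P' s * (h s * a) + P s * (v * a)"
      by (simp add: distrib_right mult.assoc Pa P'a)
    then have "inner b (v * a + \<mu> *\<^sub>R (h s * b)) = inner b (P' s * (h s * a) + P s * (v * a))" by simp
    moreover have "inner b (P' s * (h s * a)) = \<mu> * inner a (h s * a)"
      using inner_adj[of "P' s" b "h s * a"] by (simp add: Pd P'b)
    moreover have "inner b (P s * (v * a)) = 0"
      using inner_adj[of "P s" b "v * a"] by (simp add: Pr Pb)
    ultimately have eq: "inner b (v * a) = \<mu> * (inner a (h s * a) - inner b (h s * b))"
      by (simp add: inner_add_right algebra_simps)
    \<comment> \<open>The form is at least \<open>1 - s * \<epsilon>\<close> on the range of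
      \<open>P s\<close> and at most \<open>s * \<epsilon>\<close> on its complement; the difference
      becomes the denominator of the bound.\<close>
    have "(1/2 + (1/2 - s * \<epsilon>)) * (norm a)\<^sup>2 \<le> inner a (h s * a)"
      using riesz_projection(5)[OF gapped_h[OF assms] ab(1)] Pa by (simp add: P_def)
    moreover have "inner b (h s * b) \<le> (1/2 - (1/2 - s * \<epsilon>)) * (norm b)\<^sup>2"
      using riesz_projection(6)[OF gapped_h[OF assms] ab(2)] Pb by (simp add: P_def)
    ultimately have "(1 - 2 * s * \<epsilon>) * (norm a)\<^sup>2 \<le> inner a (h s * a) - inner b (h s * b)"
      unfolding nab by (simp add: algebra_simps)
    then have "\<bar>\<mu>\<bar> * ((1 - 2 * s * \<epsilon>) * (norm a)\<^sup>2) \<le> \<bar>\<mu>\<bar> * \<bar>inner a (h s * a) - inner b (h s * b)\<bar>"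
      by (intro mult_left_mono) auto
    also have "\<dots> = \<bar>inner b (v * a)\<bar>" by (simp add: eq abs_mult)
    also have "\<dots> \<le> norm b * norm (v * a)" by (rule Cauchy_Schwarz_ineq2)
    also have "\<dots> \<le> norm b * (\<epsilon> * norm a)" by (intro mult_left_mono opbD[OF v(4)]) simp
    also have "\<dots> = \<epsilon> * (norm a)\<^sup>2" by (simp add: nab power2_eq_square)
    finally have "\<bar>\<mu>\<bar> * (1 - 2 * s * \<epsilon>) * (norm a)\<^sup>2 \<le> \<epsilon> * (norm a)\<^sup>2" by (simp add: mult.assoc)
    then have "\<bar>\<mu>\<bar> * (1 - 2 * s * \<epsilon>) \<le> \<epsilon>" using \<open>a \<noteq> 0\<close> by (simp add: mult_le_cancel_right)
    then show ?thesis using g by (simp add: field_simps)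
  qed
qed

text \<open>With \<open>Z = idmat n - P s - M s\<close> \<open>K s\<close> is \<open>P' P + M' M + Z' Z\<close>, Kato's generator for the three
  spectral projections.\<close>

definition G :: "real \<Rightarrow> fmat" where "G s = 2 *\<^sub>R P s + M s - idmat n"
definition K :: "real \<Rightarrow> fmat" where "K s = P' s * G s + M' s * cnjm (G s)"

lemma cnjm_G: "cnjm (G s) = 2 *\<^sub>R M s + P s - idmat n"
  by (simp add: G_def M_def cnjm_add cnjm_diff cnjm_scaleR)

lemma cnjm_K: "cnjm (K s) = K s"
  by (simp add: K_def M'_def cnjm_add cnjm_mult add.commute)

lemma corner_K: "s \<in> {0..1} \<Longrightarrow> corner n (K s)"
  by (simp add: K_def G_def M'_def P_proj M_proj corner_cnjm)

lemma M'_rel: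
  assumes "s \<in> {0..1}"
  shows "adj (M' s) = M' s" "M' s * M s + M s * M' s = M' s" "M' s * P s + M s * P' s = 0"
proof -
  show "adj (M' s) = M' s" unfolding M'_def cnjm_adj[symmetric] P'_rel(1)[OF assms] ..
  have "cnjm (P' s * P s + P s * P' s) = cnjm (P' s)" by (simp only: P'_rel(2)[OF assms])
  then show "M' s * M s + M s * M' s = M' s" unfolding M'_def M_def cnjm_add cnjm_mult .
  have "cnjm (P' s * M s + P s * M' s) = cnjm 0" by (simp only: P'_rel(3)[OF assms])
  then show "M' s * P s + M s * P' s = 0" unfolding M'_def M_def cnjm_add cnjm_mult cnjm_cnjm cnjm_0 .
qed

text \<open>\<open>K P = P' P\<close> and \<open>P K = - P P'\<close>, and the product rule for
  \<open>P = P P\<close> combines them to \<open>P'\<close>. A flow generated by \<open>K\<close>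
  therefore carries the projections along.\<close>

lemma K_commutator: assumes "s \<in> {0..1}" shows "K s * P s - P s * K s = P' s"
proof -
  note Pr = P_proj[OF assms] M_proj[OF assms] P_M[OF assms] and r = P'_rel[OF assms]
  have c: "corner n (P' s)" "corner n (M' s)" using assms by (simp_all add: M'_def)
  have GP: "G s * P s = P s" "cnjm (G s) * P s = 0"
    unfolding cnjm_G unfolding G_def using Pr by (simp_all add: distrib_right left_diff_distrib scaleR_2)
  have KP: "K s * P s = P' s * P s" by (simp add: K_def distrib_right mult.assoc GP)
  have PPM: "P s * P' s * M s = P' s * M s"
  proof -
    have "P' s * M s = (P' s * P s + P s * P' s) * M s" using r by simp
    also have "\<dots> = P' s * (P s * M s) + P s * P' s * M s" by (simp only: distrib_right mult.assoc)
    finally show ?thesis using Pr by simp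
  qed
  have "P s * P' s * P s = P s * (P' s * P s + P s * P' s) * P s" using r by simp
  also have "\<dots> = P s * P' s * (P s * P s) + (P s * P s) * P' s * P s" by (simp add: algebra_simps)
  finally have PPP: "P s * P' s * P s = 0" using Pr by simp
  have PM': "P s * M' s = - (P' s * M s)" using r(3) by (simp add: eq_neg_iff_add_eq_0 add.commute)
  have MG: "M s * cnjm (G s) = M s"
    using Pr by (simp add: cnjm_G distrib_left right_diff_distrib scaleR_2)
  have "P s * K s = P s * P' s * G s + P s * M' s * cnjm (G s)" by (simp add: K_def distrib_left mult.assoc)
  also have "P s * P' s * G s = P' s * M s - P s * P' s"
    using c Pr by (simp add: G_def distrib_left right_diff_distrib PPP PPM)
  also have "P s * M' s * cnjm (G s) = - (P' s * M s)" unfolding PM' by (simp add: mult.assoc MG)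
  finally have "P s * K s = - (P s * P' s)" by simp
  then show ?thesis using KP r(2) by simp
qed

text \<open>\<open>K s + adj (K s)\<close> is the derivative of the sum of the squares of the three
  projections, which is constantly \<open>idmat n\<close>. Together with \<open>cnjm_K\<close> this
  makes \<open>K s\<close> real antisymmetric.\<close>

lemma adj_K: assumes "s \<in> {0..1}" shows "adj (K s) = - K s"
proof -
  note Pr = P_proj[OF assms] M_proj[OF assms] P_M[OF assms] and r = P'_rel[OF assms] M'_rel[OF assms]
  have c: "corner n (P' s)" "corner n (M' s)" using assms by (simp_all add: M'_def)
  have aG: "adj (G s) = G s" "adj (cnjm (G s)) = cnjm (G s)"
    unfolding cnjm_G unfolding G_def using Pr by (simp_all add: adj_add adj_diff adj_scaleR)
  have "K s + adj (K s) = 2 *\<^sub>R (P' s * P s + P s * P' s) + (P' s * M s + P s * M' s) + (M' s * P s + M s * P' s)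
      + 2 *\<^sub>R (M' s * M s + M s * M' s) - 2 *\<^sub>R P' s - 2 *\<^sub>R M' s"
  proof -
    have "adj (K s) = G s * P' s + cnjm (G s) * M' s" by (simp add: K_def adj_add adj_mult aG r)
    then show ?thesis using c by (simp add: K_def cnjm_G) (simp add: G_def algebra_simps scaleR_2)
  qed
  also have "\<dots> = 0" unfolding r by simp
  finally show ?thesis by (simp add: eq_neg_iff_add_eq_0 add.commute)
qed

text \<open>\<open>G s\<close> is \<open>P s - Z\<close>: it acts as 1 near eigenvalue 1, as -1 near
  0 and as 0 near -1. Written with \<open>G\<close> and its conjugate, \<open>K\<close> has only two
  terms, each bounded by \<open>\<epsilon> / (1 - 2 * \<epsilon>)\<close>.\<close>

lemma G_opnorm_le: assumes "s \<in> {0..1}" shows "opnorm_le (G s) 1"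
proof (rule opnorm_le_partial_reflection)
  note Pr = P_proj[OF assms] M_proj[OF assms] P_M[OF assms]
  show "adj (G s) = G s" "adj (idmat n - M s) = idmat n - M s"
    using Pr by (simp_all add: G_def adj_add adj_diff adj_scaleR)
  show "G s * G s = idmat n - M s"
    using Pr by (simp add: G_def algebra_simps scaleR_2)
  show "(idmat n - M s) * (idmat n - M s) = idmat n - M s"
    using Pr by (simp add: algebra_simps)
qed

lemma K_opnorm_le: assumes "s \<in> {0..1}" shows "opnorm_le (K s) (2 * \<epsilon> / (1 - 2 * \<epsilon>))"
proof -
  have se: "s * \<epsilon> \<le> \<epsilon>" using assms eps by (auto simp: mult_left_le_one_le)
  then have le: "\<epsilon> / (1 - 2 * s * \<epsilon>) \<le> \<epsilon> / (1 - 2 * \<epsilon>)" and nn: "0 \<le> \<epsilon> / (1 - 2 * \<epsilon>)"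
    using eps by (auto intro!: divide_left_mono mult_pos_pos)
  have 1: "opnorm_le (P' s) (\<epsilon> / (1 - 2 * \<epsilon>))" by (rule opnorm_le_mono[OF P'_opb[OF assms] le])
  then have 2: "opnorm_le (M' s) (\<epsilon> / (1 - 2 * \<epsilon>))" unfolding M'_def by (rule opnorm_le_cnjm)
  have "opnorm_le (K s) (\<epsilon> / (1 - 2 * \<epsilon>) * 1 + \<epsilon> / (1 - 2 * \<epsilon>) * 1)"
    unfolding K_def by (intro opnorm_le_add opnorm_le_mult 1 2 G_opnorm_le opnorm_le_cnjm assms nn)
  then show ?thesis by simp
qed

lemma K_continuous: "continuous_on {0..1} K"
proof -
  have M: "continuous_on {0..1} M" unfolding M_def[abs_def]
    using continuous_on_compose2[OF linear_continuous_on[OF bounded_linear_cnjm] P_continuous] by auto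
  have M': "continuous_on {0..1} M'" unfolding M'_def[abs_def]
    using continuous_on_compose2[OF linear_continuous_on[OF bounded_linear_cnjm] P'_continuous] by auto
  show ?thesis
    unfolding K_def[abs_def] cnjm_G unfolding G_def
    by (intro continuous_intros P_continuous P'_continuous M M')
qed

end

section \<open>Decay of the generator\<close>

definition band :: "nat \<Rightarrow> fmat \<Rightarrow> bool" where
  "band L A \<longleftrightarrow> (\<forall>i j. i + L < j \<or> j + L < i \<longrightarrow> ent A i j = 0)"

lemma band_0 [simp]: "band L 0" by (simp add: band_def)
lemma band_idmat [simp]: "band L (idmat n)" by (auto simp: band_def)
lemma band_add: "band L A \<Longrightarrow> band L B \<Longrightarrow> band L (A + B)" by (simp add: band_def)
lemma band_scC: "band L A \<Longrightarrow> band L (c *\<^sub>C A)" by (simp add: band_def)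
lemma band_scaleR: "band L A \<Longrightarrow> band L (c *\<^sub>R A)" by (simp add: band_def)
lemma band_cnjm: "band L A \<Longrightarrow> band L (cnjm A)" by (simp add: band_def)
lemma band_mono: "band L A \<Longrightarrow> L \<le> L' \<Longrightarrow> band L' A" by (auto simp: band_def)

lemma band_mult:
  assumes "band L A" "band L' B" shows "band (L + L') (A * B)"
  unfolding band_def
proof (intro allI impI)
  fix i j assume ij: "i + (L + L') < j \<or> j + (L + L') < i"
  obtain n where n: "corner n A" using corner_ex by blast
  have "ent A i k * ent B k j = 0" for k
  proof -
    have "i + L < k \<or> k + L < i \<or> k + L' < j \<or> j + L' < k" using ij by linarith
    then show ?thesis using assms unfolding band_def by auto
  qed
  then show "ent (A * B) i j = 0" unfolding ent_mult_left[OF n] by (simp add: sum.neutral)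
qed

lemma band_has_integral:
  assumes "(F has_integral I) S" "\<And>t. t \<in> S \<Longrightarrow> band L (F t)" shows "band L I"
  unfolding band_def
proof (intro allI impI)
  fix i j assume ij: "i + L < j \<or> j + L < i"
  have "((\<lambda>t. ent (F t) i j) has_integral ent I i j) S"
    by (rule has_integral_lin[OF assms(1) bounded_linear_ent])
  then have "((\<lambda>t. 0) has_integral ent I i j) S"
    by (rule has_integral_eq[rotated]) (use assms(2) ij in \<open>auto simp: band_def\<close>)
  then show "ent I i j = 0" using has_integral_unique[OF has_integral_0] by metis
qed

definition near_band :: "nat \<Rightarrow> real \<Rightarrow> fmat \<Rightarrow> bool" where
  "near_band L \<delta> A \<longleftrightarrow> (\<exists>T. band L T \<and> opnorm_le (A - T) \<delta>)"

lemma apxI: "band L T \<Longrightarrow> opnorm_le (A - T) \<delta> \<Longrightarrow> near_band L \<delta> A"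
  unfolding near_band_def by blast

lemma apxE: assumes "near_band L \<delta> A" obtains T where "band L T" "opnorm_le (A - T) \<delta>"
  using assms unfolding near_band_def by blast

lemma near_band_add: assumes "near_band L a A" "near_band L b B" shows "near_band L (a + b) (A + B)"
proof -
  obtain S T where "band L S" "opnorm_le (A - S) a" "band L T" "opnorm_le (B - T) b" using assms by (auto elim!: apxE)
  then show ?thesis
    using band_add[of L S T] opnorm_le_add[of "A - S" a "B - T" b] by (intro apxI[of L "S + T"]) (auto simp: algebra_simps)
qed

lemma near_band_scaleR: assumes "near_band L a A" shows "near_band L (\<bar>c\<bar> * a) (c *\<^sub>R A)"
proof -
  obtain T where "band L T" "opnorm_le (A - T) a" using assms by (auto elim!: apxE)
  then show ?thesis
    using opnorm_le_scaleR[of "A - T" a c] by (intro apxI[of L "c *\<^sub>R T"]) (auto simp: band_scaleR scaleR_right_diff_distrib)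
qed

lemma near_band_cnjm: assumes "near_band L a A" shows "near_band L a (cnjm A)"
proof -
  obtain T where "band L T" "opnorm_le (A - T) a" using assms by (auto elim!: apxE)
  then show ?thesis
    using opnorm_le_cnjm[of "A - T" a] by (intro apxI[of L "cnjm T"]) (auto simp: band_cnjm cnjm_diff)
qed

lemma near_band_band: "band L A \<Longrightarrow> near_band L 0 A"
  by (rule apxI[of L A]) simp_all

text \<open>With band approximants \<open>S\<close> and \<open>T\<close>, write
  \<open>A * B = S * T + S * (B - T) + (A - S) * B\<close>. Bandwidths add, so the first term
  vanishes this far from the diagonal, and the norms of the others bound the entry.\<close>

lemma near_band_mult_ent:
  assumes "near_band L \<delta> A" "near_band L' \<delta>' B" "opnorm_le A a" "opnorm_le B b" "0 \<le> \<delta>" "0 \<le> a" "i + (L + L') < j \<or> j + (L + L') < i"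
  shows "cmod (ent (A * B) i j) \<le> (a + \<delta>) * \<delta>' + \<delta> * b"
proof -
  obtain S T where S: "band L S" "opnorm_le (A - S) \<delta>" and T: "band L' T" "opnorm_le (B - T) \<delta>'"
    using assms(1,2) unfolding near_band_def by blast
  have "ent (S * T) i j = 0" using band_mult[OF S(1) T(1)] assms(7) unfolding band_def by blast
  moreover have "A * B = S * T + (S * (B - T) + (A - S) * B)" by (simp add: algebra_simps)
  ultimately have "ent (A * B) i j = ent (S * (B - T) + (A - S) * B) i j" by (simp del: ent_add) simp
  moreover have "opnorm_le S (a + \<delta>)" using opnorm_le_diff[OF assms(3) S(2)] by simp
  then have "opnorm_le (S * (B - T) + (A - S) * B) ((a + \<delta>) * \<delta>' + \<delta> * b)"
    using assms(4-6) S T by (intro opnorm_le_add opnorm_le_mult) auto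
  ultimately show ?thesis using opnorm_le_ent by metis
qed

section \<open>Neumann expansion of the resolvent and decay of \<open>K\<close>\<close>

locale local_perturbation = perturbation +
  fixes r :: nat
  assumes band_h0: "band 1 h0" "band 1 (h0 * h0)" and band_v: "band r v" and r: "1 \<le> r" and eps4: "\<epsilon> < 1/4"
begin

text \<open>Since \<open>h0\<close> cubed is \<open>h0\<close>, its resolvent is a quadratic
  polynomial in \<open>h0\<close>, hence exactly of bandwidth 1.\<close>

lemma R0_band: "band 1 (R 0 t)"
proof -
  define z where "z = 1 + contour_pt t"
  have z: "z \<noteq> 0" "z * z - 1 \<noteq> 0"
  proof -
    show "z \<noteq> 0"
    proof
      assume "z = 0" then have "contour_pt t = - 1" by (simp add: z_def add_eq_0_iff)
      then show False using norm_contour_pt[of t] by simp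
    qed
    show "z * z - 1 \<noteq> 0"
    proof
      assume "z * z - 1 = 0"
      then have "contour_pt t * (contour_pt t + 2) = 0" by (simp add: z_def algebra_simps)
      then have "contour_pt t = 0 \<or> contour_pt t = - 2" by (simp add: add_eq_0_iff2)
      then have "cmod (contour_pt t) = cmod 0 \<or> cmod (contour_pt t) = cmod (- 2)" by metis
      then show False by simp
    qed
  qed
  \<comment> \<open>Determined by the values \<open>1 / z\<close>, \<open>1 / (z - 1)\<close> and
    \<open>1 / (z + 1)\<close> at the eigenvalues 0, 1 and -1.\<close>
  define a b c where "a = 1 / z" and "b = 1 / (z * z - 1)" and "c = 1 / (z * (z * z - 1))"
  define X where "X = a *\<^sub>C idmat n + b *\<^sub>C h0 + c *\<^sub>C (h0 * h0)"
  have k: "z * a = 1" "z * b = a + c" "z * c = b"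
    using z by (simp_all add: a_def b_def c_def field_simps)
  have h03: "h0 * (h0 * h0) = h0" using h0(3) by (simp add: mult.assoc)
  have "(z *\<^sub>C idmat n - h0) * X = (z * a) *\<^sub>C idmat n + (z * b) *\<^sub>C h0 + (z * c) *\<^sub>C (h0 * h0)
      - (a *\<^sub>C h0 + b *\<^sub>C (h0 * h0) + c *\<^sub>C h0)"
    using h0(1) by (simp add: X_def left_diff_distrib distrib_left scC_add_right scC_diff_right h03)
      (simp add: algebra_simps)
  moreover have "X * (z *\<^sub>C idmat n - h0) = (z * a) *\<^sub>C idmat n + (z * b) *\<^sub>C h0 + (z * c) *\<^sub>C (h0 * h0)
      - (a *\<^sub>C h0 + b *\<^sub>C (h0 * h0) + c *\<^sub>C h0)"
    using h0(1) by (simp add: X_def right_diff_distrib distrib_right scC_add_right scC_diff_right h0(3) mult.commute)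
  ultimately have "is_res n h0 z X"
    unfolding is_res_def using h0(1) by (simp add: k scC_add_left) (simp add: X_def)
  then have "R 0 t = X" unfolding R_def contour_res_def h_def by (simp add: z_def res_eqI)
  then show ?thesis unfolding X_def by (simp only: band_add band_scC band_h0 band_idmat)
qed

lemma R0_opnorm_le: "opnorm_le (R 0 t) 2"
  using contour_res(2)[OF gapped_h[of 0], of t] by (simp add: R_def)

primrec F :: "real \<Rightarrow> nat \<Rightarrow> real \<Rightarrow> fmat" where
  "F s 0 t = R 0 t" | "F s (Suc m) t = F s m t * (s *\<^sub>R (v * R 0 t))"
primrec E :: "real \<Rightarrow> nat \<Rightarrow> real \<Rightarrow> fmat" where
  "E s 0 t = R s t" | "E s (Suc m) t = E s m t * (s *\<^sub>R (v * R 0 t))"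
definition T :: "real \<Rightarrow> nat \<Rightarrow> real \<Rightarrow> fmat" where "T s m t = (\<Sum>k<m. F s k t)"

text \<open>\<open>R s = R 0 + R s (s v) R 0\<close>, iterated \<open>m\<close> times.
  \<open>F s k\<close> is the term \<open>R 0 (s v R 0)^k\<close>; the remainder
  \<open>E s m\<close> is \<open>R s (s v R 0)^m\<close> with the full resolvent, so the finite
  expansion is exact.\<close>

lemma neumann: assumes "s \<in> {0..1}" shows "R s t = T s m t + E s m t"
proof -
  have step: "E s m t = F s m t + E s (Suc m) t" for m
  proof (induction m)
    case 0 show ?case using R_diff[of 0 s t] assms by (simp add: algebra_simps)
  next
    case (Suc m)
    then have "E s m t * (s *\<^sub>R (v * R 0 t)) = (F s m t + E s (Suc m) t) * (s *\<^sub>R (v * R 0 t))" by simp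
    then show ?case unfolding E.simps F.simps distrib_right .
  qed
  show ?thesis
  proof (induction m)
    case (Suc m)
    have "T s (Suc m) t = T s m t + F s m t" by (simp add: T_def)
    then show ?case using Suc step[of m] by (simp only: add.assoc)
  qed (simp add: T_def)
qed

text \<open>The term \<open>F s k\<close> contains \<open>k + 1\<close> resolvents of bandwidth 1
  and \<open>k\<close> copies of \<open>v\<close>, and only \<open>k < m\<close> occur.\<close>

lemma T_band: "band (m * (r + 1)) (T s m t)"
proof -
  have F: "band (1 + k * (r + 1)) (F s k t)" for k
  proof (induction k)
    case (Suc k)
    have "band (1 + k * (r + 1) + (r + 1)) (F s k t * (s *\<^sub>R (v * R 0 t)))"
      by (intro band_mult Suc band_scaleR band_v R0_band)
    then show ?case by (simp add: algebra_simps)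
  qed (simp add: R0_band[simplified])
  show ?thesis
  proof (induction m)
    case (Suc m)
    have "1 + m * (r + 1) \<le> Suc m * (r + 1)" by simp
    then show ?case
      using band_add[OF band_mono[OF Suc] band_mono[OF F[of m]], of "Suc m * (r + 1)"] by (simp add: T_def)
  qed (simp add: T_def)
qed

lemma R_opb4: "s \<in> {0..1} \<Longrightarrow> opnorm_le (R s t) 4"
proof (rule opnorm_le_mono[OF R_opnorm_le])
  have "1 / (1/2 - \<epsilon>) \<le> 1 / (1/4)" using eps4 eps by (intro divide_left_mono) auto
  then show "1 / (1/2 - \<epsilon>) \<le> 4" by simp
qed

text \<open>Each factor \<open>s v R 0\<close> has norm at most \<open>2 * \<epsilon>\<close>, since
  \<open>R 0\<close> is bounded by 2; for \<open>\<epsilon> < 1/4\<close> this is below 1/2, which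
  fixes the rate of decay.\<close>

lemma E_opnorm_le: assumes "s \<in> {0..1}" shows "opnorm_le (E s m t) (4 * (1/2) ^ m)"
proof (induction m)
  case 0 then show ?case using R_opb4[OF assms] by simp
next
  case (Suc m)
  have "opnorm_le (s *\<^sub>R (v * R 0 t)) (\<bar>s\<bar> * (\<epsilon> * 2))" by (intro opnorm_le_scaleR opnorm_le_mult v R0_opnorm_le eps)
  moreover have "\<bar>s\<bar> * (\<epsilon> * 2) \<le> 1/2" using assms eps eps4 mult_mono[of "\<bar>s\<bar>" 1 "\<epsilon> * 2" "1/2"] by simp
  ultimately have "opnorm_le (s *\<^sub>R (v * R 0 t)) (1/2)" by (rule opnorm_le_mono)
  from opnorm_le_mult[OF Suc this] show ?case by simp
qed

lemma continuous_T: "continuous_on S (T s m)"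
proof -
  have "continuous_on S (F s k)" for k
  proof (induction k)
    case 0 have "F s 0 = R 0" by (rule ext) simp
    then show ?case using continuous_R[of 0 S] by simp
  next
    case (Suc k)
    have "F s (Suc k) = (\<lambda>t. F s k t * (s *\<^sub>R (v * R 0 t)))" by (rule ext) simp
    then show ?case using Suc continuous_R[of 0 S] by (auto intro!: continuous_intros)
  qed
  then show ?thesis unfolding T_def[abs_def] by (intro continuous_on_sum)
qed

lemma corner_T: "corner n (T s m t)"
proof -
  have "corner n (F s k t)" for k by (induction k) (auto simp: v)
  then show ?thesis unfolding T_def by auto
qed

lemma T_opnorm_le: assumes "s \<in> {0..1}" shows "opnorm_le (T s m t) 8"
proof -
  have "T s m t = R s t - E s m t" using neumann[OF assms] by (simp add: algebra_simps)
  moreover have "opnorm_le (R s t - E s m t) (4 + 4 * (1/2) ^ m)" by (intro opnorm_le_diff R_opb4 E_opnorm_le assms)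
  moreover have "4 + 4 * (1/2) ^ m \<le> (8::real)" using power_le_one[of "1/2::real" m] by simp
  ultimately show ?thesis using opnorm_le_mono by metis
qed

text \<open>Integrating the approximants keeps them banded. The error is halved because
  \<open>contour_pt\<close> has modulus 1/2.\<close>

lemma near_band_contour:
  assumes I: "((\<lambda>t. contour_pt t *\<^sub>C A t) has_integral I) {0..1}"
    and T: "continuous_on {0..1} X" "\<And>t. corner n (X t)" "\<And>t. band L (X t)" "\<And>t. opnorm_le (A t - X t) \<delta>" "0 \<le> \<delta>"
  shows "near_band L (\<delta> / 2) I"
proof -
  have J: "((\<lambda>t. contour_pt t *\<^sub>C X t) has_integral integral {0..1} (\<lambda>t. contour_pt t *\<^sub>C X t)) {0..1}" (is "(_ has_integral ?J) _")
    by (intro integrable_integral continuous_corner_integrable[of _ _ _ n] continuous_scC continuous_contour_pt T corner_scC)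
  have "band L ?J" by (rule band_has_integral[OF J]) (intro band_scC T)
  moreover have "opnorm_le (I - ?J) (\<delta> / 2)"
  proof (rule opnorm_le_has_integral[OF has_integral_diff[OF I J]])
    fix t show "opnorm_le (contour_pt t *\<^sub>C A t - contour_pt t *\<^sub>C X t) (\<delta> / 2)"
      using opnorm_le_scC[OF T(4), of "contour_pt t" t] by (simp add: scC_diff_right)
  qed (use T in simp)
  ultimately show ?thesis unfolding near_band_def by blast
qed

lemma P_near_band: assumes "s \<in> {0..1}" shows "near_band (m * (r + 1)) (2 * (1/2) ^ m) (P s)"
proof -
  have "near_band (m * (r + 1)) (4 * (1/2) ^ m / 2) (P s)"
  proof (rule near_band_contour[OF P_int[OF assms]])
    fix t show "opnorm_le (R s t - T s m t) (4 * (1/2) ^ m)"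
      using E_opnorm_le[OF assms] neumann[OF assms, of t m] by simp
  qed (rule continuous_T corner_T T_band | simp)+
  then show ?thesis by simp
qed

lemma P'_apx: assumes "s \<in> {0..1}" shows "near_band (m * (r + 1) + r + m * (r + 1)) (24 * \<epsilon> * (1/2) ^ m) (P' s)"
proof -
  have "near_band (m * (r + 1) + r + m * (r + 1)) (48 * \<epsilon> * (1/2) ^ m / 2) (P' s)"
  proof (rule near_band_contour[OF P'_int[OF assms], where X = "\<lambda>t. T s m t * v * T s m t"])
    fix t
    show "band (m * (r + 1) + r + m * (r + 1)) (T s m t * v * T s m t)"
      by (intro band_mult T_band band_v)
    \<comment> \<open>Replacing one resolvent at a time gives errors
      \<open>8 * \<epsilon> * 4\<close> and \<open>4 * \<epsilon> * 4\<close> times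
      \<open>(1/2) ^ m\<close>: together 48, and 24 after the contour factor.\<close>
    have "R s t * v * R s t - T s m t * v * T s m t = T s m t * v * E s m t + E s m t * v * R s t"
      using neumann[OF assms, of t m] by (simp add: algebra_simps)
    moreover have "opnorm_le (T s m t * v * E s m t + E s m t * v * R s t)
        (8 * \<epsilon> * (4 * (1/2) ^ m) + 4 * (1/2) ^ m * \<epsilon> * 4)"
      using eps by (intro opnorm_le_add opnorm_le_mult T_opnorm_le E_opnorm_le R_opb4 v assms) auto
    ultimately show "opnorm_le (R s t * v * R s t - T s m t * v * T s m t) (48 * \<epsilon> * (1/2) ^ m)"
      by (simp add: algebra_simps)
  qed (use eps in \<open>auto intro!: continuous_intros continuous_T simp: corner_T v\<close>)
  then show ?thesis by (simp add: algebra_simps)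
qed

lemma G_near_band: assumes "s \<in> {0..1}" shows "near_band (m * (r + 1)) (6 * (1/2) ^ m) (G s)"
proof -
  have "near_band (m * (r + 1)) (\<bar>2\<bar> * (2 * (1/2) ^ m) + 2 * (1/2) ^ m + 0) (2 *\<^sub>R P s + M s + (- 1) *\<^sub>R idmat n)"
    unfolding M_def by (intro near_band_add near_band_scaleR near_band_cnjm P_near_band near_band_band band_scaleR assms band_idmat)
  then show ?thesis by (simp add: G_def algebra_simps)
qed

text \<open>\<open>K s\<close> is \<open>P' s * G s\<close> plus its conjugate. The bandwidths
  \<open>2 m (r + 1) + r\<close> for \<open>P'\<close> and \<open>m (r + 1)\<close> for
  \<open>G\<close> add up. The constant is twice \<open>26 * 6 + 24 = 180\<close>.\<close>

lemma K_ent: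
  assumes "s \<in> {0..1}" "i + (3 * m * (r + 1) + r) < j \<or> j + (3 * m * (r + 1) + r) < i"
  shows "cmod (ent (K s) i j) \<le> 360 * \<epsilon> * (1/2) ^ m"
proof -
  have q: "0 \<le> (1/2::real) ^ m" "(1/2::real) ^ m \<le> 1" by (simp_all add: power_le_one)
  have "opnorm_le (P' s) (2 * \<epsilon>)"
  proof (rule opnorm_le_mono[OF P'_opb[OF assms(1)]])
    have "s * \<epsilon> \<le> \<epsilon>" using assms eps by (auto simp: mult_left_le_one_le)
    then have "\<epsilon> / (1 - 2 * s * \<epsilon>) \<le> \<epsilon> / (1/2)" using eps eps4 by (intro divide_left_mono) auto
    then show "\<epsilon> / (1 - 2 * s * \<epsilon>) \<le> 2 * \<epsilon>" by simp
  qed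
  then have "cmod (ent (P' s * G s) i j) \<le> (2 * \<epsilon> + 24 * \<epsilon> * (1/2) ^ m) * (6 * (1/2) ^ m) + 24 * \<epsilon> * (1/2) ^ m * 1"
    using assms eps q by (intro near_band_mult_ent[OF P'_apx G_near_band _ G_opnorm_le]) (auto simp: algebra_simps)
  also have "\<dots> \<le> (2 * \<epsilon> + 24 * \<epsilon>) * (6 * (1/2) ^ m) + 24 * \<epsilon> * (1/2) ^ m * 1"
    using eps q by (intro add_mono mult_right_mono add_left_mono mult_left_le) auto
  finally have "cmod (ent (P' s * G s) i j) \<le> 180 * \<epsilon> * (1/2) ^ m" by simp
  moreover have "K s = P' s * G s + cnjm (P' s * G s)" by (simp add: K_def M'_def cnjm_mult)
  then have "cmod (ent (K s) i j) \<le> cmod (ent (P' s * G s) i j) + cmod (ent (P' s * G s) i j)"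
    using norm_triangle_ineq[of "ent (P' s * G s) i j" "cnj (ent (P' s * G s) i j)"] by simp
  ultimately show ?thesis by simp
qed

text \<open>\<open>K_ent\<close> is used with a number \<open>m\<close> of Neumann terms
  proportional to the distance from the diagonal. Rounding \<open>m\<close> costs the factor 4 in
  \<open>1440 = 4 * 360\<close>.\<close>

lemma K_decay:
  assumes "s \<in> {0..1}"
  shows "cmod (ent (K s) i j) \<le> 1440 * \<epsilon> * (2/3) powr (\<bar>real i - real j\<bar> / (4 * real r))"
proof -
  define d where "d = (if i \<le> j then j - i else i - j)"
  have d: "\<bar>real i - real j\<bar> = real d" by (auto simp: d_def)
  \<comment> \<open>From \<open>r + 1 \<le> 2 * r\<close> the half-width
    \<open>3 * m * (r + 1) + r\<close> is at most \<open>6 * r * m + r\<close>, which this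
    \<open>m\<close> keeps below \<open>d\<close> whenever \<open>d\<close> exceeds
    \<open>r\<close>.\<close>
  define m where "m = (d - r - 1) div (6 * r)"
  have bound: "cmod (ent (K s) i j) \<le> 360 * \<epsilon> * (1/2) ^ m"
  proof (cases "d \<ge> r + 1")
    case True
    have "m * (6 * r) \<le> d - r - 1" unfolding m_def by simp
    moreover have "3 * m * (r + 1) \<le> m * (6 * r)" using r by (simp add: algebra_simps)
    ultimately have "3 * m * (r + 1) + r < d" using True by linarith
    then show ?thesis by (intro K_ent assms) (auto simp: d_def split: if_splits)
  next
    case False
    \<comment> \<open>Truncated subtraction gives 0 here, and the norm bound on \<open>K\<close>
      takes the place of \<open>K_ent\<close>.\<close>
    then have "m = 0" by (simp add: m_def)
    have "2 * \<epsilon> / (1 - 2 * \<epsilon>) \<le> 2 * \<epsilon> / (1/2)" using eps eps4 by (intro divide_left_mono) auto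
    then have "2 * \<epsilon> / (1 - 2 * \<epsilon>) \<le> 360 * \<epsilon>" using eps by simp
    then have "cmod (ent (K s) i j) \<le> 360 * \<epsilon>" by (rule order_trans[OF opnorm_le_ent[OF K_opnorm_le[OF assms]]])
    then show ?thesis using \<open>m = 0\<close> by simp
  qed
  \<comment> \<open>One unit pays for the remainder of the division, the other for the offset
    \<open>r + 1 \<le> 6 * r\<close>.\<close>
  have "real d / (6 * real r) - 2 \<le> real m"
  proof -
    have "d - r - 1 = m * (6 * r) + (d - r - 1) mod (6 * r)" by (simp only: m_def div_mult_mod_eq)
    moreover have "(d - r - 1) mod (6 * r) < 6 * r" using r by simp
    moreover have "6 * r * (m + 2) = m * (6 * r) + 12 * r" by (simp add: algebra_simps)
    ultimately have "d \<le> 6 * r * (m + 2)" using r by linarith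
    then have "real d \<le> real (6 * r * (m + 2))" by (rule of_nat_mono)
    then have "real d \<le> 6 * real r * (real m + 2)" by (simp add: algebra_simps)
    then show ?thesis using r by (simp add: field_simps)
  qed
  then have "(1/2) ^ m \<le> (1/2::real) powr (real d / (6 * real r) - 2)"
    by (subst powr_realpow[symmetric]) (auto intro: powr_mono')
  also have "\<dots> = 4 * (1/2) powr (real d / (6 * real r))" by (simp add: powr_diff power2_eq_square)
  also have "(1/2::real) powr (real d / (6 * real r)) = ((1/2) powr (2/3)) powr (real d / (4 * real r))"
    by (simp add: powr_powr)
  also have "\<dots> \<le> (2/3) powr (real d / (4 * real r))"
  proof (rule powr_mono2)
    \<comment> \<open>Passing from \<open>d / (6 r)\<close> to \<open>d / (4 r)\<close> replaces the
      base 1/2 by \<open>(1/2) powr (2/3)\<close>, which is at most 2/3 since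
      \<open>1/4 \<le> 8/27\<close>.\<close>
    have "((1/2::real) powr (2/3)) ^ 3 = (1/2) powr (2/3 * real 3)" by (subst powr_power) simp_all
    also have "\<dots> = 1/4" by (simp add: power2_eq_square)
    also have "\<dots> \<le> (2/3) ^ 3" by (simp add: power3_eq_cube)
    finally have "((1/2::real) powr (2/3)) ^ Suc 2 \<le> (2/3) ^ Suc 2" by (simp add: numeral_3_eq_3)
    then show "(1/2::real) powr (2/3) \<le> 2/3" by (rule power_le_imp_le_base) simp
  qed auto
  finally have "(1/2) ^ m \<le> 4 * (2/3::real) powr (real d / (4 * real r))" by simp
  then have "360 * \<epsilon> * (1/2) ^ m \<le> 360 * \<epsilon> * (4 * (2/3) powr (real d / (4 * real r)))"
    using eps by (intro mult_left_mono) auto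
  then show ?thesis using bound d by simp
qed

end

section \<open>Linear differential equations\<close>

lemma power_fact_has_integral:
  assumes "0 \<le> t"
  shows "((\<lambda>x. x ^ m / fact m) has_integral t ^ Suc m / fact (Suc m)) {0..t::real}"
proof -
  have "((\<lambda>x. x ^ m / fact m) has_integral t ^ Suc m / fact (Suc m) - 0 ^ Suc m / fact (Suc m)) {0..t}"
  proof (rule fundamental_theorem_of_calculus[OF assms])
    fix x
    have "((\<lambda>x. x ^ Suc m / fact (Suc m)) has_real_derivative (real (Suc m) * x ^ m / fact (Suc m))) (at x within {0..t})"
      using DERIV_cdivide[OF DERIV_pow[of "Suc m" x "{0..t}"], of "fact (Suc m)"]
      by (simp del: power_Suc fact_Suc of_nat_Suc)
    moreover have "real (Suc m) * x ^ m / fact (Suc m) = x ^ m / fact m"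
      by (simp add: divide_simps del: of_nat_Suc)
    ultimately show "((\<lambda>x. x ^ Suc m / fact (Suc m)) has_vector_derivative x ^ m / fact m) (at x within {0..t})"
      by (simp add: has_real_derivative_iff_has_vector_derivative)
  qed
  then show ?thesis by simp
qed

context
  fixes A :: "real \<Rightarrow> nat \<Rightarrow> nat \<Rightarrow> complex" and d :: nat
  assumes A: "\<And>i j. i < d \<Longrightarrow> j < d \<Longrightarrow> continuous_on {0..1} (\<lambda>t. A t i j)"
begin

text \<open>The \<open>m\<close>-th term of the Dyson series, an \<open>m\<close>-fold iterated
  integral, and not a partial sum. Scalar entries are used because the complex numbers, unlike
  \<open>fmat\<close>, are complete.\<close>

primrec picard :: "nat \<Rightarrow> real \<Rightarrow> nat \<Rightarrow> nat \<Rightarrow> complex" where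
  "picard 0 t i j = (if i = j then 1 else 0)"
| "picard (Suc m) t i j = integral {0..t} (\<lambda>x. \<Sum>k<d. A x i k * picard m x k j)"

lemma picard_deriv:
  assumes "i < d" "j < d" "\<And>k. k < d \<Longrightarrow> continuous_on {0..1} (\<lambda>t. picard m t k j)" "t \<in> {0..1}"
  shows "((\<lambda>t. picard (Suc m) t i j) has_vector_derivative (\<Sum>k<d. A t i k * picard m t k j)) (at t within {0..1})"
  unfolding picard.simps using assms A
  by (intro integral_has_vector_derivative continuous_on_sum continuous_on_mult) auto

lemma picard_continuous: "i < d \<Longrightarrow> j < d \<Longrightarrow> continuous_on {0..1} (\<lambda>t. picard m t i j)"
proof (induction m arbitrary: i)
  case (Suc m)
  then show ?case by (intro continuous_on_vector_derivative[OF picard_deriv]) auto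
qed simp

text \<open>The \<open>m\<close>-th term is bounded by \<open>(c t)^m / m!\<close>, so the series of
  derivatives converges uniformly and the sum may be differentiated term by term.\<close>

lemma linear_ode_exists:
  "\<exists>U :: real \<Rightarrow> nat \<Rightarrow> nat \<Rightarrow> complex. (\<forall>i<d. \<forall>j<d. U 0 i j = (if i = j then 1 else 0)) \<and>
     (\<forall>u\<in>{0..1}. \<forall>i<d. \<forall>j<d.
        ((\<lambda>t. U t i j) has_vector_derivative (\<Sum>k<d. A u i k * U u k j)) (at u within {0..1}))"
proof -
  have "\<exists>B. \<forall>t\<in>{0..1}. cmod (A t i j) \<le> B" if "i < d" "j < d" for i j
    using compact_imp_bounded[OF compact_continuous_image[OF A[OF that] compact_Icc]]
    unfolding bounded_iff by auto
  then obtain B0 where B0: "\<And>i j t. i < d \<Longrightarrow> j < d \<Longrightarrow> t \<in> {0..1} \<Longrightarrow> cmod (A t i j) \<le> B0 i j" by metis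
  define B where "B = (\<Sum>i<d. \<Sum>j<d. \<bar>B0 i j\<bar>)"
  have B: "cmod (A t i j) \<le> B" if "i < d" "j < d" "t \<in> {0..1}" for i j t
  proof -
    have "cmod (A t i j) \<le> \<bar>B0 i j\<bar>" using B0[OF that] by simp
    also have "\<dots> \<le> (\<Sum>j<d. \<bar>B0 i j\<bar>)" using that by (intro member_le_sum) auto
    also have "\<dots> \<le> B" unfolding B_def using that
      by (intro member_le_sum[where f = "\<lambda>i. \<Sum>j<d. \<bar>B0 i j\<bar>"]) (auto intro: sum_nonneg)
    finally show ?thesis .
  qed
  have B_nonneg: "0 \<le> B" unfolding B_def by (intro sum_nonneg) auto
  \<comment> \<open>Bounds the sum of the moduli in a row of \<open>A t\<close>, uniformly in
    \<open>t\<close>.\<close>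
  define c where "c = real d * B"
  have c: "0 \<le> c" using B_nonneg by (simp add: c_def)
  have rhs: "cmod (\<Sum>k<d. A t i k * f k) \<le> c * b" if "i < d" "t \<in> {0..1}" "\<And>k. k < d \<Longrightarrow> cmod (f k) \<le> b" for i t f b
  proof -
    have "cmod (\<Sum>k<d. A t i k * f k) \<le> (\<Sum>k<d. B * b)"
      using that B B_nonneg by (intro sum_norm_le) (auto simp: norm_mult intro!: mult_mono)
    then show ?thesis by (simp add: c_def)
  qed
  have bound: "cmod (picard m t i j) \<le> c ^ m * (t ^ m / fact m)" if "i < d" "j < d" "t \<in> {0..1}" for m t i j
    using that(1,3)
  proof (induction m arbitrary: t i)
    case (Suc m)
    have I: "((\<lambda>x. c * c ^ m * (x ^ m / fact m)) has_integral c * c ^ m * (t ^ Suc m / fact (Suc m))) {0..t}"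
      using Suc.prems by (intro has_integral_mult_right power_fact_has_integral) simp
    have "cmod (integral {0..t} (\<lambda>x. \<Sum>k<d. A x i k * picard m x k j)) \<le> integral {0..t} (\<lambda>x. c * c ^ m * (x ^ m / fact m))"
    proof (rule integral_norm_bound_integral)
      have "continuous_on {0..1} (\<lambda>x. \<Sum>k<d. A x i k * picard m x k j)"
        using Suc.prems that A picard_continuous by (intro continuous_on_sum continuous_on_mult) auto
      then show "(\<lambda>x. \<Sum>k<d. A x i k * picard m x k j) integrable_on {0..t}"
        using Suc.prems by (intro integrable_continuous_real) (auto intro: continuous_on_subset)
      show "(\<lambda>x. c * c ^ m * (x ^ m / fact m)) integrable_on {0..t}" using I by blast
      fix x assume "x \<in> {0..t}"
      then show "cmod (\<Sum>k<d. A x i k * picard m x k j) \<le> c * c ^ m * (x ^ m / fact m)"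
        unfolding mult.assoc[of c] using Suc by (intro rhs) auto
    qed
    then show ?case using integral_unique[OF I] by simp
  qed simp
  \<comment> \<open>The derivative of \<open>picard m\<close>. It involves the preceding term, so
    shifting the index turns the sum of the derivatives into \<open>A\<close> applied to the
    sum.\<close>
  define D where "D m t i j = (case m of 0 \<Rightarrow> 0 | Suc m \<Rightarrow> (\<Sum>k<d. A t i k * picard m t k j))" for m t i j
  have D: "((\<lambda>t. picard m t i j) has_vector_derivative D m t i j) (at t within {0..1})"
    if "i < d" "j < d" "t \<in> {0..1}" for m t i j
  proof (cases m)
    case 0 then show ?thesis by (simp add: D_def)
  next
    case (Suc k) then show ?thesis using picard_deriv[of i j k t] picard_continuous that by (simp add: D_def)
  qed
  define M where "M m = (case m of 0 \<Rightarrow> 0 | Suc m \<Rightarrow> c * (c ^ m / fact m))" for m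
  have exp: "summable (\<lambda>m. c ^ m / fact m)" using summable_exp[of c] by (simp add: field_simps)
  have M: "summable M"
    unfolding M_def by (subst summable_Suc_iff[symmetric]) (simp only: nat.case summable_mult[OF exp])
  have t1: "c ^ m * (t ^ m / fact m) \<le> c ^ m / fact m" if "t \<in> {0..1}" for t m
  proof -
    have "t ^ m \<le> 1" "0 \<le> t ^ m" using that by (auto simp: power_le_one)
    then have "c ^ m * (t ^ m / fact m) \<le> c ^ m * (1 / fact m)" using c by (intro mult_left_mono divide_right_mono) auto
    then show ?thesis by simp
  qed
  have DM: "cmod (D m t i j) \<le> M m" if "i < d" "j < d" "t \<in> {0..1}" for m t i j
  proof (cases m)
    case (Suc k)
    have "cmod (picard k t l j) \<le> c ^ k / fact k" if "l < d" for l
      using bound[OF that \<open>j < d\<close> \<open>t \<in> {0..1}\<close>, of k] t1[OF \<open>t \<in> {0..1}\<close>, of k] by linarith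
    then show ?thesis unfolding Suc D_def M_def using rhs[of i t "\<lambda>l. picard k t l j" "c ^ k / fact k"] that by simp
  qed (simp add: D_def M_def)
  have sm: "summable (\<lambda>m. picard m t i j)" if "i < d" "j < d" "t \<in> {0..1}" for t i j
    by (rule summable_comparison_test'[OF exp]) (use bound[OF that] t1[OF that(3)] in \<open>blast intro: order_trans\<close>)
  define U where "U t i j = (\<Sum>m. picard m t i j)" for t i j
  have "U 0 i j = (if i = j then 1 else 0)" if "i < d" "j < d" for i j
  proof -
    have "picard m 0 i j = 0" if "m \<notin> {0}" for m using that by (cases m) auto
    then have "U 0 i j = (\<Sum>m\<in>{0}. picard m 0 i j)" unfolding U_def by (intro suminf_finite) auto
    then show ?thesis by simp
  qed
  moreover have "((\<lambda>t. U t i j) has_vector_derivative (\<Sum>k<d. A u i k * U u k j)) (at u within {0..1})"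
    if ij: "i < d" "j < d" and u: "u \<in> {0..1}" for i j u
  proof -
    have ul: "uniform_limit {0..1} (\<lambda>m t. \<Sum>k<m. D k t i j) (\<lambda>t. \<Sum>k. D k t i j) sequentially"
      by (rule Weierstrass_m_test[OF _ M]) (use DM ij in auto)
    have "\<exists>g. \<forall>x\<in>{0..1}. (\<lambda>m. picard m x i j) sums g x \<and>
        (g has_derivative (\<lambda>h. h *\<^sub>R (\<Sum>k. D k x i j))) (at x within {0..1})"
    proof (rule has_derivative_series[where f' = "\<lambda>m x h. h *\<^sub>R D m x i j" and x = 0 and l = "U 0 i j"])
      show "(\<lambda>m. picard m 0 i j) sums U 0 i j" unfolding U_def by (rule summable_sums[OF sm]) (use ij in auto)
      show "\<And>m x. x \<in> {0..1} \<Longrightarrow> ((\<lambda>t. picard m t i j) has_derivative (\<lambda>h. h *\<^sub>R D m x i j)) (at x within {0..1})"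
        using D[OF ij] by (simp add: has_vector_derivative_def)
      fix e :: real assume "e > 0"
      then have "\<forall>\<^sub>F m in sequentially. \<forall>x\<in>{0..1}. dist (\<Sum>k<m. D k x i j) (\<Sum>k. D k x i j) < e"
        using ul unfolding uniform_limit_iff by blast
      then show "\<forall>\<^sub>F m in sequentially. \<forall>x\<in>{0..1}. \<forall>h. norm ((\<Sum>k<m. h *\<^sub>R D k x i j) - h *\<^sub>R (\<Sum>k. D k x i j)) \<le> e * norm h"
      proof (rule eventually_mono, intro ballI allI)
        fix m x h assume a: "\<forall>x\<in>{0..1}. dist (\<Sum>k<m. D k x i j) (\<Sum>k. D k x i j) < e" and x: "x \<in> {0..1::real}"
        have "norm ((\<Sum>k<m. h *\<^sub>R D k x i j) - h *\<^sub>R (\<Sum>k. D k x i j))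
          = \<bar>h\<bar> * dist (\<Sum>k<m. D k x i j) (\<Sum>k. D k x i j)"
          by (simp add: dist_norm flip: scaleR_sum_right scaleR_diff_right)
        also have "\<dots> \<le> \<bar>h\<bar> * e" using a x by (intro mult_left_mono) (auto intro: less_imp_le)
        finally show "norm ((\<Sum>k<m. h *\<^sub>R D k x i j) - h *\<^sub>R (\<Sum>k. D k x i j)) \<le> e * norm h"
          by (simp add: mult.commute)
      qed
    qed auto
    then obtain g where g: "\<And>x. x \<in> {0..1} \<Longrightarrow> (\<lambda>m. picard m x i j) sums g x"
      "\<And>x. x \<in> {0..1} \<Longrightarrow> (g has_vector_derivative (\<Sum>k. D k x i j)) (at x within {0..1})"
      unfolding has_vector_derivative_def by blast
    have gU: "g x = U x i j" if "x \<in> {0..1}" for x using g(1)[OF that] unfolding U_def by (rule sums_unique)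
    have "((\<lambda>t. U t i j) has_vector_derivative (\<Sum>k. D k u i j)) (at u within {0..1})"
      by (rule has_vector_derivative_transform[OF u _ g(2)[OF u]]) (simp add: gU)
    moreover have "(\<Sum>k. D k u i j) = (\<Sum>k<d. A u i k * U u k j)"
    proof -
      have "summable (\<lambda>m. D m u i j)"
        by (rule summable_comparison_test'[OF M]) (use DM[OF ij u] in auto)
      then have "(\<Sum>m. D m u i j) = (\<Sum>m. D (Suc m) u i j)"
        using suminf_split_head[of "\<lambda>m. D m u i j"] by (simp add: D_def)
      also have "\<dots> = (\<Sum>k<d. \<Sum>m. A u i k * picard m u k j)"
        unfolding D_def nat.case by (intro suminf_sum summable_mult sm) (use ij u in auto)
      also have "\<dots> = (\<Sum>k<d. A u i k * U u k j)"
        unfolding U_def by (intro sum.cong refl suminf_mult sm) (use ij u in auto)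
      finally show ?thesis .
    qed
    ultimately show ?thesis by simp
  qed
  ultimately show ?thesis by blast
qed

end

text \<open>The skew-adjoint part contributes nothing to the derivative of a squared norm, and the
  antisymmetric coupling cancels in the sum over the index. A solution that starts at zero stays
  zero, which serves as the uniqueness statement for these equations.\<close>

lemma norm_conserved:
  fixes w :: "'i \<Rightarrow> real \<Rightarrow> fmat" and L :: "real \<Rightarrow> fmat" and k :: "real \<Rightarrow> 'i \<Rightarrow> 'i \<Rightarrow> real"
  assumes "\<And>u p. u \<in> {0..1} \<Longrightarrow> p \<in> I \<Longrightarrow>
      (w p has_vector_derivative (L u * w p u + (\<Sum>q\<in>I. k u p q *\<^sub>R w q u))) (at u within {0..1})"
    and L: "\<And>u. u \<in> {0..1} \<Longrightarrow> adj (L u) = - L u"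
    and k: "\<And>u p q. u \<in> {0..1} \<Longrightarrow> p \<in> I \<Longrightarrow> q \<in> I \<Longrightarrow> k u p q = - k u q p"
    and u: "u \<in> {0..1}"
  shows "(\<Sum>p\<in>I. (norm (w p u))\<^sup>2) = (\<Sum>p\<in>I. (norm (w p 0))\<^sup>2)"
proof -
  have "((\<lambda>u. \<Sum>p\<in>I. inner (w p u) (w p u)) has_vector_derivative 0) (at x within {0..1})" if x: "x \<in> {0..1}" for x
  proof -
    let ?w' = "\<lambda>p. L x * w p x + (\<Sum>q\<in>I. k x p q *\<^sub>R w q x)"
    have "((\<lambda>u. \<Sum>p\<in>I. inner (w p u) (w p u)) has_vector_derivative
        (\<Sum>p\<in>I. inner (w p x) (?w' p) + inner (?w' p) (w p x))) (at x within {0..1})"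
      by (intro has_vector_derivative_sum bounded_bilinear.has_vector_derivative[OF bounded_bilinear_inner] assms x)
    moreover have "inner (w p x) (?w' p) + inner (?w' p) (w p x) = 2 * (\<Sum>q\<in>I. k x p q * inner (w p x) (w q x))" for p
    proof -
      have "inner (w p x) (L x * w p x) = - inner (w p x) (L x * w p x)"
        using inner_adj[of "L x" "w p x" "w p x"] unfolding L[OF x] by (simp add: inner_commute)
      then show ?thesis
        by (simp add: inner_add_left inner_add_right inner_sum_left inner_sum_right inner_commute)
    qed
    moreover have "(\<Sum>p\<in>I. \<Sum>q\<in>I. k x p q * inner (w p x) (w q x)) = 0"
    proof -
      have "(\<Sum>p\<in>I. \<Sum>q\<in>I. k x p q * inner (w p x) (w q x)) = (\<Sum>p\<in>I. \<Sum>q\<in>I. k x q p * inner (w q x) (w p x))"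
        by (rule sum.swap)
      also have "\<dots> = (\<Sum>p\<in>I. \<Sum>q\<in>I. - (k x p q * inner (w p x) (w q x)))"
      proof (intro sum.cong refl)
        fix p q assume "p \<in> I" "q \<in> I"
        then have "k x q p = - k x p q" using k[OF x] by blast
        then show "k x q p * inner (w q x) (w p x) = - (k x p q * inner (w p x) (w q x))"
          using inner_commute[of "w q x" "w p x"] by simp
      qed
      finally show ?thesis by (simp add: sum_negf)
    qed
    ultimately show ?thesis by (simp flip: sum_distrib_left)
  qed
  then obtain c where "\<And>x. x \<in> {0..1} \<Longrightarrow> (\<Sum>p\<in>I. inner (w p x) (w p x)) = c"
    by (rule has_vector_derivative_zero_constant[OF convex_real_interval(5)]) auto
  then show ?thesis using u unfolding power2_norm_eq_inner by simp
qed

section \<open>Majorana operators\<close>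

text \<open>\<open>Q'\<close> projects onto the part of the range of \<open>Q\<close> where
  \<open>S\<close> equals \<open>s\<close>. The involution \<open>X\<close> commutes with
  \<open>Q\<close> and anticommutes with \<open>S\<close>; conjugating by it forces the trace of
  \<open>Q * S\<close> to equal its own negative, so the trace of \<open>Q\<close> is
  halved.\<close>

lemma spectral_half:
  assumes Q: "corner d Q" "adj Q = Q" "Q * Q = Q"
    and S: "corner d S" "adj S = S" "S * S = idmat d" "Q * S = S * Q"
    and X: "corner d X" "X * X = idmat d" "X * S = - (S * X)" "X * Q = Q * X"
    and s: "s * s = (1::real)"
  defines "Q' \<equiv> (1/2) *\<^sub>R (Q + s *\<^sub>R (Q * S))"
  shows "corner d Q'" "adj Q' = Q'" "Q' * Q' = Q'" "tr d Q' = tr d Q / 2"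
    "\<And>Y. Y * Q = Q * Y \<Longrightarrow> Y * S = S * Y \<Longrightarrow> Y * Q' = Q' * Y"
    "\<And>Y. Q * Y = Y \<Longrightarrow> S * Y = s *\<^sub>R Y \<Longrightarrow> Q' * Y = Y"
proof -
  show "corner d Q'" using Q S by (simp add: Q'_def)
  show "adj Q' = Q'" using Q S by (simp add: Q'_def adj_scaleR adj_add adj_mult)
  have QSQS: "Q * S * (Q * S) = Q"
  proof -
    have "Q * S * (Q * S) = Q * (S * Q) * S" by (simp only: mult.assoc)
    also have "\<dots> = Q * Q * (S * S)" by (simp only: S(4)[symmetric] mult.assoc)
    finally show ?thesis using Q S by simp
  qed
  have QQS: "Q * (Q * S) = Q * S" using Q(3) by (simp only: mult.assoc[symmetric])
  have QSQ: "Q * S * Q = Q * S" using Q(3) S(4) by (metis mult.assoc)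
  have "(Q + s *\<^sub>R (Q * S)) * (Q + s *\<^sub>R (Q * S)) = Q + s *\<^sub>R (Q * S) + s *\<^sub>R (Q * S) + (s * s) *\<^sub>R Q"
    by (simp add: distrib_left distrib_right Q(3) QQS QSQ QSQS scaleR_right_distrib)
  also have "\<dots> = 2 *\<^sub>R (Q + s *\<^sub>R (Q * S))" unfolding s by (simp add: scaleR_2)
  finally show "Q' * Q' = Q'" by (simp add: Q'_def)
  have "tr d (Q * S) = tr d (X * X * (Q * S))" using X(2) Q(1) S(1) by simp
  also have "\<dots> = tr d (X * (X * (Q * S)))" by (simp only: mult.assoc)
  also have "\<dots> = tr d (X * (Q * S) * X)" using X Q S by (intro tr_mult_commute) auto
  also have "X * (Q * S) * X = - (Q * S * (X * X))"
  proof -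
    have "X * (Q * S) = (X * Q) * S" by (simp only: mult.assoc)
    also have "\<dots> = Q * (X * S)" unfolding X(4) by (simp only: mult.assoc)
    also have "\<dots> = - (Q * S * X)" unfolding X(3) by (simp add: mult.assoc)
    finally show ?thesis by (simp add: mult.assoc)
  qed
  also have "tr d \<dots> = - tr d (Q * S)" using X(2) Q S by (simp add: tr_uminus)
  finally have "tr d (Q * S) = 0" by simp
  then show "tr d Q' = tr d Q / 2"
    by (simp add: Q'_def scC_of_real[symmetric] tr_scC tr_add)
  show "Y * Q' = Q' * Y" if Y: "Y * Q = Q * Y" "Y * S = S * Y" for Y
  proof -
    have "Y * (Q * S) = Q * S * Y" using Y by (metis mult.assoc)
    then show ?thesis using Y by (simp add: Q'_def distrib_left distrib_right)
  qed
  show "Q' * Y = Y" if Y: "Q * Y = Y" "S * Y = s *\<^sub>R Y" for Y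
  proof -
    have "Q' * Y = (1/2) *\<^sub>R (Q * Y + s *\<^sub>R (Q * (S * Y)))" by (simp add: Q'_def distrib_right mult.assoc)
    also have "\<dots> = (1/2) *\<^sub>R (2 *\<^sub>R Y)" unfolding Y by (simp add: Y s scaleR_2)
    finally show ?thesis by simp
  qed
qed

text \<open>Subtracting the projection onto \<open>g\<close> from \<open>Q\<close> leaves a
  projection of trace 0. Its trace is the square of its Frobenius norm, so it vanishes.\<close>

lemma trace_one_projection:
  assumes "corner d Q" "adj Q = Q" "Q * Q = Q" "tr d Q = 1"
    and g: "corner d g" "iscol g" "norm g = 1" "Q * g = g"
    and f: "iscol f" "Q * f = f"
  shows "f = ent (adj g * f) 0 0 *\<^sub>C g"
proof -
  define A where "A = Q - g * adj g"
  have A: "corner d A" "adj A = A" using assms by (simp_all add: A_def adj_diff adj_mult)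
  have gg: "adj g * g = idmat (Suc 0)"
    using adj_mult_col[OF g(2,2)] col_adj_mult_self[OF g(2)] g(3) by simp
  have gQ: "adj g * Q = adj g" using arg_cong[OF g(4), of adj] assms(2) by (simp add: adj_mult)
  have ge: "g * idmat (Suc 0) = g" using g(2) by (simp add: iscol_def)
  have "A * A = Q * Q - (Q * g) * adj g - g * (adj g * Q) + (g * (adj g * g)) * adj g"
    by (simp add: A_def algebra_simps)
  also have "\<dots> = A" by (simp add: assms(3) g(4) gQ gg ge A_def)
  finally have AA: "A * A = A" .
  have "tr d (g * adj g) = tr d (adj g * g)" using g(1) by (intro tr_mult_commute) auto
  also have "\<dots> = 1" using tr_adj_mult_self[OF g(1)] g(3) by simp
  finally have "tr d A = 0" using assms(4) by (simp add: A_def tr_diff)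
  then have "complex_of_real ((norm A)\<^sup>2) = 0" using tr_adj_mult_self[OF A(1)] by (simp only: A(2) AA)
  then have "A = 0" by simp
  then have "f = g * (adj g * f)" using f(2) by (simp add: A_def mult.assoc[symmetric])
  also have "adj g * f = ent (adj g * f) 0 0 *\<^sub>C idmat (Suc 0)" by (rule adj_mult_col[OF g(2) f(1)])
  finally show ?thesis by (simp add: ge)
qed

section \<open>Linear and quadratic expressions in Majorana operators\<close>

locale majorana =
  fixes N d :: nat and C :: "nat \<Rightarrow> fmat"
  assumes C: "\<And>i. i < 2 * N \<Longrightarrow> corner d (C i)" "\<And>i. i < 2 * N \<Longrightarrow> adj (C i) = C i"
    and car: "\<And>i j. i < 2 * N \<Longrightarrow> j < 2 * N \<Longrightarrow> C i * C j + C j * C i = (if i = j then 2 else 0) *\<^sub>R idmat d"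
begin

lemma C_sq: assumes "i < 2 * N" shows "C i * C i = idmat d"
proof -
  have "2 *\<^sub>R (C i * C i) = 2 *\<^sub>R idmat d" using car[OF assms assms] by (simp add: scaleR_2)
  then show ?thesis by simp
qed

lemma C_anti: assumes "i < 2 * N" "j < 2 * N" "i \<noteq> j" shows "C i * C j = - (C j * C i)"
  using car[OF assms(1,2)] assms(3) by (simp add: eq_neg_iff_add_eq_0)

lemma CCC:
  assumes "i < 2 * N" "j < 2 * N" "k < 2 * N"
  shows "C i * C j * C k = C k * (C i * C j) + (if j = k then 2 else 0) *\<^sub>R C i - (if i = k then 2 else 0) *\<^sub>R C j"
proof -
  have jk: "C j * C k = (if j = k then 2 else 0) *\<^sub>R idmat d - C k * C j" using car[of j k] assms by (simp add: eq_diff_eq)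
  have ik: "C i * C k = (if i = k then 2 else 0) *\<^sub>R idmat d - C k * C i" using car[of i k] assms by (simp add: eq_diff_eq)
  have "C i * C j * C k = C i * (C j * C k)" by (simp only: mult.assoc)
  also have "\<dots> = (if j = k then 2 else 0) *\<^sub>R C i - C i * C k * C j"
    unfolding jk using C assms by (simp add: right_diff_distrib mult.assoc)
  also have "C i * C k * C j = (if i = k then 2 else 0) *\<^sub>R C j - C k * (C i * C j)"
    unfolding ik using C assms by (simp add: left_diff_distrib mult.assoc)
  finally show ?thesis by simp
qed

definition lin :: "(nat \<Rightarrow> complex) \<Rightarrow> fmat" where "lin x = (\<Sum>i<2*N. x i *\<^sub>C C i)"

definition quadratic :: "(nat \<Rightarrow> nat \<Rightarrow> real) \<Rightarrow> fmat" where
  "quadratic A = (\<i> / 4) *\<^sub>C (\<Sum>i<2*N. \<Sum>j<2*N. A i j *\<^sub>R (C i * C j))"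

definition asym :: "(nat \<Rightarrow> nat \<Rightarrow> real) \<Rightarrow> bool" where
  "asym A \<longleftrightarrow> (\<forall>i<2*N. \<forall>j<2*N. A i j = - A j i)"

lemma corner_lin [simp]: "corner d (lin x)" unfolding lin_def using C by auto
lemma corner_quadratic [simp]: "corner d (quadratic A)"
  unfolding quadratic_def using C by (intro corner_scC corner_sum corner_scaleR corner_mult) auto

text \<open>Moving \<open>C k\<close> through \<open>C i * C j\<close> leaves two linear terms with
  factor 2; antisymmetry of \<open>A\<close> makes their sums combine, and the resulting 4 cancels
  the 1/4 of \<open>quadratic\<close>.\<close>

lemma quadratic_comm:
  assumes "asym A" "k < 2 * N"
  shows "(\<i> *\<^sub>C quadratic A) * C k = C k * (\<i> *\<^sub>C quadratic A) + (\<Sum>j<2*N. A k j *\<^sub>R C j)"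
proof -
  define q where "q = (\<Sum>i<2*N. \<Sum>j<2*N. A i j *\<^sub>R (C i * C j))"
  have iq: "\<i> *\<^sub>C quadratic A = (- 1/4) *\<^sub>R q" unfolding quadratic_def q_def[symmetric] by (rule fmat_eqI) simp
  have "q * C k = (\<Sum>i<2*N. \<Sum>j<2*N. A i j *\<^sub>R (C k * (C i * C j))
      + (if j = k then (2 * A i k) *\<^sub>R C i else 0) - (if i = k then (2 * A k j) *\<^sub>R C j else 0))"
    unfolding q_def sum_distrib_right
  proof (intro sum.cong refl)
    fix i j assume "i \<in> {..<2*N}" "j \<in> {..<2*N}"
    then show "A i j *\<^sub>R (C i * C j) * C k = A i j *\<^sub>R (C k * (C i * C j))
      + (if j = k then (2 * A i k) *\<^sub>R C i else 0) - (if i = k then (2 * A k j) *\<^sub>R C j else 0)"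
      unfolding mult_scaleR_left using assms(2)
      by (subst CCC) (auto simp: scaleR_right_distrib scaleR_right_diff_distrib mult.commute)
  qed
  also have "\<dots> = C k * q + (\<Sum>i<2*N. \<Sum>j<2*N. if j = k then (2 * A i k) *\<^sub>R C i else 0)
      - (\<Sum>i<2*N. \<Sum>j<2*N. if i = k then (2 * A k j) *\<^sub>R C j else 0)"
    by (simp add: q_def sum_subtractf sum.distrib sum_distrib_left)
  also have "(\<Sum>i<2*N. \<Sum>j<2*N. if j = k then (2 * A i k) *\<^sub>R C i else 0) = (\<Sum>i<2*N. (2 * A i k) *\<^sub>R C i)"
    using assms(2) by simp
  also have "\<dots> = - (\<Sum>i<2*N. (2 * A k i) *\<^sub>R C i)"
  proof -
    have "A i k = - A k i" if "i < 2 * N" for i using assms that unfolding asym_def by blast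
    then show ?thesis by (simp add: sum_negf[symmetric])
  qed
  also have "(\<Sum>i<2*N. \<Sum>j<2*N. if i = k then (2 * A k j) *\<^sub>R C j else 0) = (\<Sum>j<2*N. (2 * A k j) *\<^sub>R C j)"
    by (subst sum.swap) (use assms(2) in simp)
  finally have qC: "q * C k = C k * q - (\<Sum>j<2*N. (2 * A k j) *\<^sub>R C j) - (\<Sum>j<2*N. (2 * A k j) *\<^sub>R C j)" by simp
  have "(\<Sum>j<2*N. (2 * A k j) *\<^sub>R C j) = 2 *\<^sub>R (\<Sum>j<2*N. A k j *\<^sub>R C j)"
    by (simp add: scaleR_sum_right)
  then have "q * C k = C k * q - 4 *\<^sub>R (\<Sum>j<2*N. A k j *\<^sub>R C j)"
    unfolding qC by (simp add: diff_diff_eq flip: scaleR_left_distrib)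
  then show ?thesis unfolding iq by (simp add: scaleR_right_diff_distrib)
qed

lemma adj_quadratic: assumes "asym A" shows "adj (quadratic A) = quadratic A"
proof -
  have "adj (quadratic A) = (- \<i> / 4) *\<^sub>C (\<Sum>i<2*N. \<Sum>j<2*N. A i j *\<^sub>R (C j * C i))"
    unfolding quadratic_def adj_scC adj_sum adj_scaleR adj_mult using C by simp
  also have "(\<Sum>i<2*N. \<Sum>j<2*N. A i j *\<^sub>R (C j * C i)) = (\<Sum>j<2*N. \<Sum>i<2*N. A i j *\<^sub>R (C j * C i))"
    by (rule sum.swap)
  also have "\<dots> = (\<Sum>j<2*N. \<Sum>i<2*N. - (A j i *\<^sub>R (C j * C i)))"
  proof (intro sum.cong refl)
    fix i j assume "i \<in> {..<2*N}" "j \<in> {..<2*N}"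
    then have "i < 2 * N" "j < 2 * N" by auto
    then have "A i j = - A j i" using assms unfolding asym_def by blast
    then show "A i j *\<^sub>R (C j * C i) = - (A j i *\<^sub>R (C j * C i))" by simp
  qed
  finally show ?thesis by (simp add: quadratic_def sum_negf)
qed

lemma lin_comm:
  assumes "asym A"
  shows "quadratic A * lin x = lin x * quadratic A + lin (\<lambda>j. \<Sum>k<2*N. \<i> * complex_of_real (A j k) * x k)"
proof -
  have qC: "quadratic A * C k = C k * quadratic A - (\<Sum>j<2*N. (\<i> * complex_of_real (A k j)) *\<^sub>C C j)" if "k < 2 * N" for k
  proof -
    have "(- \<i>) *\<^sub>C ((\<i> *\<^sub>C quadratic A) * C k) = (- \<i>) *\<^sub>C (C k * (\<i> *\<^sub>C quadratic A) + (\<Sum>j<2*N. A k j *\<^sub>R C j))"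
      using quadratic_comm[OF assms that] by simp
    then show ?thesis
      by (simp add: scC_add_right scC_sum_right scC_scaleR del: scC_minus_left) (simp add: sum_negf)
  qed
  have "quadratic A * lin x = (\<Sum>k<2*N. x k *\<^sub>C (C k * quadratic A)) - (\<Sum>k<2*N. \<Sum>j<2*N. (\<i> * complex_of_real (A k j) * x k) *\<^sub>C C j)"
    unfolding lin_def sum_distrib_left
    by (simp add: qC scC_diff_right scC_sum_right sum_subtractf mult_ac)
  also have "(\<Sum>k<2*N. \<Sum>j<2*N. (\<i> * complex_of_real (A k j) * x k) *\<^sub>C C j)
      = (\<Sum>j<2*N. \<Sum>k<2*N. (\<i> * complex_of_real (A k j) * x k) *\<^sub>C C j)" by (rule sum.swap)
  also have "\<dots> = - lin (\<lambda>j. \<Sum>k<2*N. \<i> * complex_of_real (A j k) * x k)"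
    unfolding lin_def scC_sum_left sum_negf[symmetric]
  proof (intro sum.cong refl)
    fix j k assume "j \<in> {..<2*N}" "k \<in> {..<2*N}"
    then have "j < 2 * N" "k < 2 * N" by auto
    then have "A k j = - A j k" using assms unfolding asym_def by blast
    then show "(\<i> * complex_of_real (A k j) * x k) *\<^sub>C C j = - ((\<i> * complex_of_real (A j k) * x k) *\<^sub>C C j)" by simp
  qed
  also have "(\<Sum>k<2*N. x k *\<^sub>C (C k * quadratic A)) = lin x * quadratic A" by (simp add: lin_def sum_distrib_right)
  finally show ?thesis by simp
qed

text \<open>The pairing is bilinear rather than Hermitian. With \<open>y\<close> the conjugate of a
  nonzero \<open>x\<close> the right side is a positive multiple of the identity, so a mode and its
  adjoint cannot both annihilate a nonzero vector.\<close>

lemma lin_anti: "lin x * lin y + lin y * lin x = (2 * (\<Sum>i<2*N. x i * y i)) *\<^sub>C idmat d"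
proof -
  have "lin x * lin y + lin y * lin x = (\<Sum>i<2*N. \<Sum>j<2*N. (x i * y j) *\<^sub>C (C i * C j)) + (\<Sum>j<2*N. \<Sum>i<2*N. (x i * y j) *\<^sub>C (C j * C i))"
    unfolding lin_def sum_product by (simp add: mult.commute)
  also have "(\<Sum>j<2*N. \<Sum>i<2*N. (x i * y j) *\<^sub>C (C j * C i)) = (\<Sum>i<2*N. \<Sum>j<2*N. (x i * y j) *\<^sub>C (C j * C i))"
    by (rule sum.swap)
  also have "(\<Sum>i<2*N. \<Sum>j<2*N. (x i * y j) *\<^sub>C (C i * C j)) + \<dots> = (\<Sum>i<2*N. \<Sum>j<2*N. (x i * y j) *\<^sub>C (C i * C j + C j * C i))"
    by (simp add: sum.distrib scC_add_right)
  also have "\<dots> = (\<Sum>i<2*N. \<Sum>j<2*N. if j = i then (2 * (x i * y i)) *\<^sub>C idmat d else 0)"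
    by (intro sum.cong refl) (auto simp: car scC_scaleR mult.commute)
  also have "\<dots> = (2 * (\<Sum>i<2*N. x i * y i)) *\<^sub>C idmat d"
    by (simp add: sum_distrib_left scC_sum_left)
  finally show ?thesis .
qed

text \<open>For distinct indices a self-adjoint involution. The pairs \<open>(2 k, 2 k + 1)\<close>
  build the parity; the shifted pairs \<open>(2 j + 1, 2 j + 2)\<close> are the bonds of the
  unperturbed chain.\<close>

definition pairop :: "nat \<Rightarrow> nat \<Rightarrow> fmat" where "pairop a b = (- \<i>) *\<^sub>C (C a * C b)"

lemma pairop:
  assumes "a < 2 * N" "b < 2 * N" "a \<noteq> b"
  shows "corner d (pairop a b)" "adj (pairop a b) = pairop a b" "pairop a b * pairop a b = idmat d"
    "i < 2 * N \<Longrightarrow> pairop a b * C i = (if i = a \<or> i = b then -1 else 1) *\<^sub>R (C i * pairop a b)"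
    "X * C a = s *\<^sub>R (C a * X) \<Longrightarrow> X * C b = s *\<^sub>R (C b * X) \<Longrightarrow> s * s = 1 \<Longrightarrow> X * pairop a b = pairop a b * X"
proof -
  have ba: "C b * C a = - (C a * C b)" using C_anti[of b a] assms by simp
  show "corner d (pairop a b)" using C assms by (simp add: pairop_def)
  show "adj (pairop a b) = pairop a b"
    using C assms by (simp add: pairop_def adj_scC adj_mult adj_uminus ba)
  have "C a * C b * (C a * C b) = C a * (C b * C a) * C b" by (simp only: mult.assoc)
  also have "\<dots> = - (C a * C a * (C b * C b))" unfolding ba by (simp add: mult.assoc)
  finally have "C a * C b * (C a * C b) = - idmat d" using C_sq assms by simp
  then show "pairop a b * pairop a b = idmat d" by (simp add: pairop_def)
  show "pairop a b * C i = (if i = a \<or> i = b then -1 else 1) *\<^sub>R (C i * pairop a b)" if i: "i < 2 * N"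
  proof -
    have "C a * C b * C i = (if i = a \<or> i = b then -1 else 1) *\<^sub>R (C i * (C a * C b))"
    proof (cases "i = a \<or> i = b")
      case True
      then consider "i = a" | "i = b" by blast
      then show ?thesis
      proof cases
        case 1
        have "C a * C b * C a = C a * (C b * C a)" by (simp only: mult.assoc)
        then show ?thesis using 1 ba by simp
      next
        case 2
        have "C b * (C a * C b) = (C b * C a) * C b" by (simp only: mult.assoc)
        then show ?thesis using 2 ba by simp
      qed
    next
      case False
      then show ?thesis using CCC[of a b i] assms i by auto
    qed
    then show ?thesis by (auto simp: pairop_def)
  qed
  show "X * pairop a b = pairop a b * X"
    if "X * C a = s *\<^sub>R (C a * X)" "X * C b = s *\<^sub>R (C b * X)" "s * s = 1" for X s
  proof -
    have "X * (C a * C b) = (X * C a) * C b" by (simp only: mult.assoc)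
    also have "\<dots> = s *\<^sub>R (C a * (X * C b))" unfolding that(1) by (simp add: mult.assoc)
    also have "\<dots> = (s * s) *\<^sub>R (C a * C b * X)" unfolding that(2) by (simp add: mult.assoc)
    finally show ?thesis using that(3) by (simp add: pairop_def)
  qed
qed

primrec parop :: "nat \<Rightarrow> fmat" where
  "parop 0 = idmat d" | "parop (Suc k) = parop k * pairop (2 * k) (2 * k + 1)"

text \<open>The commutation rule is carried along for partial products: the next pair has to commute
  with the earlier factors for the product to stay a self-adjoint involution.\<close>

lemma parop:
  assumes "k \<le> N"
  shows "corner d (parop k) \<and> adj (parop k) = parop k \<and> parop k * parop k = idmat d \<and>
    (\<forall>i<2*N. parop k * C i = (if i < 2 * k then -1 else 1) *\<^sub>R (C i * parop k))"
  using assms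
proof (induction k)
  case 0 then show ?case using C by simp
next
  case (Suc k)
  let ?T = "pairop (2 * k) (2 * k + 1)"
  have ab: "2 * k < 2 * N" "2 * k + 1 < 2 * N" "2 * k \<noteq> 2 * k + 1" using Suc.prems by auto
  note T = pairop[OF ab]
  have IH: "corner d (parop k)" "adj (parop k) = parop k" "parop k * parop k = idmat d"
    "\<And>i. i < 2 * N \<Longrightarrow> parop k * C i = (if i < 2 * k then -1 else 1) *\<^sub>R (C i * parop k)" using Suc by auto
  have comm: "parop k * ?T = ?T * parop k"
    by (rule T(5)[of _ 1]) (use IH(4)[OF ab(1)] IH(4)[OF ab(2)] in auto)
  have "parop k * ?T * (parop k * ?T) = parop k * (?T * parop k) * ?T" by (simp only: mult.assoc)
  also have "\<dots> = (parop k * parop k) * (?T * ?T)" unfolding comm[symmetric] by (simp only: mult.assoc)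
  also have "\<dots> = idmat d" using IH T by simp
  finally have sq: "parop k * ?T * (parop k * ?T) = idmat d" .
  have "parop k * ?T * C i = (if i < 2 * Suc k then -1 else 1) *\<^sub>R (C i * (parop k * ?T))" if i: "i < 2 * N" for i
  proof -
    have "parop k * ?T * C i = parop k * (?T * C i)" by (simp only: mult.assoc)
    also have "\<dots> = (if i = 2 * k \<or> i = 2 * k + 1 then -1 else 1) *\<^sub>R (parop k * C i * ?T)"
      unfolding T(4)[OF i] by (simp add: mult.assoc)
    also have "\<dots> = (if i = 2 * k \<or> i = 2 * k + 1 then -1 else 1) *\<^sub>R (if i < 2 * k then -1 else 1) *\<^sub>R (C i * (parop k * ?T))"
      unfolding IH(4)[OF i] by (simp add: mult.assoc)
    also have "\<dots> = (if i < 2 * Suc k then -1 else 1) *\<^sub>R (C i * (parop k * ?T))" by auto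
    finally show ?thesis .
  qed
  then show ?case using IH T sq comm by (simp add: adj_mult)
qed

lemmas parity = parop[OF order_refl]

lemma parity_C: "i < 2 * N \<Longrightarrow> parop N * C i = - (C i * parop N)"
  using parity by simp

lemma parity_lin: "parop N * lin x = - (lin x * parop N)"
  by (simp add: lin_def sum_distrib_left sum_distrib_right parity_C sum_negf)

lemma parity_quadratic: "parop N * quadratic A = quadratic A * parop N"
proof -
  have "parop N * (C i * C j) = C i * C j * parop N" if "i < 2 * N" "j < 2 * N" for i j
  proof -
    have "parop N * (C i * C j) = (parop N * C i) * C j" by (simp only: mult.assoc)
    also have "\<dots> = - (C i * (parop N * C j))" unfolding parity_C[OF that(1)] by (simp add: mult.assoc)
    also have "\<dots> = C i * C j * parop N" unfolding parity_C[OF that(2)] by (simp add: mult.assoc)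
    finally show ?thesis .
  qed
  then show ?thesis by (simp add: quadratic_def sum_distrib_left sum_distrib_right)
qed

text \<open>Lowering the energy by \<open>-l\<close> flips the parity; a mode of energy \<open>l0\<close> smaller than \<open>-l\<close> repairs it.\<close>

lemma ground_state_annihilated:
  assumes A: "asym A"
    and x: "\<And>j. j < 2 * N \<Longrightarrow> (\<Sum>k<2*N. \<i> * complex_of_real (A j k) * x k) = complex_of_real l * x j"
    and y: "\<And>j. j < 2 * N \<Longrightarrow> (\<Sum>k<2*N. \<i> * complex_of_real (A j k) * y k) = complex_of_real l0 * y j"
    and y0: "\<exists>j<2*N. y j \<noteq> 0" and l: "\<bar>l0\<bar> < - l"
    and g: "corner d g" "iscol g" "parop N * g = s *\<^sub>C g" "quadratic A * g = E *\<^sub>C g"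
    and min: "\<And>w \<mu>. corner d w \<Longrightarrow> iscol w \<Longrightarrow> w \<noteq> 0 \<Longrightarrow> parop N * w = s *\<^sub>C w \<Longrightarrow> quadratic A * w = \<mu> *\<^sub>C w \<Longrightarrow> Re E \<le> Re \<mu>"
  shows "lin x * g = 0"
proof (rule ccontr)
  define w where "w = lin x * g"
  assume "lin x * g \<noteq> 0"
  then have w0: "w \<noteq> 0" by (simp add: w_def)
  have shift: "quadratic A * (lin z * X) = (m + complex_of_real b) *\<^sub>C (lin z * X)"
    if "\<And>j. j < 2 * N \<Longrightarrow> (\<Sum>k<2*N. \<i> * complex_of_real (A j k) * z k) = complex_of_real b * z j" "quadratic A * X = m *\<^sub>C X" for z b X m
  proof -
    have "lin (\<lambda>j. \<Sum>k<2*N. \<i> * complex_of_real (A j k) * z k) = complex_of_real b *\<^sub>C lin z"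
      unfolding lin_def scC_sum_right by (intro sum.cong refl) (simp add: that(1))
    then have "quadratic A * (lin z * X) = lin z * (quadratic A * X) + complex_of_real b *\<^sub>C (lin z * X)"
      using lin_comm[OF A, of z] by (simp add: mult.assoc[symmetric] distrib_right)
    then show ?thesis by (simp add: that(2) scC_add_left)
  qed
  have par: "parop N * (lin z * X) = - (lin z * (parop N * X))" for z X
    using parity_lin[of z] by (simp add: mult.assoc[symmetric])
  have w1: "corner d w" "iscol w" "quadratic A * w = (E + complex_of_real l) *\<^sub>C w" "parop N * w = - (s *\<^sub>C w)"
    unfolding w_def using g x by (auto simp: par intro!: shift)
  \<comment> \<open>The second mode restores the parity, and the energy \<open>E + l + b\<close>
    would lie strictly below the minimum because \<open>|b| < - l\<close>; so the product must
    vanish.\<close>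
  have no: "lin z * w = 0" if "\<And>j. j < 2 * N \<Longrightarrow> (\<Sum>k<2*N. \<i> * complex_of_real (A j k) * z k) = complex_of_real b * z j" "\<bar>b\<bar> = \<bar>l0\<bar>" for z b
  proof (rule ccontr)
    assume "lin z * w \<noteq> 0"
    moreover have "quadratic A * (lin z * w) = (E + complex_of_real l + complex_of_real b) *\<^sub>C (lin z * w)"
      by (rule shift) (use that w1 in auto)
    moreover have "parop N * (lin z * w) = s *\<^sub>C (lin z * w)" by (simp add: par w1(4))
    ultimately have "Re E \<le> Re (E + complex_of_real l + complex_of_real b)"
      using w1 by (intro min) auto
    then show False using l that(2) by auto
  qed
  \<comment> \<open>As \<open>A\<close> is real, the conjugate mode has energy \<open>- l0\<close>.
    Both \<open>y\<close> and its conjugate then annihilate \<open>w\<close>, which their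
    anticommutator forbids.\<close>
  have "(\<Sum>k<2*N. \<i> * complex_of_real (A j k) * cnj (y k)) = complex_of_real (- l0) * cnj (y j)" if "j < 2 * N" for j
  proof -
    have "cnj (\<Sum>k<2*N. \<i> * complex_of_real (A j k) * y k) = cnj (complex_of_real l0 * y j)" using y[OF that] by simp
    then show ?thesis by (simp add: sum_negf) (metis add.inverse_inverse)
  qed
  then have "lin (\<lambda>k. cnj (y k)) * w = 0" by (rule no) auto
  moreover have "lin y * w = 0" by (rule no[OF y]) auto
  ultimately have "(lin y * lin (\<lambda>k. cnj (y k)) + lin (\<lambda>k. cnj (y k)) * lin y) * w = 0"
    by (simp add: distrib_right mult.assoc)
  then have "(2 * (\<Sum>i<2*N. y i * cnj (y i))) *\<^sub>C w = 0" unfolding lin_anti using w1 by simp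
  then have "cmod (2 * (\<Sum>i<2*N. y i * cnj (y i))) * norm w = 0" by (metis norm_scC norm_zero)
  then have "(\<Sum>i<2*N. y i * cnj (y i)) = 0" using w0 by simp
  moreover have "(\<Sum>i<2*N. y i * cnj (y i)) = complex_of_real (\<Sum>i<2*N. (cmod (y i))\<^sup>2)"
    by (simp only: complex_norm_square of_real_sum)
  ultimately have "(\<Sum>i<2*N. (cmod (y i))\<^sup>2) = 0" by (simp only: of_real_eq_0_iff)
  then have "\<forall>i<2*N. y i = 0" by (simp add: sum_nonneg_eq_0_iff)
  then show False using y0 by blast
qed

text \<open>The projection onto the common eigenspace for eigenvalue 1 of the first \<open>k\<close>
  bonds. The coefficient 1 is written out to match \<open>spectral_half\<close> with
  \<open>s = 1\<close>.\<close>

primrec Q :: "nat \<Rightarrow> fmat" where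
  "Q 0 = idmat d" | "Q (Suc k) = (1/2) *\<^sub>R (Q k + 1 *\<^sub>R (Q k * pairop (2 * k + 1) (2 * k + 2)))"

text \<open>Each bond halves the trace, with \<open>C (2 * k + 1)\<close> as the anticommuting
  involution: it occurs in the new bond but in none of the earlier ones. \<open>C 0\<close> occurs
  in no bond and is reserved for the parity.\<close>

lemma Q:
  assumes "k < N"
  shows "corner d (Q k) \<and> adj (Q k) = Q k \<and> Q k * Q k = Q k \<and> tr d (Q k) = of_nat d / 2 ^ k \<and>
    (\<forall>i<2*N. i = 0 \<or> 2 * k < i \<longrightarrow> C i * Q k = Q k * C i) \<and> parop N * Q k = Q k * parop N"
  using assms
proof (induction k)
  case 0
  then show ?case using C parity by (simp add: tr_def)
next
  case (Suc k)
  let ?S = "pairop (2 * k + 1) (2 * k + 2)"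
  have ab: "2 * k + 1 < 2 * N" "2 * k + 2 < 2 * N" "2 * k + 1 \<noteq> 2 * k + 2" using Suc.prems by auto
  note S = pairop[OF ab]
  have IH: "corner d (Q k)" "adj (Q k) = Q k" "Q k * Q k = Q k" "tr d (Q k) = of_nat d / 2 ^ k"
    "\<And>i. i < 2 * N \<Longrightarrow> i = 0 \<or> 2 * k < i \<Longrightarrow> C i * Q k = Q k * C i" "parop N * Q k = Q k * parop N"
    using Suc by auto
  have QS: "Q k * ?S = ?S * Q k"
    by (rule S(5)[of _ 1]) (use IH(5)[OF ab(1)] IH(5)[OF ab(2)] in auto)
  have PS: "parop N * ?S = ?S * parop N"
    by (rule S(5)[of _ "-1"]) (use parity_C[OF ab(1)] parity_C[OF ab(2)] in auto)
  have XS: "C (2 * k + 1) * ?S = - (?S * C (2 * k + 1))" using S(4)[OF ab(1)] by simp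
  have X: "C (2 * k + 1) * Q k = Q k * C (2 * k + 1)" using IH(5)[OF ab(1)] by simp
  have one: "(1::real) * 1 = 1" by simp
  note H = spectral_half[OF IH(1-3) S(1-3) QS C(1)[OF ab(1)] C_sq[OF ab(1)] XS X one]
  have Y: "C i * Q (Suc k) = Q (Suc k) * C i" if "i < 2 * N" "i = 0 \<or> 2 * Suc k < i" for i
  proof -
    have "C i * ?S = ?S * C i" using S(4)[OF that(1)] that(2) by auto
    moreover have "C i * Q k = Q k * C i" using IH(5)[OF that(1)] that(2) by auto
    ultimately show ?thesis unfolding Q.simps by (intro H(5))
  qed
  have "parop N * Q (Suc k) = Q (Suc k) * parop N" unfolding Q.simps by (rule H(5)[OF IH(6) PS])
  moreover have "corner d (Q (Suc k))" "adj (Q (Suc k)) = Q (Suc k)" "Q (Suc k) * Q (Suc k) = Q (Suc k)"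
    unfolding Q.simps by (rule H(1-3))+
  moreover have "tr d (Q (Suc k)) = of_nat d / 2 ^ Suc k" unfolding Q.simps H(4) IH(4) by simp
  ultimately show ?case using Y by blast
qed

text \<open>The \<open>N - 1\<close> bonds reduce the trace from \<open>2 ^ N\<close> to 2, and the
  fixed parity reduces it to 1, with \<open>C 0\<close> as the anticommuting involution. A
  projection of trace 1 leaves only multiples of \<open>g\<close>.\<close>

lemma unique_ground_state:
  assumes N: "0 < N" "d = 2 ^ N" and s: "s * s = (1::real)"
    and g: "corner d g" "iscol g" "norm g = 1" "parop N * g = s *\<^sub>R g"
    and f: "corner d f" "iscol f" "parop N * f = s *\<^sub>R f"
    and gl: "\<And>j. j < N - 1 \<Longrightarrow> pairop (2 * j + 1) (2 * j + 2) * g = g"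
    and fl: "\<And>j. j < N - 1 \<Longrightarrow> pairop (2 * j + 1) (2 * j + 2) * f = f"
  shows "\<exists>c. f = c *\<^sub>C g"
proof -
  have fix_Q: "Q k * X = X" if "corner d X" "\<And>j. j < N - 1 \<Longrightarrow> pairop (2 * j + 1) (2 * j + 2) * X = X" "k \<le> N - 1" for k X
    using that(3)
  proof (induction k)
    case (Suc k)
    then have "Q (Suc k) * X = (1/2) *\<^sub>R (Q k * X + Q k * (pairop (2 * k + 1) (2 * k + 2) * X))"
      by (simp add: distrib_right mult.assoc)
    also have "\<dots> = X" using Suc that(2)[of k] by (simp flip: scaleR_2)
    finally show ?case .
  qed (use that in simp)
  let ?Q = "Q (N - 1)"
  have K: "N - 1 < N" "0 < 2 * N" using N by auto
  have q: "corner d ?Q" "adj ?Q = ?Q" "?Q * ?Q = ?Q" "tr d ?Q = of_nat d / 2 ^ (N - 1)" "?Q * parop N = parop N * ?Q"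
    using Q[OF K(1)] by auto
  have q0: "C 0 * ?Q = ?Q * C 0" using Q[OF K(1)] K(2) by blast
  have XS: "C 0 * parop N = - (parop N * C 0)" using parity_C[OF K(2)] by simp
  have P: "corner d (parop N)" "adj (parop N) = parop N" "parop N * parop N = idmat d" using parity by auto
  note H = spectral_half[OF q(1-3) P q(5) C(1)[OF K(2)] C_sq[OF K(2)] XS q0 s]
  have "tr d ((1/2) *\<^sub>R (?Q + s *\<^sub>R (?Q * parop N))) = 1"
  proof -
    have "(2::complex) ^ N = 2 * 2 ^ (N - 1)" using N(1) by (metis power_eq_if not_gr_zero)
    then have "of_nat d / 2 ^ (N - 1) / 2 = (1::complex)" by (simp add: N(2))
    then show ?thesis using H(4) q(4) by metis
  qed
  moreover have "(1/2) *\<^sub>R (?Q + s *\<^sub>R (?Q * parop N)) * g = g"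
    by (rule H(6)) (use fix_Q[OF g(1) gl] g in auto)
  moreover have "(1/2) *\<^sub>R (?Q + s *\<^sub>R (?Q * parop N)) * f = f"
    by (rule H(6)) (use fix_Q[OF f(1) fl] f in auto)
  ultimately have "f = ent (adj g * f) 0 0 *\<^sub>C g"
    using trace_one_projection[OF H(1-3) _ g(1-3) _ f(2)] by blast
  then show ?thesis by blast
qed

end

section \<open>The Majorana chain\<close>

definition fmat_of_mat :: "nat \<Rightarrow> complex mat \<Rightarrow> fmat" where "fmat_of_mat d A = mk d (\<lambda>i j. A $$ (i, j))"
definition fmat_of_vec :: "nat \<Rightarrow> complex vec \<Rightarrow> fmat" where "fmat_of_vec d x = mk d (\<lambda>i j. if j = 0 then x $ i else 0)"

lemma corner_fmat_of_mat [simp]: "corner d (fmat_of_mat d A)" by (simp add: fmat_of_mat_def)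
lemma corner_fmat_of_vec [simp]: "corner d (fmat_of_vec d x)" by (simp add: fmat_of_vec_def)
lemma iscol_fmat_of_vec [simp]: "iscol (fmat_of_vec d x)" by (auto simp: fmat_of_vec_def iscol_iff)

lemma fmat_of_mat_add: "A \<in> carrier_mat d d \<Longrightarrow> B \<in> carrier_mat d d \<Longrightarrow> fmat_of_mat d (A + B) = fmat_of_mat d A + fmat_of_mat d B"
  by (rule fmat_eqI) (auto simp: fmat_of_mat_def)

lemma fmat_of_mat_smult: "A \<in> carrier_mat d d \<Longrightarrow> fmat_of_mat d (a \<cdot>\<^sub>m A) = a *\<^sub>C fmat_of_mat d A"
  by (rule fmat_eqI) (auto simp: fmat_of_mat_def)

lemma fmat_of_mat_one: "fmat_of_mat d (1\<^sub>m d) = idmat d"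
  by (rule fmat_eqI) (auto simp: fmat_of_mat_def)

lemma fmat_of_mat_mult:
  assumes "A \<in> carrier_mat d d" "B \<in> carrier_mat d d" shows "fmat_of_mat d (A * B) = fmat_of_mat d A * fmat_of_mat d B"
proof (rule corner_eqI[of d])
  fix i j assume ij: "i < d" "j < d"
  have "(A * B) $$ (i, j) = (\<Sum>k<d. A $$ (i, k) * B $$ (k, j))"
    using assms ij by (simp add: scalar_prod_def atLeast0LessThan)
  then show "ent (fmat_of_mat d (A * B)) i j = ent (fmat_of_mat d A * fmat_of_mat d B) i j"
    using ij by (simp add: ent_mult_left[OF corner_fmat_of_mat]) (simp add: fmat_of_mat_def)
qed auto

lemma fmat_of_mat_adj: "self_adjoint_mat A \<Longrightarrow> A \<in> carrier_mat d d \<Longrightarrow> adj (fmat_of_mat d A) = fmat_of_mat d A"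
proof (rule corner_eqI[of d])
  fix i j assume A: "self_adjoint_mat A" "A \<in> carrier_mat d d" and ij: "i < d" "j < d"
  then have "A $$ (i, j) = cnj (A $$ (j, i))" unfolding self_adjoint_mat_def by blast
  then show "ent (adj (fmat_of_mat d A)) i j = ent (fmat_of_mat d A) i j" using ij by (simp add: fmat_of_mat_def)
qed auto

lemma fmat_of_vec_mult:
  assumes "A \<in> carrier_mat d d" "x \<in> carrier_vec d" shows "fmat_of_vec d (A *\<^sub>v x) = fmat_of_mat d A * fmat_of_vec d x"
proof (rule corner_eqI[of d])
  fix i j assume ij: "i < d" "j < d"
  have "(A *\<^sub>v x) $ i = (\<Sum>k<d. A $$ (i, k) * x $ k)"
    using assms ij by (simp add: scalar_prod_def atLeast0LessThan)
  then show "ent (fmat_of_vec d (A *\<^sub>v x)) i j = ent (fmat_of_mat d A * fmat_of_vec d x) i j"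
    using ij by (simp add: ent_mult_left[OF corner_fmat_of_mat]) (simp add: fmat_of_mat_def fmat_of_vec_def)
qed auto

lemma fmat_of_vec_smult: "x \<in> carrier_vec d \<Longrightarrow> fmat_of_vec d (a \<cdot>\<^sub>v x) = a *\<^sub>C fmat_of_vec d x"
  by (rule fmat_eqI) (auto simp: fmat_of_vec_def)

lemma fmat_of_vec_inj:
  assumes "0 < d" "x \<in> carrier_vec d" "y \<in> carrier_vec d" "fmat_of_vec d x = fmat_of_vec d y" shows "x = y"
proof (rule eq_vecI)
  fix i assume "i < dim_vec y"
  then have "ent (fmat_of_vec d x) i 0 = x $ i" "ent (fmat_of_vec d y) i 0 = y $ i" using assms(1-3) by (auto simp: fmat_of_vec_def)
  then show "x $ i = y $ i" using assms(4) by simp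
qed (use assms in auto)

lemma fmat_of_vec_surj:
  assumes "corner d w" "iscol w"
  obtains x where "x \<in> carrier_vec d" "fmat_of_vec d x = w"
proof
  show "vec d (\<lambda>i. ent w i 0) \<in> carrier_vec d" by simp
  show "fmat_of_vec d (vec d (\<lambda>i. ent w i 0)) = w"
    by (rule corner_eqI[of d]) (use assms in \<open>auto simp: fmat_of_vec_def iscol_iff\<close>)
qed

lemma norm_fmat_of_vec: assumes "0 < d" "x \<in> carrier_vec d" shows "norm (fmat_of_vec d x) = vnorm x"
proof -
  have "(norm (fmat_of_vec d x))\<^sup>2 = (\<Sum>i<d. \<Sum>j<d. if j = 0 then (cmod (x $ i))\<^sup>2 else 0)"
    unfolding norm_fmat_sq[OF corner_fmat_of_vec] by (intro sum.cong refl) (auto simp: fmat_of_vec_def)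
  also have "\<dots> = (vnorm x)\<^sup>2"
    unfolding vnorm_def using assms by (simp add: sum_nonneg)
  finally have "(norm (fmat_of_vec d x))\<^sup>2 = (vnorm x)\<^sup>2" .
  moreover have "0 \<le> vnorm x" by (simp add: vnorm_def sum_nonneg)
  ultimately show ?thesis by (simp add: power2_eq_iff_nonneg)
qed

lemma has_vector_derivative_mk:
  assumes "\<And>i j. i < n \<Longrightarrow> j < n \<Longrightarrow> ((\<lambda>t. F t i j) has_vector_derivative G i j) (at u within S)"
  shows "((\<lambda>t. mk n (F t)) has_vector_derivative mk n G) (at u within S)"
  unfolding mk_sum[of n "F _"] mk_sum[of n G]
  by (intro has_vector_derivative_sum bounded_linear.has_vector_derivative[OF bounded_linear_scC_left] assms) auto

text \<open>Indices start at 0 from here on: \<open>c p\<close> becomes \<open>C (p - 1)\<close>, and the unperturbed Hamiltonian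
  pairs each odd index with its successor.\<close>

definition A0 :: "nat \<Rightarrow> nat \<Rightarrow> real" where
  "A0 i j = (if i = 0 then 0 else if odd i then (if j = i + 1 then 1 else 0) else (if j = i - 1 then -1 else 0))"

lemma A0_alt: "A0 i j = (if odd i \<and> j = Suc i then 1 else if odd j \<and> i = Suc j then -1 else 0)"
  by (cases i) (auto simp: A0_def)

lemma A0_asym: "A0 i j = - A0 j i"
  unfolding A0_alt by auto

lemma sum_A0:
  assumes "i < n"
  shows "(\<Sum>k<n. complex_of_real (A0 i k) * f k) =
    (if i = 0 then 0 else if odd i then (if i + 1 < n then f (i + 1) else 0) else - f (i - 1))"
proof -
  have "complex_of_real (A0 i k) * f k =
    (if k = (if odd i then i + 1 else i - 1) then (if i = 0 then 0 else if odd i then f k else - f k) else 0)" for k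
    by (auto simp: A0_def)
  then show ?thesis using assms by (auto simp: sum.delta)
qed

definition hmat :: "nat \<Rightarrow> (nat \<Rightarrow> nat \<Rightarrow> real) \<Rightarrow> fmat" where
  "hmat n A = mk n (\<lambda>i j. \<i> * complex_of_real (A i j))"

lemma corner_hmat [simp]: "corner n (hmat n A)" by (simp add: hmat_def)

lemma adj_hmat: assumes "\<And>i j. i < n \<Longrightarrow> j < n \<Longrightarrow> A i j = - A j i" shows "adj (hmat n A) = hmat n A"
proof (rule corner_eqI[of n])
  fix i j assume "i < n" "j < n"
  then show "ent (adj (hmat n A)) i j = ent (hmat n A) i j" using assms[of i j] by (simp add: hmat_def)
qed auto

lemma cnjm_hmat: "cnjm (hmat n A) = - hmat n A"
  by (rule fmat_eqI) (auto simp: hmat_def)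

text \<open>Every index except the two ends 0 and \<open>2 * N - 1\<close> belongs to exactly one
  bond. The ends span the kernel: they are the zero modes of the unperturbed chain.\<close>

lemma hmat_A0_sq: "hmat (2 * N) A0 * hmat (2 * N) A0 = diag (2 * N) (\<lambda>i. if 0 < i \<and> i < 2 * N - 1 then 1 else 0)"
proof (rule corner_eqI[of "2 * N"])
  fix i j assume ij: "i < 2 * N" "j < 2 * N"
  have "ent (hmat (2 * N) A0 * hmat (2 * N) A0) i j = (\<Sum>k<2*N. complex_of_real (A0 i k) * (- complex_of_real (A0 k j)))"
    unfolding ent_mult_left[OF corner_hmat] by (intro sum.cong refl) (use ij in \<open>auto simp: hmat_def complex_eq_iff\<close>)
  also have "\<dots> = (if i = j then if 0 < i \<and> i < 2 * N - 1 then 1 else 0 else 0)"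
  proof -
    have "i + 1 < 2 * N \<longleftrightarrow> i < 2 * N - 1" by linarith
    moreover have "i < 2 * N - 1" if "even i" using that ij by (auto elim!: evenE)
    ultimately show ?thesis unfolding sum_A0[OF ij(1)] by (auto simp: A0_def elim!: oddE)
  qed
  finally show "ent (hmat (2 * N) A0 * hmat (2 * N) A0) i j = ent (diag (2 * N) (\<lambda>i. if 0 < i \<and> i < 2 * N - 1 then 1 else 0)) i j"
    using ij by simp
qed auto

lemma hmat_A0_cube: "hmat (2 * N) A0 * hmat (2 * N) A0 * hmat (2 * N) A0 = hmat (2 * N) A0"
proof (rule corner_eqI[of "2 * N"])
  fix i j assume ij: "i < 2 * N" "j < 2 * N"
  have "A0 i j = 0" if "\<not> (0 < i \<and> i < 2 * N - 1)"
  proof (cases "i = 0")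
    case False
    then have "i = 2 * N - 1" using that ij by linarith
    moreover have "odd (2 * N - 1)" using ij by auto
    ultimately show ?thesis using ij by (auto simp: A0_def)
  qed (simp add: A0_def)
  then show "ent (hmat (2 * N) A0 * hmat (2 * N) A0 * hmat (2 * N) A0) i j = ent (hmat (2 * N) A0) i j"
    unfolding hmat_A0_sq ent_diag_mult using ij by (auto simp: hmat_def)
qed auto

lemma band_hmat_A0: "band 1 (hmat n A0)" "band 1 (hmat (2 * N) A0 * hmat (2 * N) A0)"
  unfolding hmat_A0_sq by (auto simp: band_def hmat_def A0_def)

text \<open>Rescaling to the unit ball. The set under \<open>Sup\<close> is first bounded by the
  Frobenius norm, since only then does the supremum dominate its members.\<close>

lemma op_norm_apply:
  assumes "op_norm n M \<le> b"
  shows "(\<Sum>p\<in>{1..n}. (\<Sum>q\<in>{1..n}. M p q * x q)\<^sup>2) \<le> b\<^sup>2 * (\<Sum>q\<in>{1..n}. (x q)\<^sup>2)"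
proof -
  let ?S = "{sqrt (\<Sum>p\<in>{1..n}. (\<Sum>q\<in>{1..n}. M p q * x q)\<^sup>2) | x. (\<Sum>q\<in>{1..n}. (x q)\<^sup>2) \<le> 1}"
  have bdd: "bdd_above ?S"
  proof (rule bdd_aboveI)
    fix y assume "y \<in> ?S"
    then obtain x where y: "y = sqrt (\<Sum>p\<in>{1..n}. (\<Sum>q\<in>{1..n}. M p q * x q)\<^sup>2)" and x: "(\<Sum>q\<in>{1..n}. (x q)\<^sup>2) \<le> 1" by blast
    have "(\<Sum>p\<in>{1..n}. (\<Sum>q\<in>{1..n}. M p q * x q)\<^sup>2) \<le> (\<Sum>p\<in>{1..n}. \<Sum>q\<in>{1..n}. (M p q)\<^sup>2)"
    proof (rule sum_mono)
      fix p
      have "(\<Sum>q\<in>{1..n}. M p q * x q)\<^sup>2 \<le> (\<Sum>q\<in>{1..n}. (M p q)\<^sup>2) * (\<Sum>q\<in>{1..n}. (x q)\<^sup>2)" by (rule Cauchy_Schwarz_ineq_sum)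
      also have "\<dots> \<le> (\<Sum>q\<in>{1..n}. (M p q)\<^sup>2) * 1" by (rule mult_left_mono[OF x]) (simp add: sum_nonneg)
      finally show "(\<Sum>q\<in>{1..n}. M p q * x q)\<^sup>2 \<le> (\<Sum>q\<in>{1..n}. (M p q)\<^sup>2)" by simp
    qed
    then show "y \<le> sqrt (\<Sum>p\<in>{1..n}. \<Sum>q\<in>{1..n}. (M p q)\<^sup>2)" unfolding y by simp
  qed
  have le: "sqrt (\<Sum>p\<in>{1..n}. (\<Sum>q\<in>{1..n}. M p q * x q)\<^sup>2) \<le> b" if "(\<Sum>q\<in>{1..n}. (x q)\<^sup>2) \<le> 1" for x
  proof -
    have "sqrt (\<Sum>p\<in>{1..n}. (\<Sum>q\<in>{1..n}. M p q * x q)\<^sup>2) \<le> Sup ?S" by (rule cSup_upper[OF _ bdd]) (use that in blast)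
    then show ?thesis using assms unfolding op_norm_def by linarith
  qed
  define t where "t = (\<Sum>q\<in>{1..n}. (x q)\<^sup>2)"
  have t0: "0 \<le> t" by (simp add: t_def sum_nonneg)
  show ?thesis
  proof (cases "t = 0")
    case True
    then have "\<forall>q\<in>{1..n}. x q = 0" unfolding t_def by (subst (asm) sum_nonneg_eq_0_iff) auto
    then show ?thesis by simp
  next
    case False
    then have t: "0 < t" using t0 by simp
    have "(\<Sum>q\<in>{1..n}. (x q / sqrt t)\<^sup>2) = 1"
      using t by (simp add: power_divide t_def sum_divide_distrib[symmetric])
    then have le': "sqrt (\<Sum>p\<in>{1..n}. (\<Sum>q\<in>{1..n}. M p q * (x q / sqrt t))\<^sup>2) \<le> b" by (intro le) simp
    have eq: "(\<Sum>p\<in>{1..n}. (\<Sum>q\<in>{1..n}. M p q * (x q / sqrt t))\<^sup>2) = (\<Sum>p\<in>{1..n}. (\<Sum>q\<in>{1..n}. M p q * x q)\<^sup>2) / t"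
      using t by (simp add: sum_divide_distrib[symmetric] power_divide)
    have "(\<Sum>p\<in>{1..n}. (\<Sum>q\<in>{1..n}. M p q * x q)\<^sup>2) / t \<le> b\<^sup>2"
      using le' unfolding eq by (rule sqrt_le_D)
    then show ?thesis using t unfolding t_def[symmetric] by (simp add: field_simps)
  qed
qed

text \<open>\<open>op_norm\<close> tests real vectors only. A real matrix acts separately on the
  real and imaginary parts of each column, and the squared lengths add.\<close>

lemma op_norm_opnorm_le:
  assumes "op_norm n M \<le> b" "0 \<le> b"
  shows "opnorm_le (mk n (\<lambda>i j. complex_of_real (M (Suc i) (Suc j)))) b" (is "opnorm_le ?A b")
  unfolding opnorm_le_def
proof
  fix X
  obtain m0 where "corner m0 X" using corner_ex by blast
  then obtain m where m: "corner m X" "n \<le> m" by (meson corner_mono max.cobounded1 max.cobounded2)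
  have A: "corner m ?A" using m by (simp add: corner_mono[OF corner_mk])
  have col: "(\<Sum>i<n. (\<Sum>k<n. M (Suc i) (Suc k) * x k)\<^sup>2) \<le> b\<^sup>2 * (\<Sum>k<n. (x k)\<^sup>2)" for x
  proof -
    have sh: "(\<Sum>p\<in>{1..n}. f p) = (\<Sum>i<n. f (Suc i))" for f :: "nat \<Rightarrow> real"
      using sum.atLeast1_atMost_eq[of f n] by simp
    show ?thesis using op_norm_apply[OF assms(1), of "\<lambda>q. x (q - 1)"] unfolding sh by simp
  qed
  have ent: "ent (?A * X) i j = (if i < n then (\<Sum>k<n. complex_of_real (M (Suc i) (Suc k)) * ent X k j) else 0)" for i j
    by (simp add: ent_mult_left[OF corner_mk])
  have "(norm (?A * X))\<^sup>2 = (\<Sum>i<m. \<Sum>j<m. (cmod (ent (?A * X) i j))\<^sup>2)"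
    using norm_fmat_sq[OF corner_mult[OF A m(1)]] .
  also have "\<dots> = (\<Sum>j<m. \<Sum>i<m. (cmod (ent (?A * X) i j))\<^sup>2)" by (rule sum.swap)
  also have "\<dots> \<le> (\<Sum>j<m. \<Sum>i<m. b\<^sup>2 * (cmod (ent X i j))\<^sup>2)"
  proof (rule sum_mono)
    fix j
    have "(\<Sum>i<m. (cmod (ent (?A * X) i j))\<^sup>2) = (\<Sum>i<n. (cmod (ent (?A * X) i j))\<^sup>2)"
      using m(2) by (intro sum.mono_neutral_right) (auto simp: ent)
    also have "\<dots> = (\<Sum>i<n. (\<Sum>k<n. M (Suc i) (Suc k) * Re (ent X k j))\<^sup>2) + (\<Sum>i<n. (\<Sum>k<n. M (Suc i) (Suc k) * Im (ent X k j))\<^sup>2)"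
      unfolding sum.distrib[symmetric] by (intro sum.cong refl) (simp add: ent cmod_power2)
    also have "\<dots> \<le> b\<^sup>2 * (\<Sum>k<n. (Re (ent X k j))\<^sup>2) + b\<^sup>2 * (\<Sum>k<n. (Im (ent X k j))\<^sup>2)"
      by (intro add_mono col)
    also have "\<dots> = (\<Sum>k<n. b\<^sup>2 * (cmod (ent X k j))\<^sup>2)"
      by (simp add: cmod_power2 sum_distrib_left sum.distrib distrib_left)
    also have "\<dots> \<le> (\<Sum>k<m. b\<^sup>2 * (cmod (ent X k j))\<^sup>2)" using m(2) by (intro sum_mono2) auto
    finally show "(\<Sum>i<m. (cmod (ent (?A * X) i j))\<^sup>2) \<le> (\<Sum>i<m. b\<^sup>2 * (cmod (ent X i j))\<^sup>2)" .
  qed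
  also have "\<dots> = (\<Sum>i<m. \<Sum>j<m. b\<^sup>2 * (cmod (ent X i j))\<^sup>2)" by (rule sum.swap)
  also have "\<dots> = (b * norm X)\<^sup>2"
    unfolding power_mult_distrib norm_fmat_sq[OF m(1)] by (simp add: sum_distrib_left)
  finally show "norm (?A * X) \<le> b * norm X" using assms(2) by (simp add: power2_le_iff_abs_le)
qed

text \<open>A real test vector is embedded as column 0 of a matrix; invariance under
  \<open>cnjm\<close> ensures that taking real parts of the entries loses nothing.\<close>

lemma opnorm_le_op_norm:
  assumes "opnorm_le A b" "corner n A" "cnjm A = A" "0 \<le> b"
  shows "op_norm n (\<lambda>p q. Re (ent A (p - 1) (q - 1))) \<le> b"
  unfolding op_norm_def
proof (rule cSup_least)
  let ?S = "{sqrt (\<Sum>p\<in>{1..n}. (\<Sum>q\<in>{1..n}. Re (ent A (p - 1) (q - 1)) * x q)\<^sup>2) | x. (\<Sum>q\<in>{1..n}. (x q)\<^sup>2) \<le> 1}"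
  have "sqrt (\<Sum>p\<in>{1..n}. (\<Sum>q\<in>{1..n}. Re (ent A (p - 1) (q - 1)) * (\<lambda>_. 0) q)\<^sup>2) \<in> ?S"
    by (intro CollectI exI[of _ "\<lambda>_. 0"]) simp
  then show "?S \<noteq> {}" by blast
  fix y assume "y \<in> ?S"
  then obtain x where y: "y = sqrt (\<Sum>p\<in>{1..n}. (\<Sum>q\<in>{1..n}. Re (ent A (p - 1) (q - 1)) * x q)\<^sup>2)" and x: "(\<Sum>q\<in>{1..n}. (x q)\<^sup>2) \<le> 1" by blast
  have sh: "(\<Sum>p\<in>{1..n}. f p) = (\<Sum>i<n. f (Suc i))" for f :: "nat \<Rightarrow> real"
    using sum.atLeast1_atMost_eq[of f n] by simp
  define X where "X = mk n (\<lambda>i j. if j = 0 then complex_of_real (x (Suc i)) else 0)"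
  have re: "ent A i j = complex_of_real (Re (ent A i j))" for i j
    using arg_cong[OF assms(3), of "\<lambda>A. ent A i j"] by (auto simp: complex_eq_iff)
  have "(norm X)\<^sup>2 = (\<Sum>i<n. \<Sum>j<n. if j = 0 then (x (Suc i))\<^sup>2 else 0)"
    unfolding X_def norm_fmat_sq[OF corner_mk] by (intro sum.cong refl) auto
  also have "\<dots> \<le> 1" using x unfolding sh by (cases "n = 0") auto
  finally have nX: "norm X \<le> 1" by (simp add: power_le_one_iff abs_square_le_1)
  have "(\<Sum>i<n. (\<Sum>k<n. Re (ent A i k) * x (Suc k))\<^sup>2) = (\<Sum>i<n. \<Sum>j<n. if j = 0 then (\<Sum>k<n. Re (ent A i k) * x (Suc k))\<^sup>2 else 0)"
    by (cases "n = 0") auto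
  also have "\<dots> = (\<Sum>i<n. \<Sum>j<n. (cmod (ent (A * X) i j))\<^sup>2)"
  proof (intro sum.cong refl)
    fix i j assume ij: "i \<in> {..<n}" "j \<in> {..<n}"
    have "ent (A * X) i j = complex_of_real (if j = 0 then \<Sum>k<n. Re (ent A i k) * x (Suc k) else 0)"
      unfolding ent_mult_left[OF assms(2)] using ij by (subst re) (auto simp: X_def)
    then show "(if j = 0 then (\<Sum>k<n. Re (ent A i k) * x (Suc k))\<^sup>2 else 0) = (cmod (ent (A * X) i j))\<^sup>2"
      by (simp del: of_real_sum)
  qed
  also have "\<dots> = (norm (A * X))\<^sup>2"
    by (rule norm_fmat_sq[symmetric]) (use assms in \<open>simp add: X_def\<close>)
  finally have "y = norm (A * X)" unfolding y sh by simp
  also have "\<dots> \<le> b * norm X" by (rule opbD[OF assms(1)])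
  also have "\<dots> \<le> b" using nX assms(4) by (simp add: mult_left_le)
  finally show "y \<le> b" .
qed

section \<open>Fock space operators of the chain\<close>

locale chain =
  fixes N :: nat and c :: "nat \<Rightarrow> complex mat"
  assumes N: "2 \<le> N" and maj: "majorana_ops N c"
begin

definition C :: "nat \<Rightarrow> fmat" where "C i = fmat_of_mat (2 ^ N) (c (Suc i))"

lemma c_carrier: "p \<in> {1..2*N} \<Longrightarrow> c p \<in> carrier_mat (2 ^ N) (2 ^ N)"
  using maj unfolding majorana_ops_def by blast

lemma c_mult_carrier: "p \<in> {1..2*N} \<Longrightarrow> q \<in> {1..2*N} \<Longrightarrow> c p * c q \<in> carrier_mat (2 ^ N) (2 ^ N)"
  using c_carrier mult_carrier_mat by blast

lemma majorana_C: "majorana N (2 ^ N) C"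
proof
  fix i assume "i < 2 * N"
  then have i: "Suc i \<in> {1..2*N}" by simp
  show "corner (2 ^ N) (C i)" by (simp add: C_def)
  show "adj (C i) = C i"
    unfolding C_def using i maj unfolding majorana_ops_def by (blast intro: fmat_of_mat_adj)
  fix j assume "j < 2 * N"
  then have j: "Suc j \<in> {1..2*N}" by simp
  have "c (Suc i) * c (Suc j) + c (Suc j) * c (Suc i) = (if Suc i = Suc j then 2 else 0) \<cdot>\<^sub>m 1\<^sub>m (2 ^ N)"
    using maj i j unfolding majorana_ops_def by blast
  from arg_cong[OF this, of "fmat_of_mat (2 ^ N)"]
  have "C i * C j + C j * C i = (if Suc i = Suc j then 2 else 0) *\<^sub>C idmat (2 ^ N)"
    unfolding C_def using i j
    by (simp add: fmat_of_mat_add[OF c_mult_carrier c_mult_carrier] fmat_of_mat_mult[OF c_carrier c_carrier] fmat_of_mat_smult[OF one_carrier_mat] fmat_of_mat_one)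
  then show "C i * C j + C j * C i = (if i = j then 2 else 0) *\<^sub>R idmat (2 ^ N)"
    by (auto simp: scC_of_real[symmetric])
qed

sublocale majorana N "2 ^ N" C by (rule majorana_C)

lemma shift_sum: "(\<Sum>p\<in>{1..2*N}. f p) = (\<Sum>i<2*N. f (Suc i))" for f :: "nat \<Rightarrow> 'a::comm_monoid_add"
  using sum.atLeast1_atMost_eq[of f "2 * N"] by simp

lemma ent_CC:
  assumes "i < 2 * N" "j < 2 * N" "a < 2 ^ N" "b < 2 ^ N"
  shows "ent (C i * C j) a b = (c (Suc i) * c (Suc j)) $$ (a, b)"
proof -
  have "C i * C j = fmat_of_mat (2 ^ N) (c (Suc i) * c (Suc j))"
    unfolding C_def using assms by (intro fmat_of_mat_mult[symmetric] c_carrier) auto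
  then show ?thesis using assms by (simp add: fmat_of_mat_def)
qed

lemma fmat_of_mat_quad_op: "fmat_of_mat (2 ^ N) (quad_op N c M) = quadratic (\<lambda>i j. M (Suc i) (Suc j))"
proof (rule corner_eqI[of "2 ^ N"])
  fix a b :: nat assume ab: "a < 2 ^ N" "b < 2 ^ N"
  have "ent (fmat_of_mat (2 ^ N) (quad_op N c M)) a b
      = \<i> / 4 * (\<Sum>i<2*N. \<Sum>j<2*N. complex_of_real (M (Suc i) (Suc j)) * (c (Suc i) * c (Suc j)) $$ (a, b))"
    using ab unfolding fmat_of_mat_def quad_op_def shift_sum by simp
  also have "\<dots> = ent (quadratic (\<lambda>i j. M (Suc i) (Suc j))) a b"
    unfolding quadratic_def using ab by (simp add: ent_CC)
  finally show "ent (fmat_of_mat (2 ^ N) (quad_op N c M)) a b = ent (quadratic (\<lambda>i j. M (Suc i) (Suc j))) a b" .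
qed auto

lemma quad_op_carrier: "quad_op N c M \<in> carrier_mat (2 ^ N) (2 ^ N)" by (simp add: quad_op_def)
lemma H0_op_carrier: "H0_op N c \<in> carrier_mat (2 ^ N) (2 ^ N)" by (simp add: H0_op_def)

text \<open>The antisymmetric coefficients list every bond twice, with signs that agree after
  anticommuting; this turns the 1/4 of \<open>quadratic\<close> into the 1/2 of
  \<open>H0_op\<close>.\<close>

lemma fmat_of_mat_H0_op: "fmat_of_mat (2 ^ N) (H0_op N c) = quadratic A0"
proof -
  have two: "(\<Sum>i<2*m. f i) = (\<Sum>k<m. f (2 * k) + f (2 * k + 1))" for m and f :: "nat \<Rightarrow> fmat"
    by (induction m) (simp_all add: add.assoc)
  have "(\<Sum>i<2*N. \<Sum>j<2*N. A0 i j *\<^sub>R (C i * C j)) =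
      (\<Sum>i<2*N. \<Sum>j<2*N. (if j = Suc i then (if odd i then C i * C j else 0) else 0)
        + (if i = Suc j then (if odd j then C j * C i else 0) else 0))"
  proof (intro sum.cong refl)
    fix i j assume "i \<in> {..<2*N}" "j \<in> {..<2*N}"
    then have "C i * C j = - (C j * C i)" if "i \<noteq> j" using that by (intro C_anti) auto
    then show "A0 i j *\<^sub>R (C i * C j) = (if j = Suc i then (if odd i then C i * C j else 0) else 0)
        + (if i = Suc j then (if odd j then C j * C i else 0) else 0)"
      unfolding A0_alt by auto
  qed
  also have "\<dots> = (\<Sum>i<2*N. \<Sum>j<2*N. if j = Suc i then (if odd i then C i * C j else 0) else 0)
      + (\<Sum>i<2*N. \<Sum>j<2*N. if i = Suc j then (if odd j then C j * C i else 0) else 0)"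
    by (simp add: sum.distrib)
  also have "(\<Sum>i<2*N. \<Sum>j<2*N. if i = Suc j then (if odd j then C j * C i else 0) else 0)
      = (\<Sum>i<2*N. \<Sum>j<2*N. if j = Suc i then (if odd i then C i * C j else 0) else 0)"
    by (rule sum.swap)
  also have "(\<Sum>i<2*N. \<Sum>j<2*N. if j = Suc i then (if odd i then C i * C j else 0) else 0)
      = (\<Sum>i<2*N. if Suc i < 2 * N \<and> odd i then C i * C (Suc i) else 0)"
    by (intro sum.cong refl) (simp add: sum.delta)
  also have "\<dots> = (\<Sum>k<N. if Suc (2 * k + 1) < 2 * N then C (2 * k + 1) * C (2 * k + 2) else 0)"
    unfolding two by (intro sum.cong refl) simp
  also have "\<dots> = (\<Sum>k<N-1. C (2 * k + 1) * C (2 * k + 2))"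
    by (rule sum.mono_neutral_cong_right) auto
  finally have q: "(\<Sum>i<2*N. \<Sum>j<2*N. A0 i j *\<^sub>R (C i * C j)) = 2 *\<^sub>R (\<Sum>k<N-1. C (2 * k + 1) * C (2 * k + 2))"
    by (simp only: scaleR_2)
  show ?thesis
  proof (rule corner_eqI[of "2 ^ N"])
    fix a b :: nat assume ab: "a < 2 ^ N" "b < 2 ^ N"
    have "(\<Sum>j\<in>{1..N-1}. (c (2*j) * c (2*j+1)) $$ (a,b)) = (\<Sum>k<N-1. (c (2 * Suc k) * c (2 * Suc k + 1)) $$ (a, b))"
      using sum.atLeast1_atMost_eq[of "\<lambda>j. (c (2*j) * c (2*j+1)) $$ (a,b)" "N - 1"] by simp
    also have "\<dots> = (\<Sum>k<N-1. ent (C (2 * k + 1) * C (2 * k + 2)) a b)"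
    proof (rule sum.cong[OF refl])
      fix k assume "k \<in> {..<N-1}"
      then show "(c (2 * Suc k) * c (2 * Suc k + 1)) $$ (a, b) = ent (C (2 * k + 1) * C (2 * k + 2)) a b"
        using ent_CC[of "2 * k + 1" "2 * k + 2" a b] ab by simp
    qed
    finally have H: "(\<Sum>j\<in>{1..N-1}. (c (2*j) * c (2*j+1)) $$ (a,b)) = (\<Sum>k<N-1. ent (C (2 * k + 1) * C (2 * k + 2)) a b)" .
    have "ent (fmat_of_mat (2 ^ N) (H0_op N c)) a b = \<i> / 2 * (\<Sum>k<N-1. ent (C (2 * k + 1) * C (2 * k + 2)) a b)"
      using ab H by (simp add: fmat_of_mat_def H0_op_def)
    moreover have "ent (quadratic A0) a b = \<i> / 4 * (2 * (\<Sum>k<N-1. ent (C (2 * k + 1) * C (2 * k + 2)) a b))"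
      unfolding quadratic_def q ent_scC ent_scaleR ent_sum by simp
    moreover have "\<i> / 4 * (2 * z) = \<i> / 2 * z" for z by simp
    ultimately show "ent (fmat_of_mat (2 ^ N) (H0_op N c)) a b = ent (quadratic A0) a b" by metis
  qed auto
qed

lemma fmat_of_mat_parity_op: "parity_op N c \<in> carrier_mat (2 ^ N) (2 ^ N)" "fmat_of_mat (2 ^ N) (parity_op N c) = parop N"
proof -
  let ?f = "\<lambda>M j. M * ((-\<i>) \<cdot>\<^sub>m (c (2*j-1) * c (2*j)))"
  have "foldl ?f (1\<^sub>m (2^N)) [1..<k+1] \<in> carrier_mat (2 ^ N) (2 ^ N) \<and>
      fmat_of_mat (2 ^ N) (foldl ?f (1\<^sub>m (2^N)) [1..<k+1]) = parop k" if "k \<le> N" for k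
    using that
  proof (induction k)
    case 0 then show ?case by (simp add: fmat_of_mat_one)
  next
    case (Suc k)
    let ?M = "foldl ?f (1\<^sub>m (2^N)) [1..<k+1]"
    have M: "?M \<in> carrier_mat (2 ^ N) (2 ^ N)" "fmat_of_mat (2 ^ N) ?M = parop k" using Suc by auto
    have pq: "2 * k + 1 \<in> {1..2*N}" "2 * k + 2 \<in> {1..2*N}" using Suc.prems by auto
    have cc: "(-\<i>) \<cdot>\<^sub>m (c (2 * k + 1) * c (2 * k + 2)) \<in> carrier_mat (2 ^ N) (2 ^ N)"
      using c_mult_carrier[OF pq] by simp
    have "fmat_of_mat (2 ^ N) ((-\<i>) \<cdot>\<^sub>m (c (2 * k + 1) * c (2 * k + 2))) = pairop (2 * k) (2 * k + 1)"
      unfolding fmat_of_mat_smult[OF c_mult_carrier[OF pq]] fmat_of_mat_mult[OF c_carrier[OF pq(1)] c_carrier[OF pq(2)]]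
      by (simp add: pairop_def C_def)
    moreover have "foldl ?f (1\<^sub>m (2^N)) [1..<Suc k+1] = ?M * ((-\<i>) \<cdot>\<^sub>m (c (2 * k + 1) * c (2 * k + 2)))" by simp
    ultimately show ?case using M cc fmat_of_mat_mult[OF M(1) cc] by simp
  qed
  from this[of N] show "parity_op N c \<in> carrier_mat (2 ^ N) (2 ^ N)" "fmat_of_mat (2 ^ N) (parity_op N c) = parop N"
    unfolding parity_op_def by auto
qed

definition is_is_gs :: "(nat \<Rightarrow> nat \<Rightarrow> real) \<Rightarrow> real \<Rightarrow> fmat \<Rightarrow> bool" where
  "is_is_gs A s g \<longleftrightarrow> corner (2 ^ N) g \<and> iscol g \<and> norm g = 1 \<and> parop N * g = s *\<^sub>R g \<and>
    (\<exists>E. quadratic A * g = E *\<^sub>C g \<and> (\<forall>w \<mu>. corner (2 ^ N) w \<longrightarrow> iscol w \<longrightarrow> w \<noteq> 0 \<longrightarrow> parop N * w = s *\<^sub>R w \<longrightarrow>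
       quadratic A * w = \<mu> *\<^sub>C w \<longrightarrow> Re E \<le> Re \<mu>))"

text \<open>Minimality transfers because every competing column comes from a vector of the original
  type.\<close>

lemma ground_state_is_gs:
  assumes H: "H \<in> carrier_mat (2 ^ N) (2 ^ N)" "fmat_of_mat (2 ^ N) H = quadratic A"
    and g: "ground_state (2 ^ N) (parity_op N c) H \<sigma> g"
  shows "is_is_gs A ((-1) ^ \<sigma>) (fmat_of_vec (2 ^ N) g)"
proof -
  have d: "0 < (2::nat) ^ N" by simp
  have s: "(-1) ^ \<sigma> *\<^sub>C X = ((-1) ^ \<sigma> :: real) *\<^sub>R X" for X by (simp add: scC_of_real[symmetric])
  obtain E where gc: "g \<in> carrier_vec (2 ^ N)" "vnorm g = 1" "parity_op N c *\<^sub>v g = ((-1)^\<sigma>) \<cdot>\<^sub>v g" "H *\<^sub>v g = E \<cdot>\<^sub>v g"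
    and min: "\<And>w \<mu>. w \<in> carrier_vec (2 ^ N) \<Longrightarrow> w \<noteq> 0\<^sub>v (2 ^ N) \<Longrightarrow> parity_op N c *\<^sub>v w = ((-1)^\<sigma>) \<cdot>\<^sub>v w \<Longrightarrow> H *\<^sub>v w = \<mu> \<cdot>\<^sub>v w \<Longrightarrow> Re E \<le> Re \<mu>"
    using g unfolding ground_state_def by blast
  have "quadratic A * fmat_of_vec (2 ^ N) g = E *\<^sub>C fmat_of_vec (2 ^ N) g"
    using fmat_of_vec_mult[OF H(1) gc(1)] by (simp add: H(2) gc fmat_of_vec_smult)
  moreover have "parop N * fmat_of_vec (2 ^ N) g = (-1) ^ \<sigma> *\<^sub>R fmat_of_vec (2 ^ N) g"
    using fmat_of_vec_mult[OF fmat_of_mat_parity_op(1) gc(1)] by (simp add: fmat_of_mat_parity_op(2) gc fmat_of_vec_smult s)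
  moreover have "Re E \<le> Re \<mu>"
    if w: "corner (2 ^ N) w" "iscol w" "w \<noteq> 0" "parop N * w = (-1) ^ \<sigma> *\<^sub>R w" "quadratic A * w = \<mu> *\<^sub>C w" for w \<mu>
  proof -
    obtain x where x: "x \<in> carrier_vec (2 ^ N)" "fmat_of_vec (2 ^ N) x = w" using fmat_of_vec_surj[OF w(1,2)] by blast
    show ?thesis
    proof (rule min[OF x(1)])
      show "x \<noteq> 0\<^sub>v (2 ^ N)"
      proof
        assume "x = 0\<^sub>v (2 ^ N)"
        then have "fmat_of_vec (2 ^ N) x = 0" by (intro fmat_eqI) (auto simp: fmat_of_vec_def)
        then show False using x(2) w(3) by simp
      qed
      have "fmat_of_vec (2 ^ N) (parity_op N c *\<^sub>v x) = fmat_of_vec (2 ^ N) ((-1) ^ \<sigma> \<cdot>\<^sub>v x)"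
        using fmat_of_vec_mult[OF fmat_of_mat_parity_op(1) x(1)] by (simp add: fmat_of_mat_parity_op(2) fmat_of_vec_smult x w(4) s)
      then show "parity_op N c *\<^sub>v x = (-1) ^ \<sigma> \<cdot>\<^sub>v x"
        by (rule fmat_of_vec_inj[OF d, rotated 2]) (use x fmat_of_mat_parity_op(1) in auto)
      have "fmat_of_vec (2 ^ N) (H *\<^sub>v x) = fmat_of_vec (2 ^ N) (\<mu> \<cdot>\<^sub>v x)"
        using fmat_of_vec_mult[OF H(1) x(1)] by (simp add: H(2) fmat_of_vec_smult x w(5))
      then show "H *\<^sub>v x = \<mu> \<cdot>\<^sub>v x"
        by (rule fmat_of_vec_inj[OF d, rotated 2]) (use x H(1) in auto)
    qed
  qed
  ultimately show ?thesis unfolding is_is_gs_def using norm_fmat_of_vec[OF d gc(1)] gc(2) by auto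
qed

end

section \<open>Zero modes and annihilating modes of the perturbed chain\<close>

locale perturbed_chain = chain +
  fixes V :: "nat \<Rightarrow> nat \<Rightarrow> real" and \<epsilon> :: real
  assumes V: "real_antisym (2 * N) V" "op_norm (2 * N) V \<le> \<epsilon>" and eps0: "0 \<le> \<epsilon>" "\<epsilon> < 1/2"
begin

abbreviation "VS \<equiv> (\<lambda>i j. V (Suc i) (Suc j))"

lemma VS_asym: "i < 2 * N \<Longrightarrow> j < 2 * N \<Longrightarrow> VS i j = - VS j i"
proof -
  assume "i < 2 * N" "j < 2 * N"
  then have "Suc i \<in> {1..2*N}" "Suc j \<in> {1..2*N}" by auto
  then show "VS i j = - VS j i" using V(1) unfolding real_antisym_def by blast
qed

sublocale perturbation "2 * N" "hmat (2 * N) A0" "hmat (2 * N) VS" \<epsilon>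
proof
  show "adj (hmat (2 * N) A0) = hmat (2 * N) A0" by (rule adj_hmat) (rule A0_asym)
  show "adj (hmat (2 * N) VS) = hmat (2 * N) VS" by (rule adj_hmat) (rule VS_asym)
  have "hmat (2 * N) VS = \<i> *\<^sub>C mk (2 * N) (\<lambda>i j. complex_of_real (VS i j))"
    by (rule fmat_eqI) (auto simp: hmat_def)
  then show "opnorm_le (hmat (2 * N) VS) \<epsilon>" using opnorm_le_scC[OF op_norm_opnorm_le[OF V(2) eps0(1)], of \<i>] by simp
qed (use eps0 in \<open>auto simp: hmat_A0_cube cnjm_hmat\<close>)

definition As :: "real \<Rightarrow> nat \<Rightarrow> nat \<Rightarrow> real" where "As s i j = A0 i j + s * VS i j"

lemma asym_As: "asym (As s)"
  unfolding asym_def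
proof (intro allI impI)
  fix i j assume "i < 2 * N" "j < 2 * N"
  then show "As s i j = - As s j i" using A0_asym[of i j] VS_asym[of i j] by (simp add: As_def)
qed

lemma h_As: "h s = hmat (2 * N) (As s)"
  unfolding h_def by (rule fmat_eqI) (auto simp: hmat_def As_def algebra_simps)

lemma eigen_entries:
  assumes "h s * x = complex_of_real \<mu> *\<^sub>C x" "i < 2 * N"
  shows "(\<Sum>k<2*N. \<i> * complex_of_real (As s i k) * ent x k j) = complex_of_real \<mu> * ent x i j"
proof -
  have "ent (h s * x) i j = complex_of_real \<mu> * ent x i j" using assms(1) by simp
  then show ?thesis using assms(2) unfolding h_As ent_mult_left[OF corner_hmat] by (simp add: hmat_def)
qed

text \<open>If no eigenvalue were within \<open>s * \<epsilon>\<close> of 0, all would have modulus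
  at least \<open>1 - s * \<epsilon>\<close>. But the basis vector of the end index 0 lies in the
  kernel of the unperturbed matrix, so \<open>h s\<close> shrinks it to length at most
  \<open>s * \<epsilon>\<close>, which is smaller.\<close>

lemma low_mode:
  assumes "s \<in> {0..1}"
  obtains \<mu> where "\<mu> \<in> spec (2 * N) (h s)" "\<bar>\<mu>\<bar> \<le> s * \<epsilon>"
proof (rule ccontr)
  assume "\<not> thesis"
  then have no: "s * \<epsilon> < \<bar>\<mu>\<bar>" if "\<mu> \<in> spec (2 * N) (h s)" for \<mu> using that \<open>\<And>\<mu>. _ \<Longrightarrow> _ \<Longrightarrow> thesis\<close> by force
  have se: "s * \<epsilon> \<le> \<epsilon>" "0 \<le> s * \<epsilon>" using assms eps0 by (auto simp: mult_left_le_one_le)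
  define \<delta> where "\<delta> = 1 - s * \<epsilon>"
  have \<delta>: "0 < \<delta>" "s * \<epsilon> < \<delta>" using se eps0 unfolding \<delta>_def by linarith+
  have far: "\<delta> \<le> cmod (0 - complex_of_real \<mu>)" if \<mu>: "\<mu> \<in> spec (2 * N) (h s)" for \<mu>
  proof -
    obtain k :: real where "k \<in> {-1, 0, 1}" "\<bar>\<mu> - k\<bar> \<le> 1/2 - (1/2 - s * \<epsilon>)"
      using gapped_h[OF assms] \<mu> unfolding gapped_def by blast
    then show ?thesis using no[OF \<mu>] by (auto simp: \<delta>_def abs_if split: if_splits)
  qed
  let ?R = "res (2 * N) (h s) 0"
  have R: "is_res (2 * N) (h s) 0 ?R" "opnorm_le ?R (1 / \<delta>)"
    using res_spectral[OF h(1,2) \<delta>(1) far] by auto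
  define X where "X = diag (2 * N) (\<lambda>i. if i = 0 then 1 else 0)"
  have "ent X 0 0 = 1" using N by (simp add: X_def)
  then have "X \<noteq> 0" by auto
  then have X: "corner (2 * N) X" "X \<noteq> 0" by (simp_all add: X_def)
  have "hmat (2 * N) A0 * X = 0"
  proof (rule corner_eqI[of "2 * N"])
    fix i j assume "i < 2 * N" "j < 2 * N"
    show "ent (hmat (2 * N) A0 * X) i j = ent 0 i j"
      unfolding ent_mult_left[OF corner_hmat] by (auto simp: X_def hmat_def A0_alt intro!: sum.neutral)
  qed (use X in auto)
  then have "h s * X = s *\<^sub>R (hmat (2 * N) VS * X)" by (simp add: h_def distrib_right)
  then have hX: "norm (h s * X) \<le> s * (\<epsilon> * norm X)"
    using assms opbD[OF v(4), of X] by (simp add: mult_left_mono)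
  have "X = - (?R * (h s * X))"
  proof -
    have "?R * (- h s) = idmat (2 * N)" using R(1) by (simp add: is_res_def)
    then have "?R * (- h s) * X = X" using X by simp
    then show ?thesis by (simp add: mult.assoc)
  qed
  then have "norm X = norm (?R * (h s * X))" by (metis norm_minus_cancel)
  also have "\<dots> \<le> 1 / \<delta> * norm (h s * X)" by (rule opbD[OF R(2)])
  also have "\<dots> \<le> 1 / \<delta> * (s * (\<epsilon> * norm X))" using \<delta> by (intro mult_left_mono hX) auto
  also have "\<dots> = (s * \<epsilon> / \<delta>) * norm X" by simp
  also have "\<dots> < 1 * norm X" using X \<delta> by (intro mult_strict_right_mono) auto
  finally show False by simp
qed

text \<open>Component \<open>p\<close> of the matrix \<open>A\<close> applied to the vector of
  Majorana operators. The rows of \<open>P s\<close>, unlike a choice of eigenvectors, give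
  operators known to be differentiable in \<open>s\<close>.\<close>

definition row_op :: "nat \<Rightarrow> fmat \<Rightarrow> fmat" where "row_op p A = lin (\<lambda>q. ent A p q)"

text \<open>Row \<open>p\<close> of \<open>P s\<close> combines conjugates of eigenvectors with
  eigenvalues \<open>l k\<close> near 1. Since \<open>h s\<close> changes sign under conjugation,
  these are modes of energy \<open>- l k\<close>, and \<open>l k\<close> is at least
  \<open>1 - s * \<epsilon>\<close>, more than the modulus of the low mode, as
  \<open>ground_state_annihilated\<close> requires.\<close>

lemma is_is_gs_annihilated:
  assumes s: "s \<in> {0..1}" and g: "is_is_gs (As s) \<sigma> g" and p: "p < 2 * N"
  shows "row_op p (P s) * g = 0"
proof -
  obtain W l where Wl: "diagonalizes (2 * N) (h s) W l" using diagonalizes_ex h by blast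
  note W = Wl[unfolded diagonalizes_def]
  define ch where "ch = (\<lambda>i. if \<bar>l i - 1\<bar> < 1/2 then 1 else 0 :: complex)"
  have P: "P s = W * diag (2 * N) ch * adj W"
    unfolding ch_def P_def by (rule riesz_spectral[OF gapped_h[OF s] Wl])
  have se: "s * \<epsilon> \<le> \<epsilon>" "0 \<le> s * \<epsilon>" using s eps0 by (auto simp: mult_left_le_one_le)
  obtain \<mu> where \<mu>: "\<mu> \<in> spec (2 * N) (h s)" "\<bar>\<mu>\<bar> \<le> s * \<epsilon>" using low_mode[OF s] by blast
  then obtain x where x: "corner (2 * N) x" "x \<noteq> 0" "h s * x = complex_of_real \<mu> *\<^sub>C x" unfolding spec_def by blast
  then obtain i0 j0 where ij: "ent x i0 j0 \<noteq> 0" by (metis ent_0 fmat_eqI)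
  then have i0: "i0 < 2 * N" using x(1) unfolding corner_def by (metis not_le)
  obtain E where gE: "quadratic (As s) * g = E *\<^sub>C g"
    and gmin: "\<And>w \<mu>. corner (2 ^ N) w \<Longrightarrow> iscol w \<Longrightarrow> w \<noteq> 0 \<Longrightarrow> parop N * w = \<sigma> *\<^sub>R w \<Longrightarrow> quadratic (As s) * w = \<mu> *\<^sub>C w \<Longrightarrow> Re E \<le> Re \<mu>"
    using g unfolding is_is_gs_def by blast
  have hW: "h s * W = W * diag (2 * N) (\<lambda>i. complex_of_real (l i))"
  proof -
    have "h s * W = W * diag (2 * N) (\<lambda>i. complex_of_real (l i)) * (adj W * W)" using W by (simp add: mult.assoc)
    then show ?thesis using W by simp
  qed
  have zero: "lin (\<lambda>q. cnj (ent W q k)) * g = 0" if k: "k < 2 * N" "\<bar>l k - 1\<bar> < 1/2" for k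
  proof (rule ground_state_annihilated[OF asym_As, where l = "- l k" and y = "\<lambda>q. ent x q j0" and ?l0.0 = \<mu> and s = "complex_of_real \<sigma>" and E = E])
    fix j assume j: "j < 2 * N"
    have "ent (h s * W) j k = complex_of_real (l k) * ent W j k"
    proof -
      have "ent (W * diag (2 * N) (\<lambda>i. complex_of_real (l i))) j k = (\<Sum>m<2*N. if m = k then ent W j m * complex_of_real (l m) else 0)"
        unfolding ent_mult_right[OF corner_diag] by (intro sum.cong refl) auto
      then show ?thesis using k hW by simp
    qed
    then have "(\<Sum>m<2*N. \<i> * complex_of_real (As s j m) * ent W m k) = complex_of_real (l k) * ent W j k"
      unfolding h_As ent_mult_left[OF corner_hmat] using j by (simp add: hmat_def)
    from arg_cong[OF this, of cnj]
    have "- (\<Sum>m<2*N. \<i> * complex_of_real (As s j m) * cnj (ent W m k)) = complex_of_real (l k) * cnj (ent W j k)"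
      by (simp add: sum_negf)
    then show "(\<Sum>m<2*N. \<i> * complex_of_real (As s j m) * cnj (ent W m k)) = complex_of_real (- l k) * cnj (ent W j k)"
      by (simp add: neg_eq_iff_add_eq_0 add_eq_0_iff)
    show "(\<Sum>m<2*N. \<i> * complex_of_real (As s j m) * ent x m j0) = complex_of_real \<mu> * ent x j j0"
      by (rule eigen_entries[OF x(3) j])
  next
    have "l k \<in> spec (2 * N) (h s)" using W k by blast
    then obtain b :: real where "b \<in> {-1, 0, 1}" "\<bar>l k - b\<bar> \<le> 1/2 - (1/2 - s * \<epsilon>)"
      using gapped_h[OF s] unfolding gapped_def by blast
    then show "\<bar>\<mu>\<bar> < - (- l k)" using k(2) \<mu>(2) se eps0 by (auto simp: abs_if split: if_splits)
  qed (use g gE gmin ij i0 in \<open>auto simp: is_is_gs_def scC_of_real\<close>)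
  have "ent (P s) p q = (\<Sum>k<2*N. ent W p k * ch k * cnj (ent W q k))" for q
  proof -
    have "ent (P s) p q = (\<Sum>k<2*N. ent W p k * ent (diag (2 * N) ch * adj W) k q)"
      unfolding P mult.assoc using W by (intro ent_mult_left) blast
    then show ?thesis by (simp add: ent_diag_mult mult.assoc)
  qed
  then have "row_op p (P s) = (\<Sum>q<2*N. \<Sum>k<2*N. (ent W p k * ch k * cnj (ent W q k)) *\<^sub>C C q)"
    by (simp add: row_op_def lin_def scC_sum_left)
  also have "\<dots> = (\<Sum>k<2*N. (ent W p k * ch k) *\<^sub>C lin (\<lambda>q. cnj (ent W q k)))"
    by (subst sum.swap) (simp add: lin_def scC_sum_right)
  finally have "row_op p (P s) * g = (\<Sum>k<2*N. (ent W p k * ch k) *\<^sub>C (lin (\<lambda>q. cnj (ent W q k)) * g))"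
    by (simp add: sum_distrib_right)
  also have "\<dots> = 0" by (intro sum.neutral ballI) (auto simp: ch_def zero)
  finally show ?thesis .
qed

text \<open>On the eigenvalues -1, 0, 1 the polynomial \<open>(l^2 + l) / 2\<close> is the indicator
  of 1.\<close>

lemma P_zero: "P 0 = (1/2) *\<^sub>R (hmat (2 * N) A0 * hmat (2 * N) A0 + hmat (2 * N) A0)"
proof -
  let ?h = "hmat (2 * N) A0"
  have h0_eq: "h 0 = ?h" by (simp add: h_def)
  obtain W l where Wl: "diagonalizes (2 * N) ?h W l" using diagonalizes_ex[OF h0(1,2)] by blast
  note W = Wl[unfolded diagonalizes_def]
  let ?D = "diag (2 * N) (\<lambda>i. complex_of_real (l i))"
  have hW: "?h = W * ?D * adj W" using W by blast
  have "W * ?D * adj W * (W * ?D * adj W) = W * ?D * (adj W * W) * ?D * adj W" by (simp only: mult.assoc)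
  also have "\<dots> = W * (?D * ?D) * adj W" using W by (simp add: mult.assoc)
  finally have hh: "?h * ?h = W * (?D * ?D) * adj W" using hW by metis
  have "P 0 = W * diag (2 * N) (\<lambda>i. if \<bar>l i - 1\<bar> < 1/2 then 1 else 0) * adj W"
    unfolding P_def h0_eq by (rule riesz_spectral[OF _ Wl]) (use gapped_h[of 0] h0_eq in simp)
  also have "diag (2 * N) (\<lambda>i. if \<bar>l i - 1\<bar> < 1/2 then 1 else 0) = (1/2) *\<^sub>R (?D * ?D + ?D)"
  proof (rule fmat_eqI)
    fix i j
    have "l i = -1 \<or> l i = 0 \<or> l i = 1" if "i < 2 * N" using spec_h0[of "l i"] W that by auto
    then show "ent (diag (2 * N) (\<lambda>i. if \<bar>l i - 1\<bar> < 1/2 then 1 else 0)) i j = ent ((1/2) *\<^sub>R (?D * ?D + ?D)) i j"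
      unfolding diag_mult_diag by auto
  qed
  also have "W * \<dots> * adj W = (1/2) *\<^sub>R (W * (?D * ?D) * adj W + W * ?D * adj W)"
    by (simp add: distrib_left distrib_right)
  finally show ?thesis using hh hW by metis
qed

text \<open>Row \<open>2 j + 1\<close> of \<open>P 0\<close> is half of
  \<open>C (2 j + 1) + i C (2 j + 2)\<close>; multiplying the annihilation condition by
  \<open>C (2 j + 1)\<close> turns it into the fixed point equation.\<close>

lemma pair_fixed:
  assumes "\<And>p. p < 2 * N \<Longrightarrow> row_op p (P 0) * X = 0" "corner (2 ^ N) X" "j < N - 1"
  shows "pairop (2 * j + 1) (2 * j + 2) * X = X"
proof -
  have p: "2 * j + 1 < 2 * N" "2 * j + 2 < 2 * N" using assms(3) by auto
  have "row_op (2 * j + 1) (P 0) = (\<Sum>q<2*N. (if q = 2 * j + 1 then (1/2) *\<^sub>C C q else 0) + (if q = 2 * j + 2 then (\<i>/2) *\<^sub>C C q else 0))"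
    unfolding row_op_def lin_def
  proof (rule sum.cong[OF refl])
    fix q assume "q \<in> {..<2*N}"
    then show "ent (P 0) (2 * j + 1) q *\<^sub>C C q = (if q = 2 * j + 1 then (1/2) *\<^sub>C C q else 0) + (if q = 2 * j + 2 then (\<i>/2) *\<^sub>C C q else 0)"
      unfolding P_zero hmat_A0_sq using p assms(3) by (auto simp: hmat_def A0_def)
  qed
  also have "\<dots> = (1/2) *\<^sub>C C (2 * j + 1) + (\<i>/2) *\<^sub>C C (2 * j + 2)" using p by (simp add: sum.distrib)
  finally have "(1/2) *\<^sub>C (C (2 * j + 1) * X) + (\<i>/2) *\<^sub>C (C (2 * j + 2) * X) = 0"
    using assms(1)[OF p(1)] by (simp add: distrib_right)
  then have "C (2 * j + 1) * ((1/2) *\<^sub>C (C (2 * j + 1) * X) + (\<i>/2) *\<^sub>C (C (2 * j + 2) * X)) = 0" by simp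
  then have "(1/2) *\<^sub>C (C (2 * j + 1) * C (2 * j + 1) * X) + (\<i>/2) *\<^sub>C (C (2 * j + 1) * C (2 * j + 2) * X) = 0"
    by (simp add: distrib_left mult.assoc)
  then have "2 *\<^sub>C ((1/2) *\<^sub>C X + (\<i>/2) *\<^sub>C (C (2 * j + 1) * C (2 * j + 2) * X)) = 0"
    unfolding C_sq[OF p(1)] using assms(2) by simp
  then have "X + \<i> *\<^sub>C (C (2 * j + 1) * C (2 * j + 2) * X) = 0" by (simp add: scC_add_right)
  then have "- (\<i> *\<^sub>C (C (2 * j + 1) * C (2 * j + 2) * X)) = X" by (simp add: add_eq_0_iff)
  then show ?thesis by (simp add: pairop_def)
qed

section \<open>The flow from the perturbed to the unperturbed chain\<close>

definition Dm :: "real \<Rightarrow> nat \<Rightarrow> nat \<Rightarrow> real" where "Dm u i j = Re (ent (K (1 - u)) i j)"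
definition L :: "real \<Rightarrow> fmat" where "L u = \<i> *\<^sub>C quadratic (Dm u)"

lemma ent_K: "ent (K (1 - u)) i j = complex_of_real (Dm u i j)"
  using arg_cong[OF cnjm_K, of "\<lambda>A. ent A i j" "1 - u"] by (auto simp: complex_eq_iff Dm_def)

lemma Dm_antisym: "u \<in> {0..1} \<Longrightarrow> Dm u i j = - Dm u j i"
  using arg_cong[OF adj_K, of "1 - u" "\<lambda>A. ent A j i"] by (simp add: Dm_def complex_eq_iff)

lemma asym_Dm: "u \<in> {0..1} \<Longrightarrow> asym (Dm u)"
  unfolding asym_def using Dm_antisym by blast

lemma adj_L: "u \<in> {0..1} \<Longrightarrow> adj (L u) = - L u"
  unfolding L_def adj_scC adj_quadratic[OF asym_Dm] by simp

lemma corner_L [simp]: "corner (2 ^ N) (L u)" by (simp add: L_def)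

lemma parity_L: "parop N * L u = L u * parop N"
  by (simp add: L_def parity_quadratic)

lemma row_op_sum: "row_op p A = (\<Sum>q<2*N. ent A p q *\<^sub>C C q)" by (simp add: row_op_def lin_def)

lemma bounded_linear_row_op: "bounded_linear (row_op p)"
  unfolding row_op_sum[abs_def]
  by (intro bounded_linear_sum bounded_linear_compose[OF bounded_linear_scC_left bounded_linear_ent])

lemma row_op_mult: assumes "corner (2 * N) B" shows "row_op p (B * A) = (\<Sum>q<2*N. ent B p q *\<^sub>C row_op q A)"
proof -
  have "row_op p (B * A) = (\<Sum>m<2*N. \<Sum>q<2*N. (ent B p q * ent A q m) *\<^sub>C C m)"
    unfolding row_op_sum ent_mult_left[OF assms] scC_sum_left ..
  also have "\<dots> = (\<Sum>q<2*N. \<Sum>m<2*N. (ent B p q * ent A q m) *\<^sub>C C m)" by (rule sum.swap)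
  finally show ?thesis by (simp add: row_op_sum scC_sum_right)
qed

text \<open>Commuting \<open>L u\<close> with the vector of Majorana operators applies
  \<open>K (1 - u)\<close> to that vector; the coefficient matrix \<open>A\<close> stays on its
  left.\<close>

lemma row_op_L:
  assumes "u \<in> {0..1}" "corner (2 * N) A"
  shows "row_op p A * L u = L u * row_op p A - row_op p (A * K (1 - u))"
proof -
  have CL: "C k * L u = L u * C k - row_op k (K (1 - u))" if "k < 2 * N" for k
    using quadratic_comm[OF asym_Dm[OF assms(1)] that] by (simp add: L_def row_op_sum ent_K scC_of_real)
  have "row_op p A * L u = (\<Sum>q<2*N. ent A p q *\<^sub>C (C q * L u))" by (simp add: row_op_sum sum_distrib_right)
  also have "\<dots> = (\<Sum>q<2*N. ent A p q *\<^sub>C (L u * C q)) - (\<Sum>q<2*N. ent A p q *\<^sub>C row_op q (K (1 - u)))"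
    by (simp add: CL scC_diff_right sum_subtractf)
  also have "(\<Sum>q<2*N. ent A p q *\<^sub>C (L u * C q)) = L u * row_op p A" by (simp add: row_op_sum sum_distrib_left)
  finally show ?thesis by (simp add: row_op_mult[OF assms(2)])
qed

lemma P_reverse_deriv:
  assumes "u \<in> {0..1}"
  shows "((\<lambda>u. P (1 - u)) has_vector_derivative (- P' (1 - u))) (at u within {0..1})"
proof -
  have "((P \<circ> (\<lambda>u. 1 - u)) has_vector_derivative ((-1) *\<^sub>R P' (1 - u))) (at u within {0..1})"
  proof (rule vector_diff_chain_within)
    show "((\<lambda>u. 1 - u) has_vector_derivative -1) (at u within {0..1})"
      by (auto intro!: derivative_eq_intros)
    have "(\<lambda>u::real. 1 - u) ` {0..1} = {0..1}" by (auto simp: image_iff intro!: bexI[of _ "1 - _"])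
    then show "(P has_vector_derivative P' (1 - u)) (at (1 - u) within (\<lambda>u. 1 - u) ` {0..1})"
      using P_deriv[of "1 - u"] assms by simp
  qed
  then show ?thesis by (simp add: o_def)
qed

text \<open>\<open>\<psi>\<close>, its parity defect \<open>w\<close> and the vectors
  \<open>z p\<close> all satisfy equations covered by \<open>norm_conserved\<close>. The latter two
  start at zero, so parity and annihilation persist to the end of the flow.\<close>

lemma flow:
  assumes \<psi>: "\<And>u. u \<in> {0..1} \<Longrightarrow> (\<psi> has_vector_derivative (L u * \<psi> u)) (at u within {0..1})"
    and g: "is_is_gs (As 1) \<sigma> (\<psi> 0)"
  shows "norm (\<psi> 1) = 1" "parop N * \<psi> 1 = \<sigma> *\<^sub>R \<psi> 1" "\<And>p. p < 2 * N \<Longrightarrow> row_op p (P 0) * \<psi> 1 = 0"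
proof -
  have cons: "norm (w 1) = norm (w 0)"
    if "\<And>u. u \<in> {0..1} \<Longrightarrow> (w has_vector_derivative (L u * w u)) (at u within {0..1})" for w
  proof -
    have "(\<Sum>p\<in>{()}. (norm (w 1))\<^sup>2) = (\<Sum>p\<in>{()}. (norm (w 0))\<^sup>2)"
      by (rule norm_conserved[where L = L and k = "\<lambda>_ _ _. 0"]) (use that adj_L in auto)
    then show ?thesis by simp
  qed
  show "norm (\<psi> 1) = 1" using cons[OF \<psi>] g by (simp add: is_is_gs_def)
  define w where "w u = parop N * \<psi> u - \<sigma> *\<^sub>R \<psi> u" for u
  have "(w has_vector_derivative (L u * w u)) (at u within {0..1})" if u: "u \<in> {0..1}" for u
  proof -
    have "(w has_vector_derivative (parop N * (L u * \<psi> u) - \<sigma> *\<^sub>R (L u * \<psi> u))) (at u within {0..1})"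
      unfolding w_def[abs_def]
      by (intro has_vector_derivative_diff bounded_linear.has_vector_derivative[OF bounded_linear_mult_right \<psi>[OF u]]
          bounded_linear.has_vector_derivative[OF bounded_linear_scaleR_right \<psi>[OF u]])
    moreover have "parop N * (L u * \<psi> u) = L u * (parop N * \<psi> u)"
      using parity_L[of u] by (simp add: mult.assoc[symmetric])
    ultimately show ?thesis by (simp add: w_def right_diff_distrib)
  qed
  from cons[OF this] have "w 1 = 0" using g by (simp add: w_def is_is_gs_def)
  then show "parop N * \<psi> 1 = \<sigma> *\<^sub>R \<psi> 1" by (simp add: w_def)
  define z where "z p u = row_op p (P (1 - u)) * \<psi> u" for p u
  have "(z p has_vector_derivative (L u * z p u + (\<Sum>q<2*N. (- Dm u p q) *\<^sub>R z q u))) (at u within {0..1})"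
    if u: "u \<in> {0..1}" for p u
  proof -
    let ?P = "P (1 - u)" and ?K = "K (1 - u)"
    have u': "1 - u \<in> {0..1}" using u by auto
    have "(z p has_vector_derivative (row_op p ?P * (L u * \<psi> u) + row_op p (- P' (1 - u)) * \<psi> u)) (at u within {0..1})"
      unfolding z_def[abs_def]
      by (intro has_vector_derivative_mult \<psi>[OF u] bounded_linear.has_vector_derivative[OF bounded_linear_row_op P_reverse_deriv[OF u]])
    moreover have "row_op p ?P * (L u * \<psi> u) = L u * z p u - row_op p (?P * ?K) * \<psi> u"
      using row_op_L[OF u P_proj(1)[OF u'], of p] by (simp add: z_def mult.assoc[symmetric] left_diff_distrib)
    \<comment> \<open>The term with \<open>P K\<close> cancels the one from commuting
      \<open>L u\<close> to the left; what remains couples the \<open>z q\<close> among themselves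
      with antisymmetric coefficients.\<close>
    moreover have "row_op p (- P' (1 - u)) = row_op p (?P * ?K) - row_op p (?K * ?P)"
      unfolding K_commutator[OF u', symmetric]
      by (simp add: linear_diff[OF bounded_linear.linear[OF bounded_linear_row_op]])
    moreover have "row_op p (?K * ?P) * \<psi> u = (\<Sum>q<2*N. Dm u p q *\<^sub>R z q u)"
      unfolding row_op_mult[OF corner_K[OF u']] by (simp add: z_def ent_K scC_of_real sum_distrib_right)
    ultimately show ?thesis by (simp add: left_diff_distrib sum_negf)
  qed
  note z = this
  have "(\<Sum>p<2*N. (norm (z p 1))\<^sup>2) = (\<Sum>p<2*N. (norm (z p 0))\<^sup>2)"
  proof (rule norm_conserved[where L = L and k = "\<lambda>u p q. - Dm u p q"])
    show "- Dm u p q = - (- Dm u q p)" if "u \<in> {0..1}" for u p q using Dm_antisym[OF that, of p q] by simp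
  qed (use z adj_L in auto)
  also have "\<dots> = 0" using is_is_gs_annihilated[OF _ g] by (simp add: z_def)
  finally have "\<forall>p<2*N. z p 1 = 0" by (simp add: sum_nonneg_eq_0_iff)
  then show "\<And>p. p < 2 * N \<Longrightarrow> row_op p (P 0) * \<psi> 1 = 0" by (simp add: z_def)
qed

abbreviation "Dmat u \<equiv> (\<lambda>p q. Dm u (p - 1) (q - 1))"

lemma L_quad_op: "L u = \<i> *\<^sub>C fmat_of_mat (2 ^ N) (quad_op N c (Dmat u))"
  unfolding fmat_of_mat_quad_op L_def by simp

lemma continuous_L: "continuous_on {0..1} (\<lambda>u. ent (L u) i j)"
proof -
  have Kc: "continuous_on {0..1} (\<lambda>u. K (1 - u))"
    by (rule continuous_on_compose2[OF K_continuous]) (auto intro!: continuous_intros)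
  have "continuous_on {0..1} (\<lambda>u. Dm u a b)" for a b
    unfolding Dm_def
    by (intro continuous_on_Re continuous_on_compose2[OF linear_continuous_on[OF bounded_linear_ent] Kc]) auto
  then show ?thesis unfolding L_def quadratic_def ent_scC ent_sum ent_scaleR
    by (intro continuous_intros)
qed

text \<open>A single \<open>U\<close> serves both sectors, as the generator does not depend on the
  parity. In each sector \<open>U 1\<close> maps the perturbed ground state to a unit vector
  satisfying the conditions of \<open>unique_ground_state\<close>, so it differs from
  \<open>g\<close> by a factor of modulus 1.\<close>

lemma evolution:
  assumes g: "\<And>\<sigma>. \<sigma> \<in> {0,1} \<Longrightarrow> ground_state (2^N) (parity_op N c) (H0_op N c) \<sigma> (g \<sigma>)"
    and gt: "\<And>\<sigma>. \<sigma> \<in> {0,1} \<Longrightarrow> ground_state (2^N) (parity_op N c) (H0_op N c + quad_op N c V) \<sigma> (gt \<sigma>)"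
  shows "\<exists>U. solves_TO_ode (2^N) (\<lambda>u. quad_op N c (Dmat u)) U \<and>
    (\<forall>\<sigma>\<in>{0::nat,1}. \<exists>\<theta>::real. g \<sigma> = exp (\<i> * complex_of_real \<theta>) \<cdot>\<^sub>v (U 1 *\<^sub>v gt \<sigma>))"
proof -
  let ?d = "2 ^ N :: nat"
  obtain U0 where U0: "\<And>i j. i < ?d \<Longrightarrow> j < ?d \<Longrightarrow> U0 0 i j = (if i = j then 1 else 0)"
    "\<And>u i j. u \<in> {0..1} \<Longrightarrow> i < ?d \<Longrightarrow> j < ?d \<Longrightarrow>
        ((\<lambda>t. U0 t i j) has_vector_derivative (\<Sum>k<?d. ent (L u) i k * U0 u k j)) (at u within {0..1})"
    using linear_ode_exists[of ?d "\<lambda>u. ent (L u)"] continuous_L by blast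
  define U where "U u = mat ?d ?d (\<lambda>(i, j). U0 u i j)" for u
  have Uc: "U u \<in> carrier_mat ?d ?d" for u by (simp add: U_def)
  have U_ent: "U u $$ (i, j) = U0 u i j" if "i < ?d" "j < ?d" for u i j using that by (simp add: U_def)
  have rhs: "(\<i> \<cdot>\<^sub>m (quad_op N c (Dmat u) * U u)) $$ (a, b) = (\<Sum>k<?d. ent (L u) a k * U0 u k b)"
    if "a < ?d" "b < ?d" for u a b
  proof -
    have "(\<Sum>k<?d. ent (L u) a k * U0 u k b) = (\<Sum>k<?d. \<i> * (quad_op N c (Dmat u) $$ (a, k) * U u $$ (k, b)))"
      unfolding L_quad_op using that by (intro sum.cong refl) (simp add: fmat_of_mat_def U_ent)
    then show ?thesis using that Uc[of u] quad_op_carrier[of "Dmat u"]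
      by (simp add: scalar_prod_def atLeast0LessThan sum_distrib_left)
  qed
  have ode: "solves_TO_ode ?d (\<lambda>u. quad_op N c (Dmat u)) U"
    unfolding solves_TO_ode_def
  proof (intro conjI ballI allI impI)
    show "U 0 = 1\<^sub>m ?d" by (rule eq_matI) (auto simp: U_def U0(1))
    fix u :: real and a b assume u: "u \<in> {0..1}"
    show "U u \<in> carrier_mat ?d ?d" by (rule Uc)
    assume ab: "a < ?d" "b < ?d"
    show "((\<lambda>t. U t $$ (a, b)) has_vector_derivative (\<i> \<cdot>\<^sub>m (quad_op N c (Dmat u) * U u)) $$ (a, b)) (at u within {0..1})"
      unfolding rhs[OF ab] U_ent[OF ab] by (rule U0(2)[OF u ab])
  qed
  have FU: "((\<lambda>u. fmat_of_mat ?d (U u)) has_vector_derivative (L u * fmat_of_mat ?d (U u))) (at u within {0..1})" if u: "u \<in> {0..1}" for u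
  proof -
    have "((\<lambda>u. mk ?d (U0 u)) has_vector_derivative mk ?d (\<lambda>i j. \<Sum>k<?d. ent (L u) i k * U0 u k j)) (at u within {0..1})"
      by (rule has_vector_derivative_mk) (rule U0(2)[OF u])
    moreover have "fmat_of_mat ?d (U t) = mk ?d (U0 t)" for t by (rule fmat_eqI) (simp add: fmat_of_mat_def U_ent)
    moreover have "mk ?d (\<lambda>i j. \<Sum>k<?d. ent (L u) i k * U0 u k j) = L u * mk ?d (U0 u)"
      by (rule corner_eqI[of ?d]) (simp_all add: ent_mult_left[OF corner_L])
    ultimately show ?thesis by simp
  qed
  have "\<exists>\<theta>::real. g \<sigma> = exp (\<i> * complex_of_real \<theta>) \<cdot>\<^sub>v (U 1 *\<^sub>v gt \<sigma>)" if \<sigma>: "\<sigma> \<in> {0,1}" for \<sigma>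
  proof -
    let ?s = "(-1) ^ \<sigma> :: real" and ?g = "fmat_of_vec ?d (g \<sigma>)" and ?gt = "fmat_of_vec ?d (gt \<sigma>)"
    have As: "As 0 = A0" "fmat_of_mat ?d (H0_op N c + quad_op N c V) = quadratic (As 1)"
    proof -
      show "As 0 = A0" by (intro ext) (simp add: As_def)
      have "quadratic A0 + quadratic VS = quadratic (As 1)"
        by (simp add: quadratic_def As_def scaleR_left_distrib sum.distrib scC_add_right)
      then show "fmat_of_mat ?d (H0_op N c + quad_op N c V) = quadratic (As 1)"
        using fmat_of_mat_add[OF H0_op_carrier quad_op_carrier] by (simp add: fmat_of_mat_H0_op fmat_of_mat_quad_op)
    qed
    have is_is_gs_g: "is_is_gs (As 0) ?s ?g"
      unfolding As by (rule ground_state_is_gs[OF H0_op_carrier fmat_of_mat_H0_op g[OF \<sigma>]])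
    have is_is_gs_gt: "is_is_gs (As 1) ?s ?gt"
      by (rule ground_state_is_gs[OF _ As(2) gt[OF \<sigma>]]) (simp add: H0_op_carrier quad_op_carrier)
    have car: "g \<sigma> \<in> carrier_vec ?d" "gt \<sigma> \<in> carrier_vec ?d"
      using g[OF \<sigma>] gt[OF \<sigma>] by (simp_all add: ground_state_def)
    define \<psi> where "\<psi> u = fmat_of_mat ?d (U u) * ?gt" for u
    have \<psi>: "(\<psi> has_vector_derivative (L u * \<psi> u)) (at u within {0..1})" if "u \<in> {0..1}" for u
      unfolding \<psi>_def[abs_def] mult.assoc[symmetric]
      by (rule bounded_linear.has_vector_derivative[OF bounded_linear_mult_left FU[OF that]])
    have "fmat_of_mat ?d (U 0) = idmat ?d" by (rule fmat_eqI) (auto simp: fmat_of_mat_def U_ent U0(1))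
    then have "\<psi> 0 = ?gt" by (simp add: \<psi>_def)
    then have fl: "norm (\<psi> 1) = 1" "parop N * \<psi> 1 = ?s *\<^sub>R \<psi> 1" "\<And>p. p < 2 * N \<Longrightarrow> row_op p (P 0) * \<psi> 1 = 0"
      using flow[OF \<psi>, of ?s] is_is_gs_gt by simp_all
    have c\<psi>: "corner ?d (\<psi> 1)" "iscol (\<psi> 1)" by (auto simp: \<psi>_def)
    have "\<exists>a. ?g = a *\<^sub>C \<psi> 1"
    proof (rule unique_ground_state[where s = ?s])
      show "pairop (2 * j + 1) (2 * j + 2) * ?g = ?g" if "j < N - 1" for j
        by (rule pair_fixed[OF is_is_gs_annihilated[OF _ is_is_gs_g] _ that]) auto
      show "pairop (2 * j + 1) (2 * j + 2) * \<psi> 1 = \<psi> 1" if "j < N - 1" for j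
        by (rule pair_fixed[OF fl(3) c\<psi>(1) that])
      show "?s * ?s = 1" by (simp flip: power_mult_distrib)
    qed (use N fl c\<psi> is_is_gs_g in \<open>auto simp: is_is_gs_def\<close>)
    then obtain a where a: "?g = a *\<^sub>C \<psi> 1" by blast
    have "norm ?g = 1" using is_is_gs_g by (simp add: is_is_gs_def)
    then have "cmod a = 1" using fl(1) unfolding a by simp
    then obtain t where t: "a = exp (\<i> * complex_of_real t)" using complex_norm_eq_1_exp by metis
    have "\<psi> 1 = fmat_of_vec ?d (U 1 *\<^sub>v gt \<sigma>)" unfolding \<psi>_def using fmat_of_vec_mult[OF Uc car(2)] by simp
    then have "fmat_of_vec ?d (g \<sigma>) = fmat_of_vec ?d (a \<cdot>\<^sub>v (U 1 *\<^sub>v gt \<sigma>))"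
      using a Uc[of 1] car(2) by (subst fmat_of_vec_smult) auto
    then have "g \<sigma> = a \<cdot>\<^sub>v (U 1 *\<^sub>v gt \<sigma>)"
      by (rule fmat_of_vec_inj[rotated 3]) (use car Uc[of 1] in auto)
    then show ?thesis using t by blast
  qed
  then show ?thesis using ode by blast
qed

lemma Dmat_norm: "u \<in> {0..1} \<Longrightarrow> op_norm (2 * N) (Dmat u) \<le> 3 * \<epsilon> / (1 - 2 * \<epsilon>)"
proof -
  assume u: "u \<in> {0..1}"
  have "op_norm (2 * N) (\<lambda>p q. Re (ent (K (1 - u)) (p - 1) (q - 1))) \<le> 2 * \<epsilon> / (1 - 2 * \<epsilon>)"
    using u eps0 by (intro opnorm_le_op_norm K_opnorm_le corner_K cnjm_K) auto
  also have "\<dots> \<le> 3 * \<epsilon> / (1 - 2 * \<epsilon>)" using eps0 by (intro divide_right_mono) auto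
  finally show ?thesis by (simp add: Dm_def)
qed

lemma Dmat_decay:
  assumes r: "1 \<le> r" "has_range (2 * N) r V" and e4: "\<epsilon> < 1/4" and u: "u \<in> {0..1}"
    and p: "p \<in> {1..2*N}" and q: "q \<in> {1..2*N}"
  shows "\<bar>Dmat u p q\<bar> \<le> 1440 * \<epsilon> * (real r)\<^sup>2 * (2/3) powr (\<bar>real p - real q\<bar> / (4 * real r))"
proof -
  interpret lp: local_perturbation "2 * N" "hmat (2 * N) A0" "hmat (2 * N) VS" \<epsilon> r
  proof
    show "band r (hmat (2 * N) VS)"
      unfolding band_def
    proof (intro allI impI)
      fix i j assume ij: "i + r < j \<or> j + r < i"
      show "ent (hmat (2 * N) VS) i j = 0"
      proof (cases "i < 2 * N \<and> j < 2 * N")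
        case True
        then have "Suc i \<in> {1..2*N}" "Suc j \<in> {1..2*N}" "real r < \<bar>real (Suc i) - real (Suc j)\<bar>" using ij by auto
        then have "V (Suc i) (Suc j) = 0" using r(2) unfolding has_range_def by blast
        then show ?thesis by (simp add: hmat_def)
      qed (auto simp: hmat_def)
    qed
  qed (use r e4 band_hmat_A0 in auto)
  have "\<bar>Dmat u p q\<bar> \<le> cmod (ent (K (1 - u)) (p - 1) (q - 1))" by (simp add: Dm_def abs_Re_le_cmod)
  also have "\<dots> \<le> 1440 * \<epsilon> * (2/3) powr (\<bar>real (p - 1) - real (q - 1)\<bar> / (4 * real r))"
    by (rule lp.K_decay) (use u in auto)
  also have "\<bar>real (p - 1) - real (q - 1)\<bar> = \<bar>real p - real q\<bar>" using p q by (auto simp: of_nat_diff)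
  also have "1440 * \<epsilon> * (2/3) powr (\<bar>real p - real q\<bar> / (4 * real r))
      \<le> 1440 * \<epsilon> * (real r)\<^sup>2 * (2/3) powr (\<bar>real p - real q\<bar> / (4 * real r))"
  proof (rule mult_right_mono)
    have "1 \<le> (real r)\<^sup>2" using r(1) by (simp add: one_le_power)
    then show "1440 * \<epsilon> \<le> 1440 * \<epsilon> * (real r)\<^sup>2" using eps0 mult_left_mono[of 1 "(real r)\<^sup>2" "1440 * \<epsilon>"] by simp
  qed simp
  finally show ?thesis .
qed

end

theorem mainTheorem2:
  shows "\<exists>C::real. C > 0 \<and>
    (\<forall>(N::nat) (c::nat \<Rightarrow> complex mat) (V::nat \<Rightarrow> nat \<Rightarrow> real) (\<epsilon>::real) (r::nat)
       (g::nat \<Rightarrow> complex vec) (gt::nat \<Rightarrow> complex vec).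
       N \<ge> 2 \<and> majorana_ops N c \<and> r \<ge> 1 \<and> 0 \<le> \<epsilon> \<and> \<epsilon> < 1/2 \<and>
       real_antisym (2*N) V \<and> op_norm (2*N) V \<le> \<epsilon> \<and> has_range (2*N) r V \<and>
       (\<forall>\<sigma>\<in>{0,1}. ground_state (2^N) (parity_op N c) (H0_op N c) \<sigma> (g \<sigma>) \<and>
                   ground_state (2^N) (parity_op N c) (H0_op N c + quad_op N c V) \<sigma> (gt \<sigma>))
       \<longrightarrow>
       (\<exists>(D::real \<Rightarrow> nat \<Rightarrow> nat \<Rightarrow> real) (U::real \<Rightarrow> complex mat).
          (\<forall>u\<in>{0..1}. real_antisym (2*N) (D u)) \<and>
          solves_TO_ode (2^N) (\<lambda>u. quad_op N c (D u)) U \<and>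
          (\<forall>\<sigma>\<in>{0,1}. \<exists>\<theta>::real. g \<sigma> = exp (\<i> * complex_of_real \<theta>) \<cdot>\<^sub>v (U 1 *\<^sub>v gt \<sigma>)) \<and>
          (\<forall>u\<in>{0..1}. op_norm (2*N) (D u) \<le> 3*\<epsilon> / (1 - 2*\<epsilon>)) \<and>
          (\<epsilon> < 1/4 \<longrightarrow>
             (\<forall>u\<in>{0..1}. \<forall>p\<in>{1..2*N}. \<forall>q\<in>{1..2*N}.
                \<bar>D u p q\<bar> \<le> C * \<epsilon> * (real r)\<^sup>2 * (2/3) powr (\<bar>real p - real q\<bar> / (4 * real r))))))"
proof (intro exI[of _ "1440::real"] conjI allI impI)
  show "(0::real) < 1440" by simp
  fix N :: nat and c :: "nat \<Rightarrow> complex mat" and V :: "nat \<Rightarrow> nat \<Rightarrow> real" and \<epsilon> :: real and r :: nat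
    and g gt :: "nat \<Rightarrow> complex vec"
  assume a: "N \<ge> 2 \<and> majorana_ops N c \<and> r \<ge> 1 \<and> 0 \<le> \<epsilon> \<and> \<epsilon> < 1/2 \<and>
       real_antisym (2*N) V \<and> op_norm (2*N) V \<le> \<epsilon> \<and> has_range (2*N) r V \<and>
       (\<forall>\<sigma>\<in>{0,1}. ground_state (2^N) (parity_op N c) (H0_op N c) \<sigma> (g \<sigma>) \<and>
                   ground_state (2^N) (parity_op N c) (H0_op N c + quad_op N c V) \<sigma> (gt \<sigma>))"
  interpret perturbed_chain N c V \<epsilon> by unfold_locales (use a in auto)
  obtain U where U: "solves_TO_ode (2^N) (\<lambda>u. quad_op N c (Dmat u)) U"
    "\<forall>\<sigma>\<in>{0::nat,1}. \<exists>\<theta>::real. g \<sigma> = exp (\<i> * complex_of_real \<theta>) \<cdot>\<^sub>v (U 1 *\<^sub>v gt \<sigma>)"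
    using evolution[of g gt] a by blast
  show "\<exists>(D::real \<Rightarrow> nat \<Rightarrow> nat \<Rightarrow> real) (U::real \<Rightarrow> complex mat).
          (\<forall>u\<in>{0..1}. real_antisym (2*N) (D u)) \<and>
          solves_TO_ode (2^N) (\<lambda>u. quad_op N c (D u)) U \<and>
          (\<forall>\<sigma>\<in>{0,1}. \<exists>\<theta>::real. g \<sigma> = exp (\<i> * complex_of_real \<theta>) \<cdot>\<^sub>v (U 1 *\<^sub>v gt \<sigma>)) \<and>
          (\<forall>u\<in>{0..1}. op_norm (2*N) (D u) \<le> 3*\<epsilon> / (1 - 2*\<epsilon>)) \<and>
          (\<epsilon> < 1/4 \<longrightarrow>
             (\<forall>u\<in>{0..1}. \<forall>p\<in>{1..2*N}. \<forall>q\<in>{1..2*N}.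
                \<bar>D u p q\<bar> \<le> 1440 * \<epsilon> * (real r)\<^sup>2 * (2/3) powr (\<bar>real p - real q\<bar> / (4 * real r))))"
  proof (intro exI[of _ "\<lambda>u. Dmat u"] exI[of _ U] conjI ballI impI)
    show "real_antisym (2*N) (Dmat u)" if "u \<in> {0..1}" for u
      unfolding real_antisym_def using Dm_antisym[OF that] by blast
    show "solves_TO_ode (2^N) (\<lambda>u. quad_op N c (Dmat u)) U" by (rule U(1))
    show "\<exists>\<theta>::real. g \<sigma> = exp (\<i> * complex_of_real \<theta>) \<cdot>\<^sub>v (U 1 *\<^sub>v gt \<sigma>)" if "\<sigma> \<in> {0,1}" for \<sigma>
      using U(2) that by blast
    show "op_norm (2*N) (Dmat u) \<le> 3*\<epsilon> / (1 - 2*\<epsilon>)" if "u \<in> {0..1}" for u by (rule Dmat_norm[OF that])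
    show "\<bar>Dmat u p q\<bar> \<le> 1440 * \<epsilon> * (real r)\<^sup>2 * (2/3) powr (\<bar>real p - real q\<bar> / (4 * real r))"
      if "\<epsilon> < 1/4" "u \<in> {0..1}" "p \<in> {1..2*N}" "q \<in> {1..2*N}" for u p q
      using a that by (intro Dmat_decay) auto
  qed
qed

end
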